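(* There exists a constant $M_0$ with the following property: if the natural number $t$ has at least $M_0$ maximal blocks of $1$s in its binary expansion, then $c_t>1/2$.
   Context: For a nonnegative integer $n$, $s(n)$ denotes the binary sum of digits of $n$, i.e. the number of digits $1$ in the binary expansion of $n$. For an integer $t\ge 0$, \[c_t=\lim_{N\to\infty}\frac1N\bigl|\{0\le n<N: s(n+t)\ge s(n)\}\bigr|\] (this limit exists). A maximal block of $1$s in the binary expansion $t=\sum_i \varepsilon_i 2^i$ is a maximal run of consecutive digits $\varepsilon_\mu=\dots=\varepsilon_{\mu+\nu-1}=1$ (so $\varepsilon_{\mu+\nu}=0$ and either $\mu=0$ or $\varepsilon_{\mu-1}=0$). *)

theory Defs
  imports Complex_Main
begin

fun binsum :: "nat \<Rightarrow> nat" where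
  "binsum n = (if n = 0 then 0 else n mod 2 + binsum (n div 2))"

definition bdigit :: "nat \<Rightarrow> nat \<Rightarrow> nat" where
  "bdigit n i = (n div 2 ^ i) mod 2"

definition c_dens :: "nat \<Rightarrow> real" where
  "c_dens t = lim (\<lambda>N. real (card {n. n < N \<and> binsum (n + t) \<ge> binsum n}) / real N)"

text \<open>Number of maximal blocks of 1s in the binary expansion of t:
  each block is determined by its lowest position mu, where digit mu is 1 and
  either mu = 0 or digit (mu-1) is 0.\<close>
definition num_blocks :: "nat \<Rightarrow> nat" where
  "num_blocks t = card {mu. bdigit t mu = 1 \<and> (mu = 0 \<or> bdigit t (mu - 1) = 0)}"

end

theory Submission
  imports Defs "HOL-Analysis.Analysis"
begin

text \<open>
  Write \<open>s\<close> for the binary sum of digits and \<open>w = 1 - z\<close> with \<open>z\<close> on the unit circle. The characteristic functions of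
  \<open>s (n + t) - s n\<close> and \<open>s (n + t + 1) - s n\<close> evolve linearly when binary digits are appended to \<open>t\<close>.
  The extremal case is that of long blocks of ones separated by single zeros: there the distribution
  is close to a centred negative binomial one, with characteristic function \<open>phi ^ m\<close>, \<open>phi = 1 / (1 - w\<^sup>2)\<close>,
  and since this is even in \<open>w\<close>, the nonnegative integers have mass exactly \<open>1/2\<close>. In general
  the characteristic function is compared with a product \<open>Phi\<close> of mixtures of \<open>1\<close> and \<open>phi\<close>, one for each digit zero,
  which agrees with it up to the order \<open>w\<^sup>2\<close> and still has mass at least \<open>1/2\<close> there. The difference is a sum over the digits zero of
  terms \<open>w\<^sup>3 * gain\<close> with \<open>gain \<ge> 0\<close> and total gain at least \<open>2\<close>, up to errors of order \<open>w\<^sup>4\<close> which are controlled by the gains.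
  If \<open>t\<close> has \<open>N\<close> blocks, all factors decay like \<open>exp (- c * N * \<bar>w\<bar>\<^sup>2)\<close>; integration over the circle then gives a surplus
  of order \<open>N powr (-3/2)\<close> times the total gain, and the errors are of smaller order.
\<close>

section \<open>Recursion over binary digits\<close>

text \<open>A normal approximation loses exactly what matters here. A symmetric law on the integers
  gives the nonnegative ones a surplus of half its mass at 0, which is of order
  \<open>N powr (-1/2)\<close>; for \<open>phi ^ m\<close> the skewness cancels that surplus
  completely. What must be detected is smaller by a factor of order \<open>N\<close>, so the mass of
  the comparison law has to be known exactly, by parity in \<open>w\<close>, and only the difference
  to it is estimated. The number of zeros is not bounded in terms of the number of blocks. Sums over
  zeros are therefore bounded in terms of falls, using geometric decay along each run. Long runs are
  the delicate case: after \<open>l\<close> equal digits the gain is only known to be of order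
  \<open>l / 2 ^ l\<close>, while the error bound has order \<open>l ^ 2 / 2 ^ l\<close>. A
  threshold \<open>L\<close> separates the runs: short ones have error at most a multiple of
  \<open>L * gain\<close>, long ones at most a multiple of \<open>1 / L ^ 2\<close> each. Taking
  \<open>L\<close> as a small multiple of \<open>sqrt N\<close> makes the first part a small
  fraction of the surplus and keeps the sum of the second part bounded.\<close>

function bin_rec :: "'s \<Rightarrow> (nat \<Rightarrow> 's \<Rightarrow> 's) \<Rightarrow> (nat \<Rightarrow> 's \<Rightarrow> 's) \<Rightarrow> nat \<Rightarrow> 's" where
  "bin_rec c f0 f1 t =
     (if t = 0 then c
      else if even t then f0 (t div 2) (bin_rec c f0 f1 (t div 2))
      else f1 (t div 2) (bin_rec c f0 f1 (t div 2)))"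
  by pat_completeness auto
termination by (relation "Wellfounded.measure (\<lambda>(_, _, _, t). t)") auto

declare bin_rec.simps [simp del]

lemma bin_rec_0 [simp]: "bin_rec c f0 f1 0 = c"
  by (simp add: bin_rec.simps)

lemma bin_rec_even: "t > 0 \<Longrightarrow> bin_rec c f0 f1 (2 * t) = f0 t (bin_rec c f0 f1 t)"
  by (subst bin_rec.simps) simp

text \<open>If \<open>f0\<close> fixes the start value, leading zeros are harmless and the rule for
  an appended zero also holds at 0.\<close>

lemma bin_rec_even': "f0 0 c = c \<Longrightarrow> bin_rec c f0 f1 (2 * t) = f0 t (bin_rec c f0 f1 t)"
  by (cases "t = 0") (simp_all add: bin_rec_even)

lemma bin_rec_odd: "bin_rec c f0 f1 (Suc (2 * t)) = f1 t (bin_rec c f0 f1 t)"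
  by (subst bin_rec.simps) simp

lemma bin_induct [case_names zero even odd]:
  assumes "P 0" and "\<And>t. t > 0 \<Longrightarrow> P t \<Longrightarrow> P (2 * t)" and "\<And>t. P t \<Longrightarrow> P (Suc (2 * t))"
  shows "P (t::nat)"
proof (induction t rule: less_induct)
  case (less t)
  show ?case
  proof (cases "t = 0")
    case False
    have IH: "P (t div 2)" using False by (intro less) simp
    show ?thesis
    proof (cases "even t")
      case True
      then have "t div 2 > 0" using False by (auto elim!: evenE)
      from assms(2)[OF this IH] True show ?thesis by simp
    next
      case False
      with assms(3)[OF IH] show ?thesis by simp
    qed
  qed (use assms(1) in simp)
qed

definition blocks :: "nat \<Rightarrow> nat" where
  "blocks = bin_rec 0 (\<lambda>_ n. n) (\<lambda>t n. if even t then n + 1 else n)"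

text \<open>The number of occurrences of \<open>10\<close> in the binary expansion.\<close>
definition falls :: "nat \<Rightarrow> nat" where
  "falls t = (if even t then blocks t else blocks t - 1)"

definition last_run :: "nat \<Rightarrow> nat" where
  "last_run = bin_rec 0 (\<lambda>t l. if even t then l + 1 else 1) (\<lambda>t l. if even t then 1 else l + 1)"

text \<open>\<open>x0\<close> and \<open>x1\<close> are the first coefficients of the expansion of \<open>YY z t / BB z t\<close> (defined below) in powers of \<open>1 - z\<close>.\<close>
definition x0 :: "nat \<Rightarrow> real" where
  "x0 = bin_rec 0 (\<lambda>_ x. x / 2) (\<lambda>_ x. x / 2 + 1)"

definition x1 :: "nat \<Rightarrow> real" where
  "x1 = bin_rec 0 (\<lambda>t x. (x + x0 t) / 2) (\<lambda>t x. (x - x0 t) / 2 + 2)"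

text \<open>Each zero below the leading one contributes \<open>f\<close> evaluated at the prefix
  above that zero.\<close>

definition zsum :: "(nat \<Rightarrow> real) \<Rightarrow> nat \<Rightarrow> real" where
  "zsum f = bin_rec 0 (\<lambda>t s. s + f t) (\<lambda>_ s. s)"

text \<open>With \<open>w = 1 - z\<close>, this is the coefficient of \<open>w\<close> in
  \<open>(1 - w) * (x0 t + x1 t * w) / 2 - x0 t / 2\<close>, the leading part of
  \<open>delta z t / BB z t\<close>.\<close>

definition gain :: "nat \<Rightarrow> real" where
  "gain t = (x1 t - x0 t) / 2"

text \<open>Each digit halves the expansion coefficients and mixes lower orders into higher ones, so
  after a run of length \<open>l\<close> the second-order terms are of size
  \<open>l ^ 2 / 2 ^ l\<close>.\<close>

definition dev :: "nat \<Rightarrow> real" where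
  "dev t = (1 + real (last_run t))\<^sup>2 / 2 ^ last_run t"

section \<open>Digit statistics and bounds for the coefficients along a run\<close>

lemma blocks_simps [simp]:
  "blocks 0 = 0" "blocks (2 * t) = blocks t"
  "blocks (Suc (2 * t)) = (if even t then blocks t + 1 else blocks t)"
  by (simp_all add: blocks_def bin_rec_even' bin_rec_odd)

lemma last_run_simps:
  "last_run 0 = 0" "t > 0 \<Longrightarrow> last_run (2 * t) = (if even t then last_run t + 1 else 1)"
  "last_run (Suc (2 * t)) = (if even t then 1 else last_run t + 1)"
  by (simp_all add: last_run_def bin_rec_even bin_rec_odd)

lemma x0_simps [simp]:
  "x0 0 = 0" "x0 (2 * t) = x0 t / 2" "x0 (Suc (2 * t)) = x0 t / 2 + 1"
  by (simp_all add: x0_def bin_rec_even' bin_rec_odd)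

lemma x1_simps [simp]:
  "x1 0 = 0" "x1 (2 * t) = (x1 t + x0 t) / 2" "x1 (Suc (2 * t)) = (x1 t - x0 t) / 2 + 2"
  by (simp_all add: x1_def bin_rec_even' bin_rec_odd)

lemma zsum_simps:
  "zsum f 0 = 0" "t > 0 \<Longrightarrow> zsum f (2 * t) = zsum f t + f t" "zsum f (Suc (2 * t)) = zsum f t"
  by (simp_all add: zsum_def bin_rec_even bin_rec_odd)

lemma blocks_pos: "odd t \<Longrightarrow> blocks t \<ge> 1"
  by (induction t rule: bin_induct) auto

lemma falls_simps:
  "falls 0 = 0" "falls (2 * t) = (if even t then falls t else falls t + 1)"
  "falls (Suc (2 * t)) = falls t"
  using blocks_pos[of t] by (auto simp: falls_def)

lemma blocks_eq_falls: "blocks t = (if even t then falls t else falls t + 1)"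
  using blocks_pos[of t] by (auto simp: falls_def)

lemma last_run_pos: "t > 0 \<Longrightarrow> last_run t \<ge> 1"
  by (induction t rule: bin_induct) (auto simp: last_run_simps)

lemma x0_nonneg: "x0 t \<ge> 0"
  by (induction t rule: bin_induct) auto

lemma x0_le: "x0 t \<le> 2"
  by (induction t rule: bin_induct) auto

lemma x0_le_x1: "x0 t \<le> x1 t"
proof (induction t rule: bin_induct)
  case (even t) then show ?case using x0_nonneg[of t] by simp
next
  case (odd t) then show ?case using x0_le[of t] unfolding x0_simps x1_simps by (simp add: field_simps)
qed simp

lemma x1_le: "x1 t \<le> 4"
proof (induction t rule: bin_induct)
  case (even t) then show ?case using x0_le[of t] by simp
next
  case (odd t) then show ?case using x0_nonneg[of t] unfolding x1_simps by (simp add: field_simps)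
qed simp

lemma x1_odd_ge: "odd t \<Longrightarrow> x1 t \<ge> 2"
  using x0_le_x1[of "t div 2"] x1_simps(3)[of "t div 2"] by simp

lemma gain_nonneg: "gain t \<ge> 0"
  using x0_le_x1[of t] by (simp add: gain_def)

lemma dev_nonneg: "dev t \<ge> 0"
  by (simp add: dev_def)

text \<open>An appended zero acts on \<open>(x0, x1)\<close> by a Jordan block with eigenvalue 1/2,
  hence the decay like \<open>1 / 2 ^ l\<close> and \<open>l / 2 ^ l\<close> along \<open>l\<close>
  zeros.\<close>

lemma run_even_bounds:
  assumes "even t" "t > 0"
  shows "1 / 2 ^ last_run t \<le> x0 t" "x0 t \<le> 2 / 2 ^ last_run t"
    "x1 t \<le> (4 + 2 * real (last_run t)) / 2 ^ last_run t"
    "real (last_run t) / 2 ^ last_run t \<le> x1 t - x0 t"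
proof -
  have "1 / 2 ^ last_run t \<le> x0 t \<and> x0 t \<le> 2 / 2 ^ last_run t \<and>
        x1 t \<le> (4 + 2 * real (last_run t)) / 2 ^ last_run t \<and>
        real (last_run t) / 2 ^ last_run t \<le> x1 t - x0 t"
    using assms
  proof (induction t rule: bin_induct)
    case (even t)
    show ?case
    proof (cases "even t")
      case True
      have IH: "1 / 2 ^ last_run t \<le> x0 t" "x0 t \<le> 2 / 2 ^ last_run t"
        "x1 t \<le> (4 + 2 * real (last_run t)) / 2 ^ last_run t"
        "real (last_run t) / 2 ^ last_run t \<le> x1 t - x0 t"
        using even True by auto
      have l: "last_run (2 * t) = last_run t + 1"
        using True even by (simp add: last_run_simps)
      show ?thesis
        unfolding l x0_simps x1_simps using IH by (simp add: field_simps)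
    next
      case False
      then obtain s where s: "t = Suc (2 * s)" by (metis oddE Suc_eq_plus1)
      have "x0 t \<ge> 1" using x0_nonneg[of s] s by simp
      moreover have "last_run (2 * t) = 1" using False even by (simp add: last_run_simps)
      ultimately show ?thesis
        using x0_le[of t] x1_le[of t] x1_odd_ge[OF False] x0_le_x1[of t]
        by (simp add: add_divide_distrib)
    qed
  qed auto
  then show "1 / 2 ^ last_run t \<le> x0 t" "x0 t \<le> 2 / 2 ^ last_run t"
    "x1 t \<le> (4 + 2 * real (last_run t)) / 2 ^ last_run t"
    "real (last_run t) / 2 ^ last_run t \<le> x1 t - x0 t" by auto
qed

lemma x0_even_le: "even t \<Longrightarrow> x0 t \<le> 1"
  using x0_le[of "t div 2"] x0_simps(2)[of "t div 2"] by auto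

text \<open>For appended ones the fixed point of \<open>(x0, x1)\<close> is \<open>(2, 2)\<close>;
  in the coordinates \<open>2 - x0\<close> and \<open>x1 - 2\<close> the map is again a Jordan block
  with eigenvalue 1/2.\<close>

lemma run_odd_bounds:
  assumes "odd t"
  shows "1 / 2 ^ last_run t \<le> 2 - x0 t" "2 - x0 t \<le> 2 / 2 ^ last_run t"
    "\<bar>x1 t - 2\<bar> \<le> (2 + 2 * real (last_run t)) / 2 ^ last_run t"
    "real (last_run t) / 2 ^ last_run t \<le> x1 t - x0 t"
proof -
  have "1 / 2 ^ last_run t \<le> 2 - x0 t \<and> 2 - x0 t \<le> 2 / 2 ^ last_run t \<and>
        \<bar>x1 t - 2\<bar> \<le> (2 + 2 * real (last_run t)) / 2 ^ last_run t \<and>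
        real (last_run t) / 2 ^ last_run t \<le> x1 t - x0 t"
    using assms
  proof (induction t rule: bin_induct)
    case (odd t)
    have v: "x1 (Suc (2 * t)) - x0 (Suc (2 * t)) = ((x1 t - x0 t) + (2 - x0 t)) / 2"
      unfolding x0_simps x1_simps by (simp add: field_simps)
    have h: "x1 (Suc (2 * t)) - 2 = ((x1 t - 2) + (2 - x0 t)) / 2"
      unfolding x0_simps x1_simps by (simp add: field_simps)
    have u: "2 - x0 (Suc (2 * t)) = (2 - x0 t) / 2"
      unfolding x0_simps x1_simps by (simp add: field_simps)
    show ?case
    proof (cases "odd t")
      case True
      have IH: "1 / 2 ^ last_run t \<le> 2 - x0 t" "2 - x0 t \<le> 2 / 2 ^ last_run t"
        "\<bar>x1 t - 2\<bar> \<le> (2 + 2 * real (last_run t)) / 2 ^ last_run t"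
        "real (last_run t) / 2 ^ last_run t \<le> x1 t - x0 t"
        using odd True by auto
      have l: "last_run (Suc (2 * t)) = last_run t + 1"
        using True by (simp add: last_run_simps)
      have "\<bar>x1 (Suc (2 * t)) - 2\<bar> \<le> (\<bar>x1 t - 2\<bar> + (2 - x0 t)) / 2"
        unfolding h abs_divide using x0_le[of t] abs_triangle_ineq[of "x1 t - 2" "2 - x0 t"] by simp
      also have "\<dots> \<le> ((2 + 2 * real (last_run t)) / 2 ^ last_run t + 2 / 2 ^ last_run t) / 2"
        using IH by (intro divide_right_mono add_mono) auto
      also have "\<dots> = (2 + 2 * real (last_run t + 1)) / 2 ^ (last_run t + 1)"
        by (simp add: field_simps)
      finally have "\<bar>x1 (Suc (2 * t)) - 2\<bar> \<le> (2 + 2 * real (last_run t + 1)) / 2 ^ (last_run t + 1)" .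
      moreover have "real (last_run t + 1) / 2 ^ (last_run t + 1) \<le> x1 (Suc (2 * t)) - x0 (Suc (2 * t))"
        unfolding v using IH by (simp add: add_divide_distrib)
      ultimately show ?thesis
        unfolding u l using IH by simp
    next
      case False
      have l: "last_run (Suc (2 * t)) = 1"
        using False by (simp add: last_run_simps)
      show ?thesis
        unfolding u v h l
        using x0_even_le[of t] False x0_nonneg[of t] x0_le_x1[of t] x1_le[of t]
        by (auto simp: abs_if)
    qed
  qed auto
  then show "1 / 2 ^ last_run t \<le> 2 - x0 t" "2 - x0 t \<le> 2 / 2 ^ last_run t"
    "\<bar>x1 t - 2\<bar> \<le> (2 + 2 * real (last_run t)) / 2 ^ last_run t"
    "real (last_run t) / 2 ^ last_run t \<le> x1 t - x0 t" by auto
qed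

lemma gain_ge: "t > 0 \<Longrightarrow> gain t \<ge> real (last_run t) / 2 ^ last_run t / 2"
  using run_odd_bounds(4)[of t] run_even_bounds(4)[of t] by (auto simp: gain_def)

section \<open>Sums over zeros bounded by the number of falls\<close>

lemma zsum_nonneg: "(\<And>s. f s \<ge> 0) \<Longrightarrow> zsum f t \<ge> 0"
  by (induction t rule: bin_induct) (simp_all add: zsum_simps)

text \<open>The tail sum \<open>\<Sum>i\<ge>l. (1 + i)\<^sup>2 / 2 ^ i\<close>, which pays for a whole run of zeros in advance.\<close>
definition pot :: "nat \<Rightarrow> real" where
  "pot l = (2 * real l ^ 2 + 8 * real l + 12) / 2 ^ l"

lemma pot_Suc: "pot (l + 1) + (1 + real l)\<^sup>2 / 2 ^ l = pot l"
  by (simp add: pot_def field_simps power2_eq_square)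

lemma pot_nonneg: "pot l \<ge> 0"
  by (simp add: pot_def)

lemma square_le_power2: "(1 + real l)\<^sup>2 \<le> 3 * 2 ^ l"
proof (cases "l \<le> 3")
  case True
  then have "l = 0 \<or> l = 1 \<or> l = 2 \<or> l = 3" by auto
  then show ?thesis by (auto simp: power2_eq_square)
next
  case False
  then have "3 \<le> l" by simp
  then show ?thesis
  proof (induction l rule: dec_induct)
    case (step n)
    have "3 * real n \<le> real n * real n" using step by (intro mult_right_mono) auto
    moreover have "3 * 3 \<le> real n * real n" using step by (intro mult_mono) auto
    ultimately have "(1 + real (Suc n))\<^sup>2 \<le> 2 * (1 + real n)\<^sup>2"
      unfolding power2_eq_square of_nat_Suc by (simp add: algebra_simps)
    also have "\<dots> \<le> 3 * 2 ^ Suc n" using step by simp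
    finally show ?case .
  qed (simp add: power2_eq_square)
qed

lemma dev_le: "dev t \<le> 3"
  using square_le_power2[of "last_run t"] by (simp add: dev_def field_simps)

text \<open>The cost of one zero, in units of \<open>norm (1 - z) ^ 3\<close>, of replacing
  \<open>BB\<close> by the real product \<open>EE\<close>: the first summand comes from
  \<open>norm_qf_minus_real\<close>, the others from \<open>norm_delta_le\<close>.\<close>

definition wt :: "nat \<Rightarrow> real" where
  "wt t = x0 t / 2 + 3 * gain t + 64 * dev t"

lemma wt_nonneg: "wt t \<ge> 0"
  using x0_nonneg[of t] gain_nonneg[of t] dev_nonneg[of t] by (simp add: wt_def)

lemma wt_even_le:
  assumes "even t" "t > 0"
  shows "wt t \<le> 72 * dev t"
proof -
  let ?l = "real (last_run t)" and ?J = "1 / 2 ^ last_run t :: real"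
  have x: "x0 t \<ge> 0" "x0 t \<le> 2 * ?J" "x1 t \<le> (4 + 2 * ?l) * ?J"
    using run_even_bounds[OF assms] x0_nonneg[of t] by auto
  have "wt t \<le> x0 t / 2 + 3 / 2 * x1 t + 64 * dev t"
    using x by (simp add: wt_def gain_def)
  also have "\<dots> \<le> ?J + 3 / 2 * ((4 + 2 * ?l) * ?J) + 64 * dev t"
    using x by (intro add_mono mult_left_mono) auto
  also have "\<dots> = ?J * (7 + 3 * ?l) + 64 * dev t"
    by (simp add: field_simps)
  also have "\<dots> \<le> ?J * (8 * (1 + ?l)\<^sup>2) + 64 * dev t"
    by (intro add_right_mono mult_left_mono) (auto simp: power2_eq_square algebra_simps)
  also have "\<dots> = 72 * dev t" by (simp add: dev_def)
  finally show ?thesis .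
qed

text \<open>Each fall deposits 1000. The first zero of a run uses at most 200, and
  \<open>72 * pot 1 = 792\<close> is kept in reserve for the later zeros of the same run.\<close>

lemma zsum_wt_le_aux:
  "zsum wt t + (if even t \<and> t > 0 then 72 * pot (last_run t) else 0) \<le> 1000 * real (falls t)"
proof (induction t rule: bin_induct)
  case (even t)
  show ?case
  proof (cases "even t")
    case True
    have "last_run (2 * t) = last_run t + 1" using True even by (simp add: last_run_simps)
    then show ?thesis
      using even True wt_even_le[of t] pot_Suc[of "last_run t"]
      by (simp add: zsum_simps falls_simps dev_def)
  next
    case False
    have "last_run (2 * t) = 1" using False even by (simp add: last_run_simps)
    moreover have "wt t \<le> 200"
      using dev_le[of t] x0_le[of t] x1_le[of t] x0_nonneg[of t] unfolding wt_def gain_def by argo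
    moreover have "pot 1 = 11" by (simp add: pot_def)
    ultimately show ?thesis
      using even False by (simp add: zsum_simps falls_simps)
  qed
next
  case (odd t)
  then show ?case
    using pot_nonneg[of "last_run t"] by (simp add: zsum_simps falls_simps split: if_splits)
qed (simp add: zsum_simps falls_simps)

lemma zsum_wt_le: "zsum wt t \<le> 1000 * real (falls t)"
  using zsum_wt_le_aux[of t] pot_nonneg[of "last_run t"] by (simp split: if_splits)

lemma fourth_power_le: "real k ^ 4 \<le> 32 * 2 ^ k"
proof (cases "k \<le> 8")
  case True
  then have "k \<in> {0..8}" by simp
  also have "{0..8} = {0,1,2,3,4,5,6,7,8::nat}" by auto
  finally show ?thesis by auto
next
  case False
  then have "8 \<le> k" by simp
  then show ?thesis
  proof (induction k rule: dec_induct)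
    case (step n)
    have "1 + real n \<le> 9 / 8 * real n" using step by simp
    then have "(1 + real n) ^ 4 \<le> (9 / 8 * real n) ^ 4" by (intro power_mono) auto
    also have "\<dots> = 6561 / 4096 * real n ^ 4" by (simp add: power_mult_distrib power_divide)
    also have "\<dots> \<le> 2 * real n ^ 4" by (intro mult_right_mono) auto
    also have "\<dots> \<le> 32 * 2 ^ Suc n" using step by simp
    finally show ?case by simp
  qed simp
qed

text \<open>For runs up to \<open>L\<close>, one factor \<open>last_run t\<close> in
  \<open>dev\<close> is traded for \<open>L\<close>; for longer ones two extra factors
  \<open>last_run t / L\<close> are inserted, and \<open>k ^ 4 / 2 ^ k\<close> is bounded.\<close>

lemma dev_le_gain:
  assumes "t > 0" "L \<ge> 1"
  shows "dev t \<le> 128 * (L * gain t + 1 / L\<^sup>2)"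
proof -
  let ?k = "real (last_run t)" and ?J = "1 / 2 ^ last_run t :: real"
  have k: "?k \<ge> 1" using last_run_pos[OF assms(1)] by simp
  have g: "gain t \<ge> ?k * ?J / 2" using gain_ge[OF assms(1)] by simp
  have "(1 + ?k)\<^sup>2 \<le> (2 * ?k)\<^sup>2" using k by (intro power_mono) auto
  then have "(1 + ?k)\<^sup>2 * ?J \<le> (2 * ?k)\<^sup>2 * ?J" by (intro mult_right_mono) auto
  then have d: "dev t \<le> 4 * (?k * ?k * ?J)" by (simp add: dev_def power2_eq_square)
  show ?thesis
  proof (cases "?k \<le> L")
    case True
    have "?k * ?J \<le> 2 * gain t" using g by simp
    then have "?k * (?k * ?J) \<le> L * (2 * gain t)"
      using True assms by (intro mult_mono[of ?k L]) auto
    moreover have "0 \<le> 1 / L\<^sup>2" "0 \<le> L * gain t" using gain_nonneg[of t] assms by simp_all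
    ultimately show ?thesis using d unfolding mult.assoc distrib_left by linarith
  next
    case False
    have "?k * ?k * ?J * L\<^sup>2 \<le> ?k * ?k * ?J * ?k\<^sup>2"
      using False assms by (intro mult_left_mono power_mono) auto
    also have "\<dots> = ?k ^ 4 * ?J" by (simp add: power2_eq_square power4_eq_xxxx)
    also have "\<dots> \<le> 32" using fourth_power_le[of "last_run t"] by (simp add: field_simps)
    finally have "4 * (?k * ?k * ?J) \<le> 128 * (1 / L\<^sup>2)" using assms by (simp add: field_simps)
    moreover have "0 \<le> L * gain t" using gain_nonneg[of t] assms by simp
    ultimately show ?thesis using d unfolding distrib_left by linarith
  qed
qed

text \<open>Runs of zeros of length at least two are paid for by the gain at their second zero.\<close>
lemma zsum_dev_le_aux:
  assumes L: "L \<ge> 1"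
  shows "zsum dev t + (if even t \<and> last_run t \<ge> 2 then pot (last_run t) else 0)
           \<le> 128 * (L * zsum gain t + real (falls t) / L\<^sup>2)"
proof (induction t rule: bin_induct)
  case (even t)
  show ?case
  proof (cases "even t")
    case True
    have l: "last_run (2 * t) = last_run t + 1" using True even by (simp add: last_run_simps)
    have g: "0 \<le> L * gain t" using gain_nonneg[of t] L by simp
    have e: "zsum dev (2 * t) = zsum dev t + dev t" "zsum gain (2 * t) = zsum gain t + gain t"
      "falls (2 * t) = falls t"
      using even True by (simp_all add: zsum_simps falls_simps)
    show ?thesis
    proof (cases "last_run t \<ge> 2")
      case True
      then show ?thesis
        using even \<open>even t\<close> g pot_Suc[of "last_run t", folded dev_def]
        unfolding e l by (simp add: distrib_left)
    next
      case False
      with last_run_pos[of t] even have l1: "last_run t = 1" by simp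
      \<comment> \<open>At the second zero \<open>128 * (1 / 4)\<close> covers
        \<open>dev t + pot 2 = 11\<close>.\<close>
      have "gain t \<ge> 1 / 4" using gain_ge[of t] even l1 by simp
      then have "L * gain t \<ge> 1 * (1 / 4)" using L by (intro mult_mono) auto
      moreover have "pot 2 = 9" "dev t = 2" by (simp_all add: pot_def dev_def l1)
      ultimately show ?thesis
        using even \<open>even t\<close> l1 unfolding e l by (simp add: distrib_left numeral_2_eq_2)
    qed
  next
    case False
    have "last_run (2 * t) = 1" using False even by (simp add: last_run_simps)
    then show ?thesis
      using even False dev_le_gain[OF even(1) L]
      by (simp add: zsum_simps falls_simps distrib_left add_divide_distrib)
  qed
next
  case (odd t)
  then show ?case
    using pot_nonneg[of "last_run t"] by (simp add: zsum_simps falls_simps split: if_splits)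
qed (simp add: zsum_simps falls_simps last_run_simps)

lemma zsum_dev_le:
  "L \<ge> 1 \<Longrightarrow> zsum dev t \<le> 128 * (L * zsum gain t + real (falls t) / L\<^sup>2)"
  using zsum_dev_le_aux[of L t] pot_nonneg[of "last_run t"] by (simp split: if_splits)

section \<open>Characteristic functions on the unit circle\<close>

text \<open>A geometric law shifted by one: the value \<open>k - 1\<close> has weight
  \<open>1 / 2 ^ (k + 1)\<close> for \<open>k \<ge> 0\<close>.\<close>

definition phi :: "complex \<Rightarrow> complex" where "phi z = 1 / (z * (2 - z))"

text \<open>The mirror image of \<open>phi\<close>, the characteristic function of
  \<open>s (n + 1) - s n\<close>. It is the fixed point of
  \<open>x \<mapsto> (z + x / z) / 2\<close>.\<close>

definition psi :: "complex \<Rightarrow> complex" where "psi z = z\<^sup>2 / (2 * z - 1)"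

text \<open>The decay charged for one fall or one block. Since \<open>norm (1 - z) \<le> 2\<close>,
  it is at least 5/6, which lets constants absorb a single factor \<open>tau\<close>.\<close>

definition tau :: "complex \<Rightarrow> real" where "tau z = 1 - (norm (1 - z))\<^sup>2 / 24"

text \<open>Adapted coordinates for the two characteristic functions \<open>chi0\<close>,
  \<open>chi1\<close> below: the first is \<open>chi1 / psi\<close>, the second
  \<open>(chi0 - chi1 / psi) / (psi * (1 - z)\<^sup>2)\<close>. A one leaves the first unchanged and
  a zero alters it only by the order \<open>(1 - z)\<^sup>2\<close>; the second is halved in modulus
  by every digit, apart from a source term at ones.\<close>

definition BY :: "complex \<Rightarrow> nat \<Rightarrow> complex \<times> complex" where
  "BY z = bin_rec (1, 0) (\<lambda>_ (b, y). (b + z / 2 * (1 - z)\<^sup>2 * y, y / (2 * z)))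
                         (\<lambda>_ (b, y). (b, z / 2 * y + b / z\<^sup>2))"

definition BB :: "complex \<Rightarrow> nat \<Rightarrow> complex" where "BB z t = fst (BY z t)"
definition YY :: "complex \<Rightarrow> nat \<Rightarrow> complex" where "YY z t = snd (BY z t)"

lemma BB_simps [simp]:
  "BB z 0 = 1" "BB z (2 * t) = BB z t + z / 2 * (1 - z)\<^sup>2 * YY z t" "BB z (Suc (2 * t)) = BB z t"
  by (simp_all add: BB_def YY_def BY_def bin_rec_even' bin_rec_odd split_beta)

lemma YY_simps [simp]:
  "YY z 0 = 0" "YY z (2 * t) = YY z t / (2 * z)" "YY z (Suc (2 * t)) = z / 2 * YY z t + BB z t / z\<^sup>2"
  by (simp_all add: BB_def YY_def BY_def bin_rec_even' bin_rec_odd split_beta)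

text \<open>The characteristic functions of \<open>s (n + t) - s n\<close> and of \<open>s (n + t + 1) - s n\<close>.\<close>
definition chi0 :: "complex \<Rightarrow> nat \<Rightarrow> complex" where
  "chi0 z t = BB z t + psi z * (1 - z)\<^sup>2 * YY z t"

definition chi1 :: "complex \<Rightarrow> nat \<Rightarrow> complex" where
  "chi1 z t = psi z * BB z t"

text \<open>After squaring, \<open>1 \<le> (1 - x / 6) * (1 + 2 * x)\<close> is enough. The range up
  to 4 is that of \<open>(norm (1 - z))\<^sup>2\<close> on the unit circle.\<close>

lemma inverse_bound_aux:
  fixes x v :: real
  assumes "v\<^sup>2 = 1 + 2 * x" "v \<ge> 1" "0 \<le> x" "x \<le> 4"
  shows "1 / v \<le> 1 - x / 12"
proof -
  have "x * x \<le> 4 * x" using assms by (intro mult_right_mono) auto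
  then have "1 \<le> (1 - x / 6) * (1 + 2 * x)"
    using assms by (simp add: algebra_simps)
  also have "\<dots> \<le> (1 - x / 12)\<^sup>2 * v\<^sup>2"
    unfolding assms(1) using assms by (intro mult_right_mono) (auto simp: power2_eq_square algebra_simps)
  also have "\<dots> = ((1 - x / 12) * v)\<^sup>2" by (simp add: power_mult_distrib)
  finally have "1 \<le> ((1 - x / 12) * v)\<^sup>2" .
  moreover have "0 \<le> (1 - x / 12) * v" using assms by (intro mult_nonneg_nonneg) auto
  ultimately have "1 \<le> (1 - x / 12) * v"
    by (metis abs_of_nonneg abs_one one_power2 power2_le_iff_abs_le real_sqrt_abs real_sqrt_ge_1_iff)
  then show ?thesis using assms by (simp add: field_simps)
qed

context
  fixes z :: complex
  assumes z: "norm z = 1"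
begin

lemma norm_2_minus_ge: "norm (2 - z) \<ge> 1"
  using norm_triangle_ineq2[of 2 z] z by simp

lemma norm_2z_minus_ge: "norm (2 * z - 1) \<ge> 1"
  using norm_triangle_ineq2[of "2 * z" 1] z by (simp add: norm_mult)

lemma norm_2z_minus_le: "norm (2 * z - 1) \<le> 3"
  using norm_triangle_ineq4[of "2 * z" 1] z by (simp add: norm_mult)

lemma unit_nonzero: "z \<noteq> 0" "2 - z \<noteq> 0" "2 * z - 1 \<noteq> 0"
  using z norm_2_minus_ge norm_2z_minus_ge by (auto simp del: right_minus_eq)

lemma norm_w_le: "norm (1 - z) \<le> 2"
  using norm_triangle_ineq4[of 1 z] z by simp

lemma norm_w_sq_le: "(norm (1 - z))\<^sup>2 \<le> 4"
  using power_mono[OF norm_w_le, of 2] by simp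

lemma norm_phi: "norm (phi z) = 1 / norm (2 - z)"
  using z by (simp add: phi_def norm_mult norm_divide)

lemma norm_phi_le: "norm (phi z) \<le> 1"
  using norm_2_minus_ge by (auto simp: norm_phi divide_le_eq_1)

lemma norm_psi: "norm (psi z) = 1 / norm (2 * z - 1)"
  using z by (simp add: psi_def norm_power norm_divide)

lemma norm_psi_le: "norm (psi z) \<le> 1"
  using norm_2z_minus_ge by (auto simp: norm_psi divide_le_eq_1)

lemma Re_Im_unit: "(Re z)\<^sup>2 + (Im z)\<^sup>2 = 1"
  using z by (simp add: cmod_def)

lemma norm_w_sq: "(norm (1 - z))\<^sup>2 = 2 - 2 * Re z"
  using Re_Im_unit unfolding cmod_power2 by (simp add: power2_eq_square algebra_simps)

lemma inverse_unit: "1 / z = cnj z"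
  using z by (metis complex_cnj_divide complex_cnj_one complex_div_cnj complex_mod_cnj div_by_1 mult_1 power_one of_real_1)

lemma norm_half_quarter: "norm (z / 2 + 1 / 4) \<le> 3 / 4 - (norm (1 - z))\<^sup>2 / 12"
proof (rule power2_le_imp_le)
  have "(norm (z / 2 + 1 / 4))\<^sup>2 = 5 / 16 + Re z / 4"
    using Re_Im_unit unfolding cmod_power2 by (simp add: power2_eq_square algebra_simps)
  also have "\<dots> = 9 / 16 - (norm (1 - z))\<^sup>2 / 8"
    unfolding norm_w_sq by (simp add: field_simps)
  also have "\<dots> \<le> (3 / 4 - (norm (1 - z))\<^sup>2 / 12)\<^sup>2"
    by (simp add: power2_eq_square algebra_simps)
  finally show "(norm (z / 2 + 1 / 4))\<^sup>2 \<le> (3 / 4 - (norm (1 - z))\<^sup>2 / 12)\<^sup>2" .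
  show "0 \<le> 3 / 4 - (norm (1 - z))\<^sup>2 / 12" using norm_w_sq_le by simp
qed

lemma norm_half_quarter': "norm (1 / 4 + 1 / (2 * z)) \<le> 3 / 4 - (norm (1 - z))\<^sup>2 / 12"
proof -
  have "1 / 4 + 1 / (2 * z) = 1 / 4 + (1 / z) / 2" by simp
  also have "\<dots> = cnj (z / 2 + 1 / 4)" by (simp add: inverse_unit)
  finally show ?thesis using norm_half_quarter by (simp only: complex_mod_cnj)
qed

lemma norm_2_minus_sq: "(norm (2 - z))\<^sup>2 = 1 + 2 * (norm (1 - z))\<^sup>2"
  unfolding norm_w_sq using Re_Im_unit unfolding cmod_power2 by (simp add: power2_eq_square algebra_simps)

lemma norm_2z_minus_sq: "(norm (2 * z - 1))\<^sup>2 = 1 + 2 * (norm (1 - z))\<^sup>2"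
  unfolding norm_w_sq using Re_Im_unit unfolding cmod_power2 by (simp add: power2_eq_square algebra_simps)

lemma norm_phi_decay: "norm (phi z) \<le> 1 - (norm (1 - z))\<^sup>2 / 12"
  unfolding norm_phi by (rule inverse_bound_aux[OF norm_2_minus_sq norm_2_minus_ge _ norm_w_sq_le]) simp

lemma norm_psi_decay: "norm (psi z) \<le> 1 - (norm (1 - z))\<^sup>2 / 12"
  unfolding norm_psi by (rule inverse_bound_aux[OF norm_2z_minus_sq norm_2z_minus_ge _ norm_w_sq_le]) simp

lemma tau_bounds: "5 / 6 \<le> tau z" "tau z \<le> 1"
  using norm_w_sq_le by (auto simp: tau_def)

lemma tau_power_pos: "0 \<le> tau z ^ n" "tau z ^ n \<le> 1"
  using tau_bounds by (auto intro!: power_le_one)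

text \<open>These are the recursions obtained by splitting \<open>n\<close> by parity, compare
  \<open>GM_even\<close> and \<open>GM_odd\<close>. They hold in the coordinates \<open>BB\<close>,
  \<open>YY\<close> because of the fixed point equation of \<open>psi\<close> (\<open>ps\<close>)
  and its variant \<open>ps2\<close>.\<close>

lemma chi_simps:
  "chi0 z 0 = 1" "chi1 z 0 = psi z"
  "chi0 z (2 * t) = chi0 z t" "chi1 z (2 * t) = (z * chi0 z t + chi1 z t / z) / 2"
  "chi0 z (Suc (2 * t)) = (z * chi0 z t + chi1 z t / z) / 2" "chi1 z (Suc (2 * t)) = chi1 z t"
proof -
  note [simp] = unit_nonzero
  show "chi0 z 0 = 1" "chi1 z 0 = psi z" "chi1 z (Suc (2 * t)) = chi1 z t"
    by (simp_all add: chi0_def chi1_def)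
  have [simp]: "z * 2 \<noteq> 1" using unit_nonzero(3) by (auto simp: mult.commute)
  have ps: "z / 2 + psi z / (2 * z) = psi z"
    by (simp add: psi_def divide_simps) (simp add: algebra_simps power2_eq_square)
  have ps2: "1 + psi z * (1 - z)\<^sup>2 / z\<^sup>2 = psi z"
    by (simp add: psi_def divide_simps) (simp add: algebra_simps power2_eq_square)
  have "chi0 z (2 * t) = BB z t + (z / 2 + psi z / (2 * z)) * ((1 - z)\<^sup>2 * YY z t)"
    unfolding chi0_def BB_simps YY_simps by (simp add: algebra_simps)
  then show "chi0 z (2 * t) = chi0 z t" unfolding ps by (simp add: chi0_def)
  have "(z * chi0 z t + chi1 z t / z) / 2
          = (z / 2 + psi z / (2 * z)) * BB z t + z / 2 * psi z * (1 - z)\<^sup>2 * YY z t"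
    unfolding chi0_def chi1_def by (simp add: field_simps)
  also have "\<dots> = psi z * BB z t + z / 2 * psi z * (1 - z)\<^sup>2 * YY z t" unfolding ps ..
  finally have m: "(z * chi0 z t + chi1 z t / z) / 2 = psi z * BB z t + z / 2 * psi z * (1 - z)\<^sup>2 * YY z t" .
  have "chi1 z (2 * t) = psi z * BB z t + z / 2 * psi z * (1 - z)\<^sup>2 * YY z t"
    unfolding chi1_def BB_simps by (simp add: algebra_simps)
  then show "chi1 z (2 * t) = (z * chi0 z t + chi1 z t / z) / 2"
    unfolding m .
  have "chi0 z (Suc (2 * t)) = (1 + psi z * (1 - z)\<^sup>2 / z\<^sup>2) * BB z t + z / 2 * psi z * (1 - z)\<^sup>2 * YY z t"
    unfolding chi0_def BB_simps YY_simps by (simp add: algebra_simps)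
  then show "chi0 z (Suc (2 * t)) = (z * chi0 z t + chi1 z t / z) / 2"
    unfolding m ps2 .
qed

lemma norm_mean_le:
  assumes "norm a \<le> A" "norm b \<le> B"
  shows "norm ((z * a + b / z) / 2) \<le> (A + B) / 2"
  using norm_triangle_ineq[of "z * a" "b / z"] assms z by (simp add: norm_mult norm_divide)

text \<open>After two means \<open>a\<close> has the coefficient \<open>z / 2 + 1 / 4\<close>. The
  two summands point in different directions unless \<open>z = 1\<close>, so its modulus is strictly
  less than 3/4.\<close>

lemma norm_mean2_le:
  assumes "norm a \<le> A" "norm b \<le> B" "b' = (z * a + b / z) / 2"
  shows "norm ((z * a + b' / z) / 2) \<le> (3 / 4 - (norm (1 - z))\<^sup>2 / 12) * A + B / 4"
proof -
  have "(z * a + b' / z) / 2 = (z / 2 + 1 / 4) * a + b / (4 * z\<^sup>2)"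
    using unit_nonzero unfolding assms(3) by (simp add: field_simps power2_eq_square)
  also have "norm \<dots> \<le> norm ((z / 2 + 1 / 4) * a) + norm (b / (4 * z\<^sup>2))"
    by (rule norm_triangle_ineq)
  also have "\<dots> \<le> (3 / 4 - (norm (1 - z))\<^sup>2 / 12) * A + B / 4"
    unfolding norm_mult using z assms norm_half_quarter order_trans[OF norm_ge_zero norm_half_quarter]
    by (intro add_mono mult_mono) (auto simp: norm_divide norm_mult norm_power)
  finally show ?thesis .
qed

lemma norm_mean2_le':
  assumes "norm a \<le> A" "norm b \<le> B" "a' = (z * a + b / z) / 2"
  shows "norm ((z * a' + b / z) / 2) \<le> A / 4 + (3 / 4 - (norm (1 - z))\<^sup>2 / 12) * B"
proof -
  have "(z * a' + b / z) / 2 = z\<^sup>2 / 4 * a + (1 / 4 + 1 / (2 * z)) * b"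
    using unit_nonzero unfolding assms(3) by (simp add: field_simps power2_eq_square)
  also have "norm \<dots> \<le> norm (z\<^sup>2 / 4 * a) + norm ((1 / 4 + 1 / (2 * z)) * b)"
    by (rule norm_triangle_ineq)
  also have "\<dots> \<le> A / 4 + (3 / 4 - (norm (1 - z))\<^sup>2 / 12) * B"
    unfolding norm_mult using z assms norm_half_quarter' order_trans[OF norm_ge_zero norm_half_quarter']
    by (intro add_mono mult_mono) (auto simp: norm_divide norm_mult norm_power)
  finally show ?thesis .
qed

text \<open>Each application of a digit replaces one of the two functions by a mean of both; two
  successive means cannot be aligned, and this is the source of the decay.\<close>
lemma chi_decay_aux:
  defines "s \<equiv> (norm (1 - z))\<^sup>2 / 12"
  shows "if even t
     then norm (chi0 z t) \<le> tau z ^ falls t \<and> norm (chi1 z t) \<le> (1 - s) * tau z ^ falls t \<and>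
          (\<exists>b. norm b \<le> tau z ^ falls t \<and> chi1 z t = (z * chi0 z t + b / z) / 2)
     else norm (chi1 z t) \<le> (1 - s) * tau z ^ falls t \<and>
          (\<exists>a. norm a \<le> tau z ^ falls t \<and> chi0 z t = (z * a + chi1 z t / z) / 2)"
proof (induction t rule: bin_induct)
  have s: "0 \<le> s" "s \<le> 1 / 3" "tau z = 1 - s / 2"
    using norm_w_sq_le by (auto simp: s_def tau_def)
  {
    case zero
    have "psi z = (z + psi z / z) / 2"
      using unit_nonzero by (simp add: psi_def divide_simps) (simp add: algebra_simps power2_eq_square)
    then show ?case
      using norm_psi_decay norm_psi_le by (auto simp: chi_simps falls_simps s_def)
  next
    case (even t)
    let ?m = "tau z ^ falls t"
    have m: "0 \<le> ?m" by (rule tau_power_pos)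
    have sm: "(1 - s) * ?m \<le> ?m" using s m by (simp add: mult_left_le_one_le)
    show ?case
    proof (cases "even t")
      case True
      then obtain b where a: "norm (chi0 z t) \<le> ?m" "norm (chi1 z t) \<le> (1 - s) * ?m"
        and b: "norm b \<le> ?m" "chi1 z t = (z * chi0 z t + b / z) / 2"
        using even(2)[unfolded if_P[OF True]] by blast
      have "norm (chi1 z (2 * t)) \<le> (3 / 4 - s) * ?m + ?m / 4"
        unfolding chi_simps s_def by (rule norm_mean2_le[OF a(1) b])
      then have "norm (chi1 z (2 * t)) \<le> (1 - s) * ?m" by (simp add: algebra_simps)
      moreover have "norm (chi1 z t) \<le> ?m" using a sm by linarith
      ultimately show ?thesis
        using True a unfolding falls_simps chi_simps by auto
    next
      case False
      then obtain a where b: "norm (chi1 z t) \<le> (1 - s) * ?m"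
        and a: "norm a \<le> ?m" "chi0 z t = (z * a + chi1 z t / z) / 2"
        using even(2)[unfolded if_not_P[OF False]] by blast
      have m': "tau z ^ falls (2 * t) = (1 - s / 2) * ?m"
        using False by (simp add: falls_simps s)
      have 1: "norm (chi0 z t) \<le> (1 - s / 2) * ?m"
        using norm_mean_le[OF a(1) b] unfolding a(2) by (simp add: algebra_simps)
      \<comment> \<open>A zero after a one creates a fall. The extra factor \<open>1 - s / 2\<close>
        comes from combining the cancellation in the double mean with the factor
        \<open>1 - s\<close> already present in the bound for \<open>chi1 z t\<close>.\<close>
      have "norm (chi1 z (2 * t)) \<le> ?m / 4 + (3 / 4 - s) * ((1 - s) * ?m)"
        unfolding chi_simps s_def by (rule norm_mean2_le'[OF a(1) b[unfolded s_def] a(2)])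
      also have "\<dots> = (1 / 4 + (3 / 4 - s) * (1 - s)) * ?m" by (simp add: field_simps)
      also have "\<dots> \<le> ((1 - s) * (1 - s / 2)) * ?m"
      proof (rule mult_right_mono[OF _ m])
        have "s * s \<le> 1 / 3 * s" using s by (intro mult_right_mono) auto
        then show "1 / 4 + (3 / 4 - s) * (1 - s) \<le> (1 - s) * (1 - s / 2)"
          using s by (simp add: field_simps)
      qed
      finally have 2: "norm (chi1 z (2 * t)) \<le> (1 - s) * ((1 - s / 2) * ?m)" unfolding mult.assoc .
      have "(1 - s) * ?m \<le> (1 - s / 2) * ?m" using s m by (intro mult_right_mono) auto
      with b have 3: "norm (chi1 z t) \<le> (1 - s / 2) * ?m" by linarith
      have "\<exists>b. norm b \<le> (1 - s / 2) * ?m \<and> chi1 z (2 * t) = (z * chi0 z (2 * t) + b / z) / 2"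
        using 3 unfolding chi_simps by blast
      then show ?thesis
        using 1 2 unfolding m' by (simp add: chi_simps)
    qed
  next
    case (odd t)
    let ?m = "tau z ^ falls t"
    have m: "0 \<le> ?m" by (rule tau_power_pos)
    have sm: "(1 - s) * ?m \<le> ?m" using s m by (simp add: mult_left_le_one_le)
    show ?case
    proof (cases "even t")
      case True
      then show ?thesis
        using odd unfolding falls_simps chi_simps by auto
    next
      case False
      then obtain a where b: "norm (chi1 z t) \<le> (1 - s) * ?m"
        and a: "norm a \<le> ?m" "chi0 z t = (z * a + chi1 z t / z) / 2"
        using odd[unfolded if_not_P[OF False]] by blast
      have "norm (chi0 z t) \<le> (?m + (1 - s) * ?m) / 2"
        using norm_mean_le[OF a(1) b] unfolding a(2) .
      also have "\<dots> \<le> ?m" using sm by simp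
      finally have "norm (chi0 z t) \<le> ?m" .
      then show ?thesis
        using b unfolding falls_simps chi_simps by auto
    qed
  }
qed

lemma norm_chi1_le: "norm (chi1 z t) \<le> tau z ^ blocks t"
proof -
  let ?s = "(norm (1 - z))\<^sup>2 / 12" and ?m = "tau z ^ falls t"
  have m: "0 \<le> ?m" by (rule tau_power_pos)
  have "norm (chi1 z t) \<le> (1 - ?s) * ?m"
    using chi_decay_aux[of t] by (auto split: if_splits)
  also have "\<dots> \<le> tau z * ?m" using m by (intro mult_right_mono) (auto simp: tau_def)
  finally have "norm (chi1 z t) \<le> tau z * ?m" .
  moreover have "tau z * ?m \<le> ?m" using m tau_bounds by (simp add: mult_left_le_one_le)
  ultimately show ?thesis by (auto simp: blocks_eq_falls)
qed

lemma norm_BB_le: "norm (BB z t) \<le> 3 * tau z ^ blocks t"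
proof -
  have "norm (BB z t) = norm (chi1 z t) * norm (2 * z - 1)"
    using unit_nonzero z by (simp add: chi1_def norm_mult norm_psi)
  also have "\<dots> \<le> tau z ^ blocks t * 3"
    by (intro mult_mono norm_chi1_le norm_2z_minus_le) (auto simp: tau_power_pos)
  finally show ?thesis by simp
qed

lemma norm_YY_le: "norm (YY z t) \<le> 9 * tau z ^ blocks t"
proof (induction t rule: bin_induct)
  case (even t)
  then show ?case using z tau_power_pos[of "blocks t"] by (simp add: norm_divide norm_mult)
next
  case (odd t)
  let ?m = "tau z ^ blocks t"
  have m: "0 \<le> ?m" by (rule tau_power_pos)
  have "norm (YY z (Suc (2 * t))) \<le> norm (z / 2 * YY z t) + norm (BB z t / z\<^sup>2)"
    unfolding YY_simps by (rule norm_triangle_ineq)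
  also have "\<dots> \<le> 9 / 2 * ?m + 3 * ?m"
    using odd norm_BB_le[of t] z by (simp add: norm_mult norm_divide norm_power)
  finally have 1: "norm (YY z (Suc (2 * t))) \<le> 15 / 2 * ?m" by simp
  \<comment> \<open>\<open>15 / 2 = 9 * (5 / 6)\<close>, so the constant 9 survives the factor
    \<open>tau z\<close> demanded by a new block.\<close>
  have "5 / 6 * ?m \<le> tau z * ?m" using m tau_bounds by (intro mult_right_mono)
  then show ?case using 1 m by auto
qed simp

text \<open>Every trailing zero halves \<open>YY\<close> and leaves the number of blocks
  unchanged.\<close>

lemma norm_YY_even_le:
  "even t \<Longrightarrow> t > 0 \<Longrightarrow> norm (YY z t) \<le> 9 * tau z ^ blocks t / 2 ^ last_run t"
proof (induction t rule: bin_induct)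
  case (even t)
  have "norm (YY z (2 * t)) = norm (YY z t) / 2" using z by (simp add: norm_divide norm_mult)
  then show ?case
    using even norm_YY_le[of t] by (auto simp: last_run_simps)
qed auto

end

section \<open>Second-order expansion\<close>

text \<open>Appending a zero to \<open>t\<close> multiplies \<open>BB\<close> by \<open>qf z (x0 t)\<close> up to \<open>(1 - z)\<^sup>2 * delta z t\<close>, where
  \<open>qf\<close> is a mixture of \<open>1\<close> and \<open>phi\<close>; \<open>err\<close> is what remains of \<open>delta\<close> after its leading term.\<close>
definition qf :: "complex \<Rightarrow> real \<Rightarrow> complex" where
  "qf z x = 1 + of_real (x / 2) * (1 - z)\<^sup>2 * phi z"

definition delta :: "complex \<Rightarrow> nat \<Rightarrow> complex" where
  "delta z t = z / 2 * YY z t - of_real (x0 t / 2) * phi z * BB z t"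

definition err :: "complex \<Rightarrow> nat \<Rightarrow> complex" where
  "err z t = delta z t - of_real (gain t) * (1 - z) * BB z t"

text \<open>\<open>YY / BB\<close> is expanded around its value for the empty expansion in \<open>rem0\<close> and around its
  value for infinitely many ones in \<open>rem1\<close>; the first is small after many zeros, the second
  after many ones.\<close>
definition rem0 :: "complex \<Rightarrow> nat \<Rightarrow> complex" where
  "rem0 z t = YY z t - (of_real (x0 t) + of_real (x1 t) * (1 - z)) * BB z t"

definition rem1 :: "complex \<Rightarrow> nat \<Rightarrow> complex" where
  "rem1 z t = YY z t - 2 / z * phi z * BB z t - (of_real (x0 t - 2) + of_real (x1 t - 2) * (1 - z)) * BB z t"

context
  fixes z :: complex
  assumes z: "norm z = 1"
begin

lemma phi_eq: "phi z = 1 + (1 - z)\<^sup>2 * phi z"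
  using unit_nonzero[OF z] by (simp add: phi_def field_simps power2_eq_square)

lemma BB_even_step: "BB z (2 * t) = qf z (x0 t) * BB z t + (1 - z)\<^sup>2 * delta z t"
  unfolding BB_simps by (simp add: qf_def delta_def algebra_simps)

lemma rem0_even:
  "rem0 z (2 * t) = rem0 z t / (2 * z) + (1 - z)\<^sup>2 *
     (of_real (x1 t + x0 t) / (2 * z) * BB z t
       - (of_real (x0 (2 * t)) + of_real (x1 (2 * t)) * (1 - z)) * (z / 2) * YY z t)"
proof -
  define u v b y where "u = complex_of_real (x0 t)" "v = complex_of_real (x1 t)" "b = BB z t" "y = YY z t"
  have "y / (2 * z) - (u / 2 + (v + u) / 2 * (1 - z)) * (b + z / 2 * (1 - z)\<^sup>2 * y)
      = (y - (u + v * (1 - z)) * b) / (2 * z) + (1 - z)\<^sup>2 *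
         ((v + u) / (2 * z) * b - (u / 2 + (v + u) / 2 * (1 - z)) * (z / 2) * y)"
    using unit_nonzero[OF z] by (simp add: divide_simps) algebra
  then show ?thesis by (simp add: rem0_def u_v_b_y_def)
qed

lemma rem0_odd:
  "rem0 z (Suc (2 * t)) = z / 2 * rem0 z t + (1 - z)\<^sup>2 * (- of_real (x1 t) / 2 + (1 + 2 * z) / z\<^sup>2) * BB z t"
proof -
  define u v b y where "u = complex_of_real (x0 t)" "v = complex_of_real (x1 t)" "b = BB z t" "y = YY z t"
  have "z / 2 * y + b / z\<^sup>2 - (u / 2 + 1 + ((v - u) / 2 + 2) * (1 - z)) * b
      = z / 2 * (y - (u + v * (1 - z)) * b) + (1 - z)\<^sup>2 * (- v / 2 + (1 + 2 * z) / z\<^sup>2) * b"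
    using unit_nonzero[OF z] by (simp add: divide_simps) algebra
  then show ?thesis by (simp add: rem0_def u_v_b_y_def)
qed

text \<open>\<open>2 / z * phi z\<close> is the fixed point of
  \<open>y \<mapsto> z / 2 * y + 1 / z\<^sup>2\<close>, so subtracting it removes the source term;
  what remains is proportional to \<open>x1 t - 2\<close>, small after many ones.\<close>

lemma rem1_odd:
  "rem1 z (Suc (2 * t)) = z / 2 * rem1 z t - (1 - z)\<^sup>2 * of_real ((x1 t - 2) / 2) * BB z t"
proof -
  define u v b y where "u = complex_of_real (x0 t)" "v = complex_of_real (x1 t)" "b = BB z t" "y = YY z t"
  have "z / 2 * y + b / z\<^sup>2 - 2 / z * (1 / (z * (2 - z))) * b - (u / 2 + 1 - 2 + ((v - u) / 2 + 2 - 2) * (1 - z)) * b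
      = z / 2 * (y - 2 / z * (1 / (z * (2 - z))) * b - (u - 2 + (v - 2) * (1 - z)) * b) - (1 - z)\<^sup>2 * ((v - 2) / 2) * b"
    using unit_nonzero[OF z] by (simp add: divide_simps) algebra
  then show ?thesis by (simp add: rem1_def u_v_b_y_def phi_def)
qed

lemma rem1_rem0:
  "rem1 z t = rem0 z t + (1 - z)\<^sup>2 * ((2 * (1 - z)\<^sup>2 - 4) / (z\<^sup>2 * (2 - z))) * BB z t"
proof -
  define u v b y where "u = complex_of_real (x0 t)" "v = complex_of_real (x1 t)" "b = BB z t" "y = YY z t"
  have "y - 2 / z * (1 / (z * (2 - z))) * b - (u - 2 + (v - 2) * (1 - z)) * b
      = y - (u + v * (1 - z)) * b + (1 - z)\<^sup>2 * ((2 * (1 - z)\<^sup>2 - 4) / (z\<^sup>2 * (2 - z))) * b"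
    using unit_nonzero[OF z] by (simp add: divide_simps) algebra
  then show ?thesis by (simp add: rem0_def rem1_def u_v_b_y_def phi_def)
qed

lemma err_rem0:
  "err z t = z / 2 * rem0 z t - (1 - z)\<^sup>2 * ((of_real (x1 t) + of_real (x0 t) * phi z) / 2) * BB z t"
proof -
  define u v b y where "u = complex_of_real (x0 t)" "v = complex_of_real (x1 t)" "b = BB z t" "y = YY z t"
  have "z / 2 * y - u / 2 * (1 / (z * (2 - z))) * b - (v - u) / 2 * (1 - z) * b
      = z / 2 * (y - (u + v * (1 - z)) * b) - (1 - z)\<^sup>2 * ((v + u * (1 / (z * (2 - z)))) / 2) * b"
    using unit_nonzero[OF z] by (simp add: divide_simps) algebra
  then show ?thesis by (simp add: err_def delta_def gain_def rem0_def u_v_b_y_def phi_def)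
qed

text \<open>The identity \<open>err_rem0\<close> with \<open>x0 - 2\<close>, \<open>x1 - 2\<close>
  in place of \<open>x0\<close>, \<open>x1\<close>: the gain depends only on the difference, and
  \<open>z / 2\<close> times the fixed point \<open>2 / z * phi z\<close> is just
  \<open>phi z\<close>.\<close>

lemma err_rem1:
  "err z t = z / 2 * rem1 z t - (1 - z)\<^sup>2 * ((of_real (x1 t - 2) + of_real (x0 t - 2) * phi z) / 2) * BB z t"
proof -
  define u v b y where "u = complex_of_real (x0 t)" "v = complex_of_real (x1 t)" "b = BB z t" "y = YY z t"
  have "z / 2 * y - u / 2 * (1 / (z * (2 - z))) * b - (v - u) / 2 * (1 - z) * b
      = z / 2 * (y - 2 / z * (1 / (z * (2 - z))) * b - (u - 2 + (v - 2) * (1 - z)) * b)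
          - (1 - z)\<^sup>2 * ((v - 2 + (u - 2) * (1 / (z * (2 - z)))) / 2) * b"
    using unit_nonzero[OF z] by (simp add: divide_simps) algebra
  then show ?thesis by (simp add: err_def delta_def gain_def rem1_def u_v_b_y_def phi_def)
qed

lemma norm_lin_le: "norm (of_real u + of_real v * (1 - z)) \<le> \<bar>u\<bar> + 2 * \<bar>v\<bar>"
proof -
  have "norm (of_real u + of_real v * (1 - z)) \<le> \<bar>u\<bar> + \<bar>v\<bar> * norm (1 - z)"
    using norm_triangle_ineq[of "of_real u" "of_real v * (1 - z)"] by (simp add: norm_mult)
  also have "\<bar>v\<bar> * norm (1 - z) \<le> \<bar>v\<bar> * 2" using norm_w_le[OF z] by (intro mult_left_mono) auto
  finally show ?thesis by simp
qed

lemma norm_mult_BB_le: "norm c \<le> C \<Longrightarrow> norm (c * BB z t) \<le> 3 * C * tau z ^ blocks t"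
  using mult_mono[OF _ norm_BB_le[OF z], of "norm c" C t]
    order_trans[OF norm_ge_zero[of c]] by (simp add: norm_mult mult_ac)

text \<open>\<open>C\<close> and \<open>J\<close> are kept free: uniform constants give
  \<open>norm_rem0_le\<close>, constants decaying along the run give
  \<open>norm_rem0_even_le\<close>.\<close>

lemma rem0_even_step:
  assumes C: "norm (rem0 z t) \<le> C * (norm (1 - z))\<^sup>2 * tau z ^ blocks t"
    and Y: "norm (YY z t) \<le> J * tau z ^ blocks t"
  shows "norm (rem0 z (2 * t))
           \<le> (C / 2 + 3 / 2 * (x1 t + x0 t) + 7 / 2 * J) * (norm (1 - z))\<^sup>2 * tau z ^ blocks t"
proof -
  let ?W = "(norm (1 - z))\<^sup>2" and ?T = "tau z ^ blocks t"
  have x: "0 \<le> x0 t" "x0 t \<le> 2" "0 \<le> x1 t" "x1 t \<le> 4"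
    using x0_nonneg[of t] x0_le[of t] x0_le_x1[of t] x1_le[of t] by auto
  define p where "p = of_real (x1 t + x0 t) / (2 * z) * BB z t"
  define q where "q = (of_real (x0 (2 * t)) + of_real (x1 (2 * t)) * (1 - z)) * (z / 2) * YY z t"
  have 1: "norm p \<le> 3 / 2 * (x1 t + x0 t) * ?T"
    using norm_mult_BB_le[of "of_real (x1 t + x0 t) / (2 * z)" "(x1 t + x0 t) / 2" t] z x
    unfolding p_def by (simp add: norm_divide norm_mult del: of_real_add)
  have "norm (of_real (x0 (2 * t)) + of_real (x1 (2 * t)) * (1 - z)) \<le> 7"
    using norm_lin_le[of "x0 (2 * t)" "x1 (2 * t)"] x unfolding x0_simps x1_simps by argo
  then have "norm ((of_real (x0 (2 * t)) + of_real (x1 (2 * t)) * (1 - z)) * (z / 2)) \<le> 7 / 2"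
    using z unfolding norm_mult by simp
  then have "norm q \<le> 7 / 2 * (J * ?T)"
    unfolding q_def norm_mult[of _ "YY z t"] using Y by (intro mult_mono) auto
  with 1 have "norm (p - q) \<le> 3 / 2 * (x1 t + x0 t) * ?T + 7 / 2 * (J * ?T)"
    using norm_triangle_ineq4[of p q] by linarith
  then have 2: "?W * norm (p - q) \<le> ?W * (3 / 2 * (x1 t + x0 t) * ?T + 7 / 2 * (J * ?T))"
    by (intro mult_left_mono) auto
  have "norm (rem0 z (2 * t)) \<le> norm (rem0 z t / (2 * z)) + norm ((1 - z)\<^sup>2 * (p - q))"
    unfolding rem0_even p_def[symmetric] q_def[symmetric] by (rule norm_triangle_ineq)
  also have "\<dots> = norm (rem0 z t) / 2 + ?W * norm (p - q)"
    using z by (simp add: norm_divide norm_mult norm_power)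
  also have "\<dots> \<le> C * ?W * ?T / 2 + ?W * (3 / 2 * (x1 t + x0 t) * ?T + 7 / 2 * (J * ?T))"
    using C 2 by simp
  finally show ?thesis by (simp add: field_simps)
qed

text \<open>Appending a one opens at most one block, so passing to the new power of
  \<open>tau\<close> costs at most the factor 6/5.\<close>

lemma tau_odd: "5 / 6 * tau z ^ blocks t \<le> tau z ^ blocks (Suc (2 * t))"
  using tau_bounds[OF z] tau_power_pos[OF z, of "blocks t"]
  by (auto intro: mult_right_mono)

lemma norm_rem0_le: "norm (rem0 z t) \<le> 110 * (norm (1 - z))\<^sup>2 * tau z ^ blocks t"
proof (induction t rule: bin_induct)
  case zero
  then show ?case by (simp add: rem0_def)
next
  case (even t)
  let ?WT = "(norm (1 - z))\<^sup>2 * tau z ^ blocks t"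
  have WT: "0 \<le> ?WT" using tau_power_pos[OF z] by simp
  have "norm (rem0 z (2 * t)) \<le> (110 / 2 + 3 / 2 * (x1 t + x0 t) + 7 / 2 * 9) * (norm (1 - z))\<^sup>2 * tau z ^ blocks t"
    by (rule rem0_even_step[OF even(2) norm_YY_le[OF z]])
  also have "\<dots> \<le> 110 * ?WT"
    unfolding mult.assoc using x0_le[of t] x1_le[of t] by (intro mult_right_mono[OF _ WT]) argo
  finally show ?case by simp
next
  case (odd t)
  let ?W = "(norm (1 - z))\<^sup>2" and ?T = "tau z ^ blocks t"
  have x: "0 \<le> x1 t" "x1 t \<le> 4"
    using x0_nonneg[of t] x0_le_x1[of t] x1_le[of t] by auto
  define c where "c = - of_real (x1 t) / 2 + (1 + 2 * z) / z\<^sup>2"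
  have "norm c \<le> norm (- complex_of_real (x1 t) / 2) + norm ((1 + 2 * z) / z\<^sup>2)"
    unfolding c_def by (rule norm_triangle_ineq)
  also have "\<dots> \<le> 2 + 3"
    using z x norm_triangle_ineq[of 1 "2 * z"]
    by (intro add_mono) (auto simp: norm_divide norm_power norm_mult)
  finally have c: "norm c \<le> 5" by simp
  have "norm (rem0 z (Suc (2 * t))) \<le> norm (z / 2 * rem0 z t) + norm ((1 - z)\<^sup>2 * (c * BB z t))"
    unfolding rem0_odd c_def[symmetric] mult.assoc by (rule norm_triangle_ineq)
  also have "\<dots> = norm (rem0 z t) / 2 + ?W * norm (c * BB z t)"
    using z by (simp add: norm_divide norm_mult norm_power)
  also have "\<dots> \<le> 110 * ?W * ?T / 2 + ?W * (3 * 5 * ?T)"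
    using odd norm_mult_BB_le[OF c, of t] by (intro add_mono mult_left_mono divide_right_mono) auto
  also have "\<dots> = 84 * ?W * (5 / 6 * ?T)" by simp
  also have "\<dots> \<le> 84 * ?W * tau z ^ blocks (Suc (2 * t))"
    by (intro mult_left_mono tau_odd) auto
  also have "\<dots> \<le> 110 * ?W * tau z ^ blocks (Suc (2 * t))"
    by (intro mult_right_mono) (auto simp: tau_power_pos[OF z])
  finally show ?case .
qed

lemma norm_rem0_even_le:
  "even t \<Longrightarrow> t > 0 \<Longrightarrow> norm (rem0 z t) \<le> 110 * dev t * (norm (1 - z))\<^sup>2 * tau z ^ blocks t"
proof (induction t rule: bin_induct)
  case (even t)
  let ?WT = "(norm (1 - z))\<^sup>2 * tau z ^ blocks t"
  have WT: "0 \<le> ?WT" using tau_power_pos[OF z] by simp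
  show ?case
  proof (cases "even t")
    case True
    let ?l = "real (last_run t)" and ?J = "1 / 2 ^ last_run t :: real"
    have l: "last_run (2 * t) = last_run t + 1" using True even by (simp add: last_run_simps)
    have "norm (rem0 z (2 * t)) \<le> (110 * dev t / 2 + 3 / 2 * (x1 t + x0 t) + 7 / 2 * (9 * ?J))
            * (norm (1 - z))\<^sup>2 * tau z ^ blocks t"
      using even True norm_YY_even_le[OF z True even(1)]
      by (intro rem0_even_step) (auto simp: mult_ac)
    also have "\<dots> \<le> (55 * (1 + ?l)\<^sup>2 * ?J + 3 / 2 * ((4 + 2 * ?l) * ?J + 2 * ?J) + 7 / 2 * (9 * ?J)) * ?WT"
      unfolding mult.assoc using WT run_even_bounds[OF True even(1)]
      by (intro mult_right_mono add_mono mult_left_mono) (auto simp: dev_def)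
    also have "\<dots> = ?J * (55 * (1 + ?l)\<^sup>2 + 81 / 2 + 3 * ?l) * ?WT" by (simp add: algebra_simps)
    also have "\<dots> \<le> ?J * (55 * (2 + ?l)\<^sup>2) * ?WT"
      using WT by (intro mult_right_mono mult_left_mono) (auto simp: power2_eq_square algebra_simps)
    also have "\<dots> = 110 * dev (2 * t) * ?WT"
      by (simp add: dev_def l)
    finally show ?thesis unfolding blocks_simps mult.assoc .
  next
    case False
    have "last_run (2 * t) = 1" using False even by (simp add: last_run_simps)
    then have d: "dev (2 * t) = 2" by (simp add: dev_def)
    have "110 * ?WT \<le> 110 * dev (2 * t) * ?WT" using WT d by (intro mult_right_mono) auto
    then show ?thesis using norm_rem0_le[of "2 * t"] unfolding blocks_simps mult.assoc by linarith
  qed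
qed auto

lemma norm_rem1_le: "norm (rem1 z t) \<le> 146 * (norm (1 - z))\<^sup>2 * tau z ^ blocks t"
proof -
  let ?W = "(norm (1 - z))\<^sup>2" and ?T = "tau z ^ blocks t"
  define c where "c = (2 * (1 - z)\<^sup>2 - 4) / (z\<^sup>2 * (2 - z))"
  have "norm c = norm (2 * (1 - z)\<^sup>2 - 4) / norm (2 - z)"
    using z by (simp add: c_def norm_divide norm_mult norm_power)
  also have "\<dots> \<le> norm (2 * (1 - z)\<^sup>2 - 4) / 1"
    using norm_2_minus_ge[OF z] by (intro divide_left_mono) auto
  also have "\<dots> \<le> 2 * ?W + 4"
    using norm_triangle_ineq4[of "2 * (1 - z)\<^sup>2" 4] by (simp add: norm_mult norm_power)
  also have "\<dots> \<le> 12" using norm_w_sq_le[OF z] by simp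
  finally have c: "norm c \<le> 12" .
  have "norm (rem1 z t) \<le> norm (rem0 z t) + norm ((1 - z)\<^sup>2 * (c * BB z t))"
    unfolding rem1_rem0 c_def[symmetric] mult.assoc by (rule norm_triangle_ineq)
  also have "\<dots> = norm (rem0 z t) + ?W * norm (c * BB z t)"
    by (simp add: norm_mult norm_power)
  also have "\<dots> \<le> 110 * ?W * ?T + ?W * (3 * 12 * ?T)"
    using norm_rem0_le norm_mult_BB_le[OF c, of t] by (intro add_mono mult_left_mono) auto
  finally show ?thesis by (simp add: mult_ac)
qed

lemma norm_rem1_odd_le:
  "odd t \<Longrightarrow> norm (rem1 z t) \<le> 110 * dev t * (norm (1 - z))\<^sup>2 * tau z ^ blocks t"
proof (induction t rule: bin_induct)
  case (odd t)
  let ?W = "(norm (1 - z))\<^sup>2" and ?T = "tau z ^ blocks t"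
  have WT: "0 \<le> ?W * ?T" using tau_power_pos[OF z] by simp
  have step: "norm (rem1 z (Suc (2 * t))) \<le> norm (rem1 z t) / 2 + 3 / 2 * \<bar>x1 t - 2\<bar> * (?W * ?T)"
  proof -
    have "norm (rem1 z (Suc (2 * t)))
        \<le> norm (z / 2 * rem1 z t) + norm ((1 - z)\<^sup>2 * (of_real ((x1 t - 2) / 2) * BB z t))"
      unfolding rem1_odd mult.assoc by (rule norm_triangle_ineq4)
    also have "\<dots> = norm (rem1 z t) / 2 + ?W * norm (of_real ((x1 t - 2) / 2) * BB z t)"
      using z by (simp add: norm_mult norm_power)
    also have "\<dots> \<le> norm (rem1 z t) / 2 + ?W * (3 * (\<bar>x1 t - 2\<bar> / 2) * ?T)"
      by (intro add_mono mult_left_mono norm_mult_BB_le) (auto simp: norm_divide simp flip: of_real_diff)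
    finally show ?thesis by (simp add: mult_ac)
  qed
  show ?case
  proof (cases "odd t")
    case True
    let ?l = "real (last_run t)" and ?J = "1 / 2 ^ last_run t :: real"
    have l: "last_run (Suc (2 * t)) = last_run t + 1" using True by (simp add: last_run_simps)
    have "norm (rem1 z (Suc (2 * t))) \<le> 110 * dev t * ?W * ?T / 2 + 3 / 2 * ((2 + 2 * ?l) * ?J) * (?W * ?T)"
      using step odd True WT run_odd_bounds(3)[OF True]
      by (elim order_trans) (intro add_mono mult_right_mono mult_left_mono divide_right_mono, auto)
    also have "\<dots> = ?J * (55 * (1 + ?l)\<^sup>2 + 3 + 3 * ?l) * (?W * ?T)"
      by (simp add: dev_def algebra_simps)
    also have "\<dots> \<le> ?J * (55 * (2 + ?l)\<^sup>2) * (?W * ?T)"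
      using WT by (intro mult_right_mono mult_left_mono) (auto simp: power2_eq_square algebra_simps)
    also have "\<dots> = 110 * dev (Suc (2 * t)) * ?W * ?T"
      by (simp add: dev_def l)
    finally show ?thesis using True by simp
  next
    case False
    have "last_run (Suc (2 * t)) = 1" using False by (simp add: last_run_simps)
    then have d: "dev (Suc (2 * t)) = 2" by (simp add: dev_def)
    have "\<bar>x1 t - 2\<bar> \<le> 2" using x1_le[of t] x0_le_x1[of t] x0_nonneg[of t] by auto
    then have "norm (rem1 z (Suc (2 * t))) \<le> 146 * ?W * ?T / 2 + 3 / 2 * 2 * (?W * ?T)"
      using step norm_rem1_le[of t] WT
      by (elim order_trans) (intro add_mono mult_right_mono mult_left_mono divide_right_mono, auto)
    also have "\<dots> = 456 / 5 * ?W * (5 / 6 * ?T)" by simp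
    also have "\<dots> \<le> 456 / 5 * ?W * tau z ^ blocks (Suc (2 * t))"
      by (intro mult_left_mono tau_odd) auto
    also have "\<dots> \<le> 110 * dev (Suc (2 * t)) * ?W * tau z ^ blocks (Suc (2 * t))"
      unfolding d by (intro mult_right_mono) (auto simp: tau_power_pos[OF z])
    finally show ?thesis .
  qed
qed auto

lemma norm_err_le:
  assumes "t > 0"
  shows "norm (err z t) \<le> 64 * dev t * (norm (1 - z))\<^sup>2 * tau z ^ blocks t"
proof -
  let ?W = "(norm (1 - z))\<^sup>2" and ?T = "tau z ^ blocks t"
  let ?l = "real (last_run t)" and ?J = "1 / 2 ^ last_run t :: real"
  have WT: "0 \<le> ?W * ?T" using tau_power_pos[OF z] by simp
  \<comment> \<open>Common to both parities: \<open>R\<close>, \<open>u\<close>, \<open>v\<close>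
    stand for \<open>rem0\<close>, \<open>x0\<close>, \<open>x1\<close> after zeros and for
    \<open>rem1\<close>, \<open>x0 - 2\<close>, \<open>x1 - 2\<close> after ones.\<close>
  have key: "norm (err z t) \<le> 64 * dev t * ?W * ?T"
    if e: "err z t = z / 2 * R - (1 - z)\<^sup>2 * ((of_real v + of_real u * phi z) / 2) * BB z t"
      and R: "norm R \<le> 110 * dev t * ?W * ?T" and uv: "\<bar>u\<bar> \<le> 2 * ?J" "\<bar>v\<bar> \<le> (4 + 2 * ?l) * ?J"
    for R u v
  proof -
    define c where "c = (of_real v + of_real u * phi z) / 2"
    have "norm (of_real v + of_real u * phi z) \<le> \<bar>v\<bar> + \<bar>u\<bar> * norm (phi z)"
      using norm_triangle_ineq[of "of_real v" "of_real u * phi z"] by (simp add: norm_mult)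
    also have "\<dots> \<le> (4 + 2 * ?l) * ?J + 2 * ?J * 1"
      using uv norm_phi_le[OF z] by (intro add_mono mult_mono) auto
    finally have "norm c \<le> ((4 + 2 * ?l) * ?J + 2 * ?J) / 2"
      unfolding c_def by (simp add: norm_divide)
    then have c: "norm c \<le> (3 + ?l) * ?J" by (simp add: algebra_simps add_divide_distrib)
    have "norm (err z t) \<le> norm (z / 2 * R) + norm ((1 - z)\<^sup>2 * (c * BB z t))"
      unfolding e c_def[symmetric] mult.assoc by (rule norm_triangle_ineq4)
    also have "\<dots> = norm R / 2 + ?W * norm (c * BB z t)"
      using z by (simp add: norm_mult norm_power)
    also have "\<dots> \<le> 110 * dev t * ?W * ?T / 2 + ?W * (3 * ((3 + ?l) * ?J) * ?T)"
      using R norm_mult_BB_le[OF c, of t] by (intro add_mono mult_left_mono divide_right_mono) auto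
    also have "\<dots> = ?J * (55 * (1 + ?l)\<^sup>2 + 9 + 3 * ?l) * (?W * ?T)"
      by (simp add: dev_def algebra_simps add_divide_distrib)
    also have "\<dots> \<le> ?J * (64 * (1 + ?l)\<^sup>2) * (?W * ?T)"
      using WT by (intro mult_right_mono mult_left_mono) (auto simp: power2_eq_square algebra_simps)
    finally show ?thesis by (simp add: dev_def)
  qed
  show ?thesis
  proof (cases "even t")
    case True
    show ?thesis
      using run_even_bounds[OF True assms] x0_nonneg[of t] x0_le_x1[of t]
      by (intro key[OF err_rem0 norm_rem0_even_le[OF True assms]]) auto
  next
    case False
    have "\<bar>x1 t - 2\<bar> \<le> (2 + 2 * ?l) * ?J" using run_odd_bounds(3)[OF False] by simp
    also have "\<dots> \<le> (4 + 2 * ?l) * ?J" by (intro mult_right_mono) auto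
    finally show ?thesis
      using run_odd_bounds[OF False] x0_le[of t]
      by (intro key[OF err_rem1 norm_rem1_odd_le[OF False]]) auto
  qed
qed

end

section \<open>Decomposition into the comparison product, gains and errors\<close>

definition Phi :: "complex \<Rightarrow> nat \<Rightarrow> complex" where
  "Phi z = bin_rec 1 (\<lambda>t p. p * qf z (x0 t)) (\<lambda>_ p. p)"

text \<open>Accumulates the gains, each multiplied by the factors \<open>qf\<close> of all later
  zeros; \<open>SS\<close> does the same with the errors.\<close>

definition MM :: "complex \<Rightarrow> nat \<Rightarrow> complex" where
  "MM z = bin_rec 0 (\<lambda>t m. qf z (x0 t) * m + of_real (gain t) * BB z t) (\<lambda>_ m. m)"

definition SS :: "complex \<Rightarrow> nat \<Rightarrow> complex" where
  "SS z = bin_rec 0 (\<lambda>t s. qf z (x0 t) * s + err z t) (\<lambda>_ s. s)"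

text \<open>The real model of \<open>Phi\<close> near \<open>z = 1\<close>, with
  \<open>y = (norm (1 - z))\<^sup>2\<close>: by \<open>w_sq_eq\<close>,
  \<open>(1 - z)\<^sup>2 * phi z\<close> is close to \<open>- y\<close> there.\<close>

definition EE :: "real \<Rightarrow> nat \<Rightarrow> real" where
  "EE y = bin_rec 1 (\<lambda>t e. (1 - x0 t / 2 * y) * e) (\<lambda>_ e. e)"

lemma Phi_simps:
  "Phi z 0 = 1" "t > 0 \<Longrightarrow> Phi z (2 * t) = Phi z t * qf z (x0 t)" "Phi z (Suc (2 * t)) = Phi z t"
  by (simp_all add: Phi_def bin_rec_even bin_rec_odd)

lemma MM_simps:
  "MM z 0 = 0" "t > 0 \<Longrightarrow> MM z (2 * t) = qf z (x0 t) * MM z t + of_real (gain t) * BB z t"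
  "MM z (Suc (2 * t)) = MM z t"
  by (simp_all add: MM_def bin_rec_even bin_rec_odd)

lemma SS_simps:
  "SS z 0 = 0" "t > 0 \<Longrightarrow> SS z (2 * t) = qf z (x0 t) * SS z t + err z t"
  "SS z (Suc (2 * t)) = SS z t"
  by (simp_all add: SS_def bin_rec_even bin_rec_odd)

lemma EE_simps:
  "EE y 0 = 1" "t > 0 \<Longrightarrow> EE y (2 * t) = (1 - x0 t / 2 * y) * EE y t" "EE y (Suc (2 * t)) = EE y t"
  by (simp_all add: EE_def bin_rec_even bin_rec_odd)

text \<open>The step from \<open>BB\<close> to \<open>chi0\<close> is compared with the square of \<open>qf\<close>, not with \<open>1 + x0 t * (1 - z)\<^sup>2 * phi z\<close>, whose constant
  term in \<open>phi\<close> may be negative.\<close>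
definition MMe :: "complex \<Rightarrow> nat \<Rightarrow> complex" where
  "MMe z t = (qf z (x0 t))\<^sup>2 * MM z t + of_real (x1 t) * BB z t"

definition erre :: "complex \<Rightarrow> nat \<Rightarrow> complex" where
  "erre z t = psi z * YY z t - of_real (x0 t) * phi z * BB z t
     - of_real ((x0 t / 2)\<^sup>2) * (1 - z)\<^sup>2 * (phi z)\<^sup>2 * BB z t - of_real (x1 t) * (1 - z) * BB z t"

definition SSe :: "complex \<Rightarrow> nat \<Rightarrow> complex" where
  "SSe z t = (qf z (x0 t))\<^sup>2 * SS z t + erre z t"

text \<open>The total gain. The summand \<open>x1 t\<close> belongs to the final step from
  \<open>BB\<close> to \<open>chi0\<close>, where \<open>psi z * YY z t\<close> enters without the
  factor \<open>z / 2\<close>.\<close>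

definition GG :: "nat \<Rightarrow> real" where
  "GG t = zsum gain t + x1 t"

lemma EE_bounds:
  assumes "0 \<le> y" "y \<le> 1"
  shows "0 \<le> EE y t" "EE y t \<le> 1" "1 - y * zsum wt t \<le> EE y t"
proof -
  have "0 \<le> EE y t \<and> EE y t \<le> 1 \<and> 1 - y * zsum wt t \<le> EE y t"
  proof (induction t rule: bin_induct)
    case (even t)
    let ?a = "x0 t / 2"
    have a: "0 \<le> ?a" "?a \<le> 1" "?a \<le> wt t"
      using x0_nonneg[of t] x0_le[of t] gain_nonneg[of t] dev_nonneg[of t] by (auto simp: wt_def)
    have ay: "0 \<le> ?a * y" "?a * y \<le> 1" using a assms mult_mono[of ?a 1 y 1] by auto
    have "?a * y * EE y t \<le> ?a * y * 1" using ay even by (intro mult_left_mono) auto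
    also have "\<dots> \<le> wt t * y" using mult_right_mono[OF a(3), of y] assms by simp
    finally have 1: "?a * y * EE y t \<le> y * wt t" by (simp add: mult.commute)
    have "1 - y * zsum wt (2 * t) = (1 - y * zsum wt t) - y * wt t"
      unfolding zsum_simps(2)[OF even(1)] by (simp add: algebra_simps)
    also have "\<dots> \<le> EE y t - ?a * y * EE y t" using 1 even by linarith
    also have "\<dots> = EE y (2 * t)" unfolding EE_simps(2)[OF even(1)] by (simp add: algebra_simps)
    finally have "1 - y * zsum wt (2 * t) \<le> EE y (2 * t)" .
    moreover have "0 \<le> EE y (2 * t)" "EE y (2 * t) \<le> 1"
      using even ay unfolding EE_simps(2)[OF even(1)] by (auto intro!: mult_nonneg_nonneg mult_le_one)
    ultimately show ?case by simp
  qed (simp_all add: EE_simps zsum_simps)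
  then show "0 \<le> EE y t" "EE y t \<le> 1" "1 - y * zsum wt t \<le> EE y t" by auto
qed

lemma x0_odd_ge: "odd t \<Longrightarrow> x0 t \<ge> 1"
  using x0_nonneg[of "t div 2"] x0_simps(3)[of "t div 2"] by simp

lemma blocks_falls_even: "blocks t = falls (2 * t)"
  by (simp add: falls_def)

context
  fixes z :: complex
  assumes z: "norm z = 1"
begin

text \<open>Variation of constants: \<open>BB_even_step\<close> is unrolled with
  \<open>delta\<close> split into gain and \<open>err\<close>, the inhomogeneities being propagated
  by \<open>qf\<close>.\<close>

lemma BB_decomp: "BB z t = Phi z t + (1 - z) ^ 3 * MM z t + (1 - z)\<^sup>2 * SS z t"
proof (induction t rule: bin_induct)
  case (even t)
  have "(1 - z)\<^sup>2 * delta z t = (1 - z) ^ 3 * (of_real (gain t) * BB z t) + (1 - z)\<^sup>2 * err z t"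
    by (simp add: err_def algebra_simps power2_eq_square power3_eq_cube)
  moreover have "qf z (x0 t) * BB z t = qf z (x0 t) * (Phi z t + (1 - z) ^ 3 * MM z t + (1 - z)\<^sup>2 * SS z t)"
    using even by simp
  ultimately show ?case
    unfolding BB_even_step[OF z] Phi_simps(2)[OF even(1)] MM_simps(2)[OF even(1)] SS_simps(2)[OF even(1)]
    by (simp add: algebra_simps)
qed (simp_all add: Phi_simps MM_simps SS_simps)

lemma chi0_decomp:
  "chi0 z t = Phi z t * qf z (x0 t) * qf z (x0 t) + (1 - z) ^ 3 * MMe z t + (1 - z)\<^sup>2 * SSe z t"
proof -
  have q: "(qf z (x0 t))\<^sup>2 * BB z t
      = BB z t + of_real (x0 t) * (1 - z)\<^sup>2 * phi z * BB z t + of_real ((x0 t / 2)\<^sup>2) * (1 - z) ^ 4 * (phi z)\<^sup>2 * BB z t"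
  proof -
    have "(1 + x / 2 * w\<^sup>2 * p)\<^sup>2 * b = b + x * w\<^sup>2 * p * b + (x / 2)\<^sup>2 * w ^ 4 * p\<^sup>2 * b"
      for x w p b :: complex
      by (simp add: field_simps power2_eq_square power4_eq_xxxx)
    from this[of "of_real (x0 t)"] show ?thesis by (simp add: qf_def)
  qed
  have "chi0 z t = (qf z (x0 t))\<^sup>2 * BB z t + (1 - z) ^ 3 * (of_real (x1 t) * BB z t) + (1 - z)\<^sup>2 * erre z t"
  proof -
    have "b + ps * w\<^sup>2 * y = (b + x * w\<^sup>2 * p * b + c * w ^ 4 * p\<^sup>2 * b) + w ^ 3 * (v * b)
        + w\<^sup>2 * (ps * y - x * p * b - c * w\<^sup>2 * p\<^sup>2 * b - v * w * b)"
      for b ps w y x p c v :: complex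
      by (simp add: algebra_simps power2_eq_square power3_eq_cube power4_eq_xxxx)
    then show ?thesis unfolding chi0_def erre_def q .
  qed
  also have "(qf z (x0 t))\<^sup>2 * BB z t
      = (qf z (x0 t))\<^sup>2 * (Phi z t + (1 - z) ^ 3 * MM z t + (1 - z)\<^sup>2 * SS z t)"
    using BB_decomp[of t] by simp
  finally show ?thesis
    unfolding MMe_def SSe_def by (simp add: algebra_simps power2_eq_square)
qed

lemma qf_mix: "qf z x = of_real (1 - x / 2) + of_real (x / 2) * phi z"
proof -
  have e: "(1 - z)\<^sup>2 * phi z = phi z - 1" using phi_eq[OF z] by (simp add: algebra_simps)
  show ?thesis unfolding qf_def mult.assoc e by (simp add: field_simps)
qed

lemma norm_qf_aux:
  assumes "0 \<le> x" "x \<le> 2"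
  shows "norm (qf z x) \<le> (1 - x / 2) + x / 2 * norm (phi z)"
  using norm_triangle_ineq[of "of_real (1 - x / 2)" "of_real (x / 2) * phi z"] assms
  unfolding qf_mix norm_mult norm_of_real by simp

lemma norm_qf_le:
  assumes "0 \<le> x" "x \<le> 2"
  shows "norm (qf z x) \<le> 1"
proof -
  have "x / 2 * norm (phi z) \<le> x / 2 * 1"
    using assms norm_phi_le[OF z] by (intro mult_left_mono) auto
  then show ?thesis using norm_qf_aux[OF assms] by simp
qed

lemma norm_qf_le_tau:
  assumes "1 \<le> x" "x \<le> 2"
  shows "norm (qf z x) \<le> tau z"
proof -
  let ?W = "(norm (1 - z))\<^sup>2"
  have "x / 2 * norm (phi z) \<le> x / 2 * (1 - ?W / 12)"
    using assms norm_phi_decay[OF z] by (intro mult_left_mono) auto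
  moreover have "1 / 2 * (?W / 12) \<le> x / 2 * (?W / 12)"
    using assms by (intro mult_right_mono) auto
  ultimately show ?thesis using norm_qf_aux[of x] assms by (simp add: tau_def algebra_simps)
qed

lemma norm_qf_le': "norm (qf z (x0 t)) \<le> 1"
  using norm_qf_le x0_nonneg x0_le by blast

text \<open>If the zero follows a one, a fall is added, but then \<open>x0 t \<ge> 1\<close>; the
  mixture has weight at least 1/2 on \<open>phi\<close>, and this yields the factor
  \<open>tau\<close>.\<close>

lemma qf_tau_step:
  assumes "norm u \<le> C * tau z ^ falls t" "0 \<le> C"
  shows "norm (qf z (x0 t) * u) \<le> C * tau z ^ falls (2 * t)"
proof (cases "even t")
  case True
  have "norm (qf z (x0 t)) * norm u \<le> 1 * (C * tau z ^ falls t)"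
    using assms norm_qf_le'[of t] by (intro mult_mono) auto
  then show ?thesis using True by (simp add: falls_simps norm_mult)
next
  case False
  have "norm (qf z (x0 t)) * norm u \<le> tau z * (C * tau z ^ falls t)"
    using assms norm_qf_le_tau[OF x0_odd_ge[OF False] x0_le] tau_bounds[OF z]
    by (intro mult_mono) auto
  then show ?thesis using False unfolding falls_simps norm_mult by (simp add: mult_ac)
qed

lemma norm_MM_le: "norm (MM z t) \<le> 3 * zsum gain t * tau z ^ falls t"
proof (induction t rule: bin_induct)
  case (even t)
  have g: "norm (complex_of_real (gain t)) \<le> gain t" using gain_nonneg[of t] by simp
  have "norm (MM z (2 * t)) \<le> norm (qf z (x0 t) * MM z t) + norm (of_real (gain t) * BB z t)"
    unfolding MM_simps(2)[OF even(1)] by (rule norm_triangle_ineq)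
  also have "\<dots> \<le> 3 * zsum gain t * tau z ^ falls (2 * t) + 3 * gain t * tau z ^ falls (2 * t)"
    using even zsum_nonneg[OF gain_nonneg] norm_mult_BB_le[OF z g, of t]
    by (intro add_mono qf_tau_step) (auto simp: blocks_falls_even)
  finally show ?case unfolding zsum_simps(2)[OF even(1)] by (simp add: distrib_left distrib_right)
qed (simp_all add: MM_simps zsum_simps falls_simps)

lemma norm_SS_le: "norm (SS z t) \<le> 64 * zsum dev t * (norm (1 - z))\<^sup>2 * tau z ^ falls t"
proof (induction t rule: bin_induct)
  case (even t)
  let ?W = "(norm (1 - z))\<^sup>2"
  have "norm (SS z (2 * t)) \<le> norm (qf z (x0 t) * SS z t) + norm (err z t)"
    unfolding SS_simps(2)[OF even(1)] by (rule norm_triangle_ineq)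
  also have "\<dots> \<le> 64 * zsum dev t * ?W * tau z ^ falls (2 * t) + 64 * dev t * ?W * tau z ^ falls (2 * t)"
    using even zsum_nonneg[OF dev_nonneg] norm_err_le[OF z even(1)]
    by (intro add_mono qf_tau_step) (auto simp: blocks_falls_even)
  finally show ?case unfolding zsum_simps(2)[OF even(1)] by (simp add: distrib_left distrib_right)
qed (simp_all add: SS_simps zsum_simps falls_simps)

text \<open>Both \<open>phi\<close> and \<open>psi\<close> are 1 up to the order
  \<open>(1 - z)\<^sup>2\<close>, so the coefficients \<open>x0\<close> and \<open>x1\<close> cancel
  the first two orders of \<open>YY\<close> and leave \<open>rem0\<close>.\<close>

lemma erre_eq:
  "erre z t = psi z * rem0 z t + (1 - z)\<^sup>2 *
     ((of_real (x0 t) + of_real (x1 t) * (1 - z)) / (2 * z - 1) - of_real (x0 t) * phi z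
       - of_real ((x0 t / 2)\<^sup>2) * (phi z)\<^sup>2) * BB z t"
proof -
  have p: "psi z = 1 + (1 - z)\<^sup>2 / (2 * z - 1)"
    using unit_nonzero[OF z] by (simp add: psi_def field_simps power2_eq_square)
  have gen: "(1 + w\<^sup>2 / d) * y - u * (1 + w\<^sup>2 * p) * b - c * w\<^sup>2 * p\<^sup>2 * b - v * w * b
      = (1 + w\<^sup>2 / d) * (y - (u + v * w) * b) + w\<^sup>2 * ((u + v * w) / d - u * p - c * p\<^sup>2) * b"
    for w d y u p b c v :: complex
    by (simp add: divide_inverse algebra_simps)
  have "erre z t = (1 + (1 - z)\<^sup>2 / (2 * z - 1)) * YY z t - of_real (x0 t) * (1 + (1 - z)\<^sup>2 * phi z) * BB z t
      - of_real ((x0 t / 2)\<^sup>2) * (1 - z)\<^sup>2 * (phi z)\<^sup>2 * BB z t - of_real (x1 t) * (1 - z) * BB z t"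
    unfolding erre_def p phi_eq[OF z, symmetric] ..
  then show ?thesis
    unfolding gen rem0_def p .
qed

text \<open>This error occurs once, not once per zero, so the uniform bound on \<open>rem0\<close>
  suffices.\<close>

lemma norm_erre_le: "norm (erre z t) \<le> 150 * (norm (1 - z))\<^sup>2 * tau z ^ blocks t"
proof -
  let ?W = "(norm (1 - z))\<^sup>2" and ?T = "tau z ^ blocks t"
  have x: "0 \<le> x0 t" "x0 t \<le> 2" "0 \<le> x1 t" "x1 t \<le> 4"
    using x0_nonneg[of t] x0_le[of t] x0_le_x1[of t] x1_le[of t] by auto
  define c1 where "c1 = (of_real (x0 t) + of_real (x1 t) * (1 - z)) / (2 * z - 1)"
  define c2 where "c2 = of_real (x0 t) * phi z"
  define c3 where "c3 = of_real ((x0 t / 2)\<^sup>2) * (phi z)\<^sup>2"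
  have "norm c1 \<le> norm (of_real (x0 t) + of_real (x1 t) * (1 - z)) / 1"
    unfolding c1_def norm_divide using norm_2z_minus_ge[OF z] by (intro divide_left_mono) auto
  then have c1: "norm c1 \<le> 10" using norm_lin_le[OF z, of "x0 t" "x1 t"] x by simp
  have "norm c2 \<le> 2 * 1"
    unfolding c2_def norm_mult using x norm_phi_le[OF z] by (intro mult_mono) auto
  moreover have "norm c3 \<le> 1 * 1"
    unfolding c3_def norm_mult norm_power norm_of_real
    using x norm_phi_le[OF z] by (intro mult_mono power_le_one) (auto intro!: power_le_one)
  ultimately have c: "norm (c1 - c2 - c3) \<le> 13"
    using c1 norm_triangle_ineq4[of "c1 - c2" c3] norm_triangle_ineq4[of c1 c2] by linarith
  have "norm (erre z t) \<le> norm (psi z * rem0 z t) + norm ((1 - z)\<^sup>2 * ((c1 - c2 - c3) * BB z t))"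
    unfolding erre_eq c1_def[symmetric] c2_def[symmetric] c3_def[symmetric] mult.assoc
    by (rule norm_triangle_ineq)
  also have "\<dots> = norm (psi z) * norm (rem0 z t) + ?W * norm ((c1 - c2 - c3) * BB z t)"
    by (simp add: norm_mult norm_power)
  also have "\<dots> \<le> 1 * (110 * ?W * ?T) + ?W * (3 * 13 * ?T)"
    using norm_rem0_le[OF z] norm_psi_le[OF z] norm_mult_BB_le[OF z c, of t]
    by (intro add_mono mult_left_mono mult_mono) auto
  also have "\<dots> = 149 * ?W * ?T" by simp
  also have "\<dots> \<le> 150 * ?W * ?T" using tau_power_pos[OF z] by (intro mult_right_mono) auto
  finally show ?thesis .
qed

lemma tau_blocks_le_falls: "tau z ^ blocks t \<le> tau z ^ falls t"
  using tau_bounds[OF z] by (intro power_decreasing) (auto simp: blocks_eq_falls)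

lemma norm_qf_sq_mult_le: "norm ((qf z (x0 t))\<^sup>2 * u) \<le> norm u"
  using norm_qf_le'[of t] unfolding norm_mult norm_power
  by (intro mult_left_le_one_le) (auto intro: power_le_one)

lemma norm_MMe_le: "norm (MMe z t) \<le> 3 * GG t * tau z ^ falls t"
proof -
  have x: "0 \<le> x1 t" using x0_nonneg[of t] x0_le_x1[of t] by auto
  then have x': "norm (complex_of_real (x1 t)) \<le> x1 t" by simp
  have "norm (MMe z t) \<le> norm ((qf z (x0 t))\<^sup>2 * MM z t) + norm (of_real (x1 t) * BB z t)"
    unfolding MMe_def by (rule norm_triangle_ineq)
  also have "\<dots> \<le> 3 * zsum gain t * tau z ^ falls t + 3 * x1 t * tau z ^ blocks t"
    using norm_MM_le[of t] norm_qf_sq_mult_le[of t "MM z t"] norm_mult_BB_le[OF z x', of t] by linarith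
  also have "\<dots> \<le> 3 * zsum gain t * tau z ^ falls t + 3 * x1 t * tau z ^ falls t"
    using x tau_blocks_le_falls by (intro add_left_mono mult_left_mono) auto
  finally show ?thesis by (simp add: GG_def algebra_simps)
qed

lemma norm_SSe_le: "norm (SSe z t) \<le> (64 * zsum dev t + 150) * (norm (1 - z))\<^sup>2 * tau z ^ falls t"
proof -
  let ?W = "(norm (1 - z))\<^sup>2"
  have "norm (SSe z t) \<le> norm ((qf z (x0 t))\<^sup>2 * SS z t) + norm (erre z t)"
    unfolding SSe_def by (rule norm_triangle_ineq)
  also have "\<dots> \<le> 64 * zsum dev t * ?W * tau z ^ falls t + 150 * ?W * tau z ^ blocks t"
    using norm_SS_le[of t] norm_qf_sq_mult_le[of t "SS z t"] norm_erre_le[of t] by linarith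
  also have "\<dots> \<le> 64 * zsum dev t * ?W * tau z ^ falls t + 150 * ?W * tau z ^ falls t"
    using tau_blocks_le_falls by (intro add_left_mono mult_left_mono) auto
  finally show ?thesis by (simp add: algebra_simps)
qed

text \<open>On the unit circle a square of \<open>1 - z\<close> supplies a definite sign up to the
  factor \<open>z\<close>. This makes gains count positively in \<open>Ig_split\<close>.\<close>

lemma w_sq_eq: "(1 - z)\<^sup>2 = - z * of_real ((norm (1 - z))\<^sup>2)"
proof -
  have "complex_of_real ((norm (1 - z))\<^sup>2) = (1 - z) * (1 - cnj z)"
    using complex_norm_square[of "1 - z"] by simp
  also have "\<dots> = (1 - z) * (1 - 1 / z)" by (simp add: inverse_unit[OF z])
  finally show ?thesis using unit_nonzero[OF z] by (simp add: field_simps power2_eq_square)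
qed

text \<open>\<open>- z * phi z = - 1 / (2 - z)\<close> differs from \<open>- 1\<close> by
  \<open>(1 - z) / (2 - z)\<close>, which contributes the third factor
  \<open>norm (1 - z)\<close>.\<close>

lemma norm_qf_minus_real:
  assumes "0 \<le> x"
  shows "norm (qf z x - of_real (1 - x / 2 * (norm (1 - z))\<^sup>2)) \<le> x / 2 * norm (1 - z) ^ 3"
proof -
  let ?W = "(norm (1 - z))\<^sup>2"
  have "qf z x - of_real (1 - x / 2 * ?W) = of_real (x / 2 * ?W) * ((1 - z) / (2 - z))"
    unfolding qf_def w_sq_eq phi_def using unit_nonzero[OF z] by (simp add: field_simps)
  also have "norm \<dots> \<le> x / 2 * ?W * (norm (1 - z) / 1)"
    unfolding norm_mult[of "of_real (x / 2 * ?W)"] norm_of_real norm_divide[of "1 - z"]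
    using assms norm_2_minus_ge[OF z] by (intro mult_mono divide_left_mono) (auto simp: abs_mult)
  finally show ?thesis by (simp add: power2_eq_square power3_eq_cube)
qed

section \<open>Approximation by real quantities near \<open>z = 1\<close>\<close>

context
  assumes w1: "norm (1 - z) \<le> 1"
begin

abbreviation "EEz \<equiv> EE ((norm (1 - z))\<^sup>2)"

lemma wsq_bounds: "0 \<le> (norm (1 - z))\<^sup>2" "(norm (1 - z))\<^sup>2 \<le> 1"
  using w1 by (auto intro: power_le_one)

lemma E_bounds: "0 \<le> EEz t" "EEz t \<le> 1"
  using EE_bounds[OF wsq_bounds] by auto

lemma norm_delta_le: 
  assumes "t > 0" shows "norm (delta z t) \<le> (3 * gain t + 64 * dev t) * norm (1 - z)"
proof -
  have g: "norm (of_real (gain t) * (1 - z)) \<le> gain t * norm (1 - z)"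
    using gain_nonneg[of t] by (simp add: norm_mult)
  have "delta z t = of_real (gain t) * (1 - z) * BB z t + err z t" by (simp add: err_def)
  then have "norm (delta z t) \<le> norm (of_real (gain t) * (1 - z) * BB z t) + norm (err z t)"
    using norm_triangle_ineq by metis
  also have "\<dots> \<le> 3 * (gain t * norm (1 - z)) * tau z ^ blocks t + 64 * dev t * (norm (1 - z))\<^sup>2 * tau z ^ blocks t"
    using norm_mult_BB_le[OF z g, of t] norm_err_le[OF z assms] by linarith
  also have "\<dots> \<le> 3 * (gain t * norm (1 - z)) * 1 + 64 * dev t * norm (1 - z) * 1"
    using tau_power_pos[OF z, of "blocks t"] gain_nonneg[of t] dev_nonneg[of t] w1
    by (intro add_mono mult_mono mult_nonneg_nonneg) (auto simp: power2_eq_square intro: mult_left_le_one_le)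
  finally show ?thesis by (simp add: algebra_simps)
qed

text \<open>Since \<open>qf\<close> and \<open>EE\<close> are bounded by 1, the one-step errors
  simply add up; \<open>wt\<close> collects the three contributions of a zero.\<close>

lemma norm_BB_minus_E: "norm (BB z t - of_real (EEz t)) \<le> zsum wt t * norm (1 - z) ^ 3"
proof (induction t rule: bin_induct)
  case (even t)
  let ?w = "norm (1 - z)" and ?q = "qf z (x0 t)" and ?p = "1 - x0 t / 2 * (norm (1 - z))\<^sup>2"
  have "BB z (2 * t) - of_real (EEz (2 * t))
      = ?q * (BB z t - of_real (EEz t)) + (?q - of_real ?p) * of_real (EEz t) + (1 - z)\<^sup>2 * delta z t"
    unfolding BB_even_step[OF z] EE_simps(2)[OF even(1)] by (simp add: algebra_simps)
  then have "norm (BB z (2 * t) - of_real (EEz (2 * t)))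
      \<le> norm (?q * (BB z t - of_real (EEz t))) + norm ((?q - of_real ?p) * of_real (EEz t)) + norm ((1 - z)\<^sup>2 * delta z t)"
    by (metis norm_triangle_ineq norm_triangle_le add_right_mono)
  also have "\<dots> = norm ?q * norm (BB z t - of_real (EEz t)) + norm (?q - of_real ?p) * EEz t + ?w\<^sup>2 * norm (delta z t)"
    using E_bounds[of t] by (simp only: norm_mult norm_power norm_of_real abs_of_nonneg)
  also have "\<dots> \<le> 1 * (zsum wt t * ?w ^ 3) + (x0 t / 2 * ?w ^ 3) * 1 + ?w\<^sup>2 * ((3 * gain t + 64 * dev t) * ?w)"
    using even norm_qf_le'[of t] E_bounds[of t] x0_nonneg[of t] norm_qf_minus_real[of "x0 t"] norm_delta_le[OF even(1)]
    by (intro add_mono mult_mono mult_left_mono) auto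
  also have "\<dots> = zsum wt (2 * t) * ?w ^ 3"
    unfolding zsum_simps(2)[OF even(1)] wt_def by (simp add: algebra_simps power2_eq_square power3_eq_cube)
  finally show ?case .
qed (simp_all add: EE_simps zsum_simps)

lemma norm_MM_minus_E:
  "norm (MM z t - of_real (zsum gain t * EEz t)) \<le> zsum gain t * (zsum wt t * norm (1 - z) ^ 3 + (norm (1 - z))\<^sup>2)"
proof (induction t rule: bin_induct)
  case (even t)
  let ?w = "norm (1 - z)" and ?q = "qf z (x0 t)" and ?p = "1 - x0 t / 2 * (norm (1 - z))\<^sup>2"
  let ?g = "gain t" and ?G = "zsum gain t" and ?a = "x0 t / 2"
  have nn: "0 \<le> ?G" "0 \<le> ?g" "0 \<le> zsum wt t" "0 \<le> ?a" "?a \<le> 1" "?a \<le> wt t"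
    using zsum_nonneg[of gain t] gain_nonneg zsum_nonneg[of wt t] wt_nonneg x0_nonneg[of t] x0_le[of t] dev_nonneg[of t]
    by (auto simp: wt_def[of t])
  define A where "A = ?q * (MM z t - of_real (?G * EEz t))"
  define B where "B = (?q - of_real ?p) * of_real (?G * EEz t)"
  define C where "C = of_real ?g * (BB z t - of_real (EEz t))"
  \<comment> \<open>This arises because the new gain is multiplied by \<open>BB z t\<close>, close
    to \<open>EEz t\<close> and not to \<open>EEz (2 * t)\<close>.\<close>
  define D where "D = complex_of_real (?g * ?a * ?w\<^sup>2 * EEz t)"
  have eq: "MM z (2 * t) - of_real (zsum gain (2 * t) * EEz (2 * t)) = A + B + C + D"
    unfolding A_def B_def C_def D_def MM_simps(2)[OF even(1)] zsum_simps(2)[OF even(1)] EE_simps(2)[OF even(1)]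
    by (simp add: algebra_simps)
  have "norm A \<le> 1 * (?G * (zsum wt t * ?w ^ 3 + ?w\<^sup>2))"
    unfolding A_def norm_mult using even norm_qf_le'[of t] by (intro mult_mono) auto
  moreover have "norm B \<le> (?a * ?w ^ 3) * (?G * 1)"
    unfolding B_def norm_mult norm_of_real using norm_qf_minus_real[of "x0 t"] x0_nonneg[of t] E_bounds[of t] nn
    by (intro mult_mono) (auto simp: abs_mult intro: mult_left_le)
  moreover have "norm C \<le> ?g * (zsum wt t * ?w ^ 3)"
    unfolding C_def norm_mult norm_of_real using norm_BB_minus_E[of t] nn by (intro mult_mono) auto
  moreover have "norm D \<le> ?g * 1 * ?w\<^sup>2 * 1"
  proof -
    have "0 \<le> ?g * ?a * ?w\<^sup>2 * EEz t" using nn E_bounds[of t] by (intro mult_nonneg_nonneg) simp_all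
    moreover have "?g * ?a * ?w\<^sup>2 * EEz t \<le> ?g * 1 * ?w\<^sup>2 * 1"
      using nn E_bounds[of t] by (intro mult_mono mult_nonneg_nonneg) simp_all
    ultimately show ?thesis unfolding D_def norm_of_real by linarith
  qed
  moreover have "norm (A + B + C + D) \<le> norm A + norm B + norm C + norm D"
    by (metis norm_triangle_ineq norm_triangle_le add_right_mono)
  ultimately have "norm (A + B + C + D)
      \<le> ?G * (zsum wt t * ?w ^ 3 + ?w\<^sup>2) + ?a * (?w ^ 3 * ?G) + ?g * (zsum wt t * ?w ^ 3) + ?g * ?w\<^sup>2"
    by (simp add: mult_ac)
  also have "\<dots> \<le> ?G * (zsum wt t * ?w ^ 3 + ?w\<^sup>2) + wt t * (?w ^ 3 * ?G) + ?g * ((zsum wt t + wt t) * ?w ^ 3) + ?g * ?w\<^sup>2"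
    using nn wt_nonneg[of t] by (intro add_mono mult_mono mult_left_mono mult_right_mono) auto
  also have "\<dots> = zsum gain (2 * t) * (zsum wt (2 * t) * ?w ^ 3 + ?w\<^sup>2)"
    unfolding zsum_simps(2)[OF even(1)] by (simp add: algebra_simps)
  finally show ?case unfolding eq .
qed (simp_all add: MM_simps zsum_simps EE_simps)

text \<open>The lower bound linear in \<open>(norm (1 - z))\<^sup>2\<close> is useful only very
  close to 1. Farther out \<open>EE \<ge> 0\<close> takes over, hence the maximum with 0, and only
  the approximation error is lost.\<close>

lemma Re_MMe_ge:
  "Re (MMe z t) \<ge> GG t * (max 0 (1 - (norm (1 - z))\<^sup>2 * (zsum wt t + 2)) - ((zsum wt t + 2) * norm (1 - z) ^ 3 + 2 * (norm (1 - z))\<^sup>2))"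
proof -
  let ?w = "norm (1 - z)" and ?q = "qf z (x0 t)" and ?p = "1 - x0 t / 2 * (norm (1 - z))\<^sup>2"
  let ?G = "zsum gain t" and ?a = "x0 t / 2" and ?x = "x1 t"
  have nn: "0 \<le> ?G" "0 \<le> zsum wt t" "0 \<le> ?a" "?a \<le> 1" "0 \<le> ?x"
    using zsum_nonneg[OF gain_nonneg] zsum_nonneg[OF wt_nonneg] x0_nonneg[of t] x0_le[of t] x0_le_x1[of t]
    by auto
  have ay: "0 \<le> ?a * ?w\<^sup>2" "?a * ?w\<^sup>2 \<le> 1 * ?w\<^sup>2" "?w\<^sup>2 \<le> 1"
    using nn(3) wsq_bounds mult_right_mono[OF nn(4) wsq_bounds(1)] by auto
  then have p: "0 \<le> ?p" "?p \<le> 1" "0 \<le> ?p\<^sup>2" "?p\<^sup>2 \<le> 1" by (auto intro: power_le_one)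
  define A where "A = ?q\<^sup>2 * (MM z t - of_real (?G * EEz t))"
  define B where "B = (?q - of_real ?p) * (?q + of_real ?p) * of_real (?G * EEz t)"
  define C where "C = of_real ?x * (BB z t - of_real (EEz t))"
  define D where "D = complex_of_real (?x * (1 - ?p\<^sup>2) * EEz t)"
  have eq: "MMe z t - of_real (GG t * (?p\<^sup>2 * EEz t)) = A + B + C + D"
  proof -
    have "q\<^sup>2 * m + x * b - (g + x) * (p\<^sup>2 * e)
        = q\<^sup>2 * (m - g * e) + (q - p) * (q + p) * (g * e) + x * (b - e) + x * (1 - p\<^sup>2) * e"
      for q m x b g p e :: complex
      by (simp add: algebra_simps power2_eq_square)
    then show ?thesis
      unfolding A_def B_def C_def D_def MMe_def GG_def of_real_add of_real_mult of_real_diff of_real_power of_real_1 .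
  qed
  have "norm A \<le> ?G * (zsum wt t * ?w ^ 3 + ?w\<^sup>2)"
    using norm_qf_sq_mult_le[of t "MM z t - of_real (?G * EEz t)"] norm_MM_minus_E[of t] unfolding A_def by linarith
  moreover have "norm B \<le> (?a * ?w ^ 3) * 2 * (?G * 1)"
  proof -
    have "norm (?q + of_real ?p) \<le> norm ?q + norm (complex_of_real ?p)" by (rule norm_triangle_ineq)
    also have "\<dots> \<le> 1 + 1" using norm_qf_le'[of t] p by (intro add_mono) (auto simp only: norm_of_real abs_of_nonneg)
    finally have "norm (?q + of_real ?p) \<le> 2" by simp
    then show ?thesis
      unfolding B_def norm_mult[of _ "of_real (?G * EEz t)"] norm_mult[of "?q - of_real ?p"] norm_of_real
      using norm_qf_minus_real[of "x0 t"] x0_nonneg[of t] E_bounds[of t] nn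
      by (intro mult_mono) (auto simp: abs_mult intro: mult_left_le)
  qed
  moreover have "(?a * ?w ^ 3) * 2 * (?G * 1) \<le> (1 * ?w ^ 3) * 2 * (?G * 1)"
    using nn by (intro mult_right_mono) auto
  moreover have "norm C \<le> ?x * (zsum wt t * ?w ^ 3)"
    unfolding C_def norm_mult norm_of_real using norm_BB_minus_E[of t] nn by (intro mult_mono) auto
  moreover have "norm D \<le> ?x * (2 * ?w\<^sup>2) * 1"
  proof -
    have "1 - ?p\<^sup>2 = (1 - ?p) * (1 + ?p)" by (simp add: power2_eq_square algebra_simps)
    also have "\<dots> \<le> ?w\<^sup>2 * 2" using p ay by (intro mult_mono) auto
    finally have d: "1 - ?p\<^sup>2 \<le> 2 * ?w\<^sup>2" by simp
    have "0 \<le> ?x * (1 - ?p\<^sup>2) * EEz t" using nn E_bounds[of t] p by (intro mult_nonneg_nonneg) simp_all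
    moreover have "?x * (1 - ?p\<^sup>2) * EEz t \<le> ?x * (2 * ?w\<^sup>2) * 1"
      using nn E_bounds[of t] by (intro mult_mono mult_left_mono d mult_nonneg_nonneg) simp_all
    ultimately show ?thesis unfolding D_def norm_of_real by linarith
  qed
  moreover have "norm (A + B + C + D) \<le> norm A + norm B + norm C + norm D"
    by (metis norm_triangle_ineq norm_triangle_le add_right_mono)
  ultimately have "norm (A + B + C + D)
      \<le> ?G * (zsum wt t * ?w ^ 3 + ?w\<^sup>2) + ?G * (2 * ?w ^ 3) + ?x * (zsum wt t * ?w ^ 3) + ?x * (2 * ?w\<^sup>2)"
    by (simp add: mult_ac)
  also have "\<dots> \<le> ?G * (zsum wt t * ?w ^ 3 + 2 * ?w\<^sup>2) + ?G * (2 * ?w ^ 3) + ?x * ((zsum wt t + 2) * ?w ^ 3) + ?x * (2 * ?w\<^sup>2)"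
    using nn by (intro add_mono mult_left_mono mult_right_mono) auto
  also have "\<dots> = GG t * ((zsum wt t + 2) * ?w ^ 3 + 2 * ?w\<^sup>2)"
    unfolding GG_def by (simp add: algebra_simps)
  finally have *: "norm (MMe z t - of_real (GG t * (?p\<^sup>2 * EEz t))) \<le> GG t * ((zsum wt t + 2) * ?w ^ 3 + 2 * ?w\<^sup>2)"
    unfolding eq .
  have "max 0 (1 - ?w\<^sup>2 * (zsum wt t + 2)) \<le> ?p\<^sup>2 * EEz t"
  proof -
    have "1 - ?w\<^sup>2 * (zsum wt t + 2) = (1 - ?w\<^sup>2 * zsum wt t) - 2 * ?w\<^sup>2" by (simp add: algebra_simps)
    also have "\<dots> \<le> EEz t - 2 * ?w\<^sup>2 * EEz t"
      using EE_bounds(3)[OF wsq_bounds, of t] E_bounds[of t] by (intro diff_mono) (auto intro: mult_left_le)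
    also have "\<dots> = (1 - 2 * ?w\<^sup>2) * EEz t" by (simp add: algebra_simps)
    also have "\<dots> \<le> ?p\<^sup>2 * EEz t"
    proof (rule mult_right_mono)
      have "1 - 2 * v \<le> (1 - v)\<^sup>2" for v :: real by (simp add: power2_eq_square algebra_simps)
      from this[of "?a * ?w\<^sup>2"] show "1 - 2 * ?w\<^sup>2 \<le> ?p\<^sup>2" using ay by linarith
    qed (rule E_bounds)
    finally show ?thesis using p E_bounds[of t] by simp
  qed
  moreover have "0 \<le> GG t" using nn by (simp add: GG_def)
  ultimately have "GG t * max 0 (1 - ?w\<^sup>2 * (zsum wt t + 2)) \<le> GG t * (?p\<^sup>2 * EEz t)"
    by (intro mult_left_mono)
  moreover have "\<bar>Re (MMe z t) - GG t * (?p\<^sup>2 * EEz t)\<bar> \<le> GG t * ((zsum wt t + 2) * ?w ^ 3 + 2 * ?w\<^sup>2)"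
    using * abs_Re_le_cmod[of "MMe z t - of_real (GG t * (?p\<^sup>2 * EEz t))"] by (simp del: of_real_mult)
  ultimately show ?thesis unfolding right_diff_distrib by linarith
qed

end

end

section \<open>Fourier inversion\<close>

lemma has_vector_derivative_cis: "(cis has_vector_derivative \<i> * cis \<theta>) (at \<theta>)"
proof -
  have "((\<lambda>\<theta>. exp (\<i> * of_real \<theta>)) has_vector_derivative \<i> * exp (\<i> * of_real \<theta>)) (at \<theta>)"
    by (rule has_vector_derivative_real_field) (auto intro!: derivative_eq_intros)
  then show ?thesis by (simp add: cis_conv_exp[abs_def])
qed

text \<open>Up to the factor \<open>\<i>\<close> the integrand is the derivative of the
  \<open>2 * pi\<close>-periodic function \<open>f \<circ> cis\<close>.\<close>

lemma has_integral_loop: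
  assumes "\<And>z. norm z = 1 \<Longrightarrow> (f has_field_derivative f' z) (at z)"
  shows "((\<lambda>\<theta>. cis \<theta> * f' (cis \<theta>)) has_integral 0) {- pi..pi}"
proof -
  have "((f \<circ> cis) has_vector_derivative \<i> * cis \<theta> * f' (cis \<theta>)) (at \<theta> within {- pi..pi})" for \<theta>
    by (rule has_vector_derivative_at_within[OF field_vector_diff_chain_at[OF has_vector_derivative_cis assms]]) simp
  then have "((\<lambda>\<theta>. \<i> * cis \<theta> * f' (cis \<theta>)) has_integral (f \<circ> cis) pi - (f \<circ> cis) (- pi)) {- pi..pi}"
    by (rule fundamental_theorem_of_calculus[rotated]) simp
  moreover have "cis (- pi) = cis pi" by (simp add: complex_eq_iff)
  ultimately have "((\<lambda>\<theta>. \<i> * cis \<theta> * f' (cis \<theta>)) has_integral 0) {- pi..pi}" by simp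
  from has_integral_mult_right[OF this, of "- \<i>"] show ?thesis
    by (simp add: mult.assoc[symmetric])
qed

lemma has_integral_cis_power_int:
  "((\<lambda>\<theta>. cis \<theta> powi k) has_integral (if k = 0 then 2 * of_real pi else 0)) {- pi..pi}"
proof (cases "k = 0")
  case True
  then show ?thesis using has_integral_const_real[of "1::complex" "- pi" pi]
    by (simp add: scaleR_conv_of_real)
next
  case False
  have "((\<lambda>z. z powi k / of_int k) has_field_derivative z powi (k - 1)) (at z)" if "norm z = 1" for z :: complex
    using that False by (auto intro!: derivative_eq_intros)
  from has_integral_loop[OF this] have "((\<lambda>\<theta>. cis \<theta> * cis \<theta> powi (k - 1)) has_integral 0) {- pi..pi}" by simp
  moreover have "cis \<theta> * cis \<theta> powi (k - 1) = cis \<theta> powi k" for \<theta>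
    using power_int_add[of "cis \<theta>" 1 "k - 1"] by simp
  ultimately show ?thesis using False by simp
qed

text \<open>Functions \<open>F = 1 + (1 - z) * A\<close> on the unit circle, with \<open>I\<close> the integral of \<open>z * A\<close>. For the characteristic
  function of a distribution on the integers, \<open>I / (2 * pi)\<close> is the mass of the negative integers.\<close>
definition has_tail :: "(complex \<Rightarrow> complex) \<Rightarrow> complex \<Rightarrow> bool" where
  "has_tail F I \<longleftrightarrow> (\<exists>A. (\<forall>\<theta>. F (cis \<theta>) = 1 + (1 - cis \<theta>) * A \<theta>) \<and>
     ((\<lambda>\<theta>. cis \<theta> * A \<theta>) has_integral I) {- pi..pi})"

lemma has_tailI:
  assumes "\<And>\<theta>. F (cis \<theta>) = 1 + (1 - cis \<theta>) * A \<theta>" "((\<lambda>\<theta>. cis \<theta> * A \<theta>) has_integral I) {- pi..pi}"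
  shows "has_tail F I"
  using assms unfolding has_tail_def by blast

lemma has_tail_power_int:
  "has_tail (\<lambda>z. z powi k) (if k \<ge> 0 then 0 else 2 * of_real pi)"
proof (cases "k \<ge> 0")
  case True
  then obtain n where n: "k = int n" by (metis nonneg_int_cases)
  \<comment> \<open>Here \<open>z * A\<close> contains positive powers of \<open>z\<close> only, so
    it integrates to 0.\<close>
  let ?A = "\<lambda>\<theta>. - (\<Sum>j<n. cis \<theta> ^ j)"
  have "cis \<theta> powi k = 1 + (1 - cis \<theta>) * ?A \<theta>" for \<theta>
    using one_diff_power_eq[of "cis \<theta>" n] by (simp add: n algebra_simps)
  moreover have "((\<lambda>\<theta>. cis \<theta> * ?A \<theta>) has_integral - (\<Sum>j<n. 0)) {- pi..pi}"
  proof -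
    have "((\<lambda>\<theta>. - (\<Sum>j<n. cis \<theta> powi (int j + 1))) has_integral - (\<Sum>j<n. 0)) {- pi..pi}"
      using has_integral_cis_power_int[of "int _ + 1"] by (intro has_integral_neg has_integral_sum) auto
    moreover have "cis \<theta> powi (int j + 1) = cis \<theta> * cis \<theta> ^ j" for \<theta> j
      using power_int_add[of "cis \<theta>" "int j" 1] by simp
    ultimately show ?thesis by (simp add: sum_distrib_left)
  qed
  ultimately have "has_tail (\<lambda>z. z powi k) (- (\<Sum>j<n. 0))" by (rule has_tailI)
  then show ?thesis using True by simp
next
  case False
  then obtain n where n: "k = - int n" "n > 0"
    by (metis int_cases3 nle_le of_nat_0_le_iff)
  \<comment> \<open>Here the summand \<open>j = n - 1\<close> of \<open>z * A\<close> is the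
    constant 1, the only one with nonzero integral.\<close>
  let ?A = "\<lambda>\<theta>. (\<Sum>j<n. cis \<theta> powi (int j - int n))"
  have shift: "cis \<theta> powi (int j - int n) = cis \<theta> ^ j / cis \<theta> ^ n" for \<theta> j
    by (simp add: power_int_diff)
  have "cis \<theta> powi k = 1 + (1 - cis \<theta>) * ?A \<theta>" for \<theta>
  proof -
    have "(1 - cis \<theta>) * ?A \<theta> = (1 - cis \<theta>) * (\<Sum>j<n. cis \<theta> ^ j) / cis \<theta> ^ n"
      by (simp only: shift sum_divide_distrib[symmetric] times_divide_eq_right)
    also have "\<dots> = (1 - cis \<theta> ^ n) / cis \<theta> ^ n" by (simp add: one_diff_power_eq)
    also have "\<dots> = cis \<theta> powi k - 1" by (simp add: n diff_divide_distrib power_int_minus inverse_eq_divide)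
    finally show ?thesis by simp
  qed
  moreover have "((\<lambda>\<theta>. cis \<theta> * ?A \<theta>) has_integral 2 * of_real pi) {- pi..pi}"
  proof -
    have "((\<lambda>\<theta>. \<Sum>j<n. cis \<theta> powi (int j + 1 - int n)) has_integral
        (\<Sum>j<n. if int j + 1 - int n = 0 then 2 * of_real pi else 0)) {- pi..pi}"
      by (intro has_integral_sum has_integral_cis_power_int) auto
    moreover have "(\<Sum>j<n. if int j + 1 - int n = 0 then 2 * of_real pi else 0)
        = (\<Sum>j<n. if j = n - 1 then 2 * complex_of_real pi else 0)"
      using n by (intro sum.cong) auto
    moreover have "cis \<theta> powi (int j + 1 - int n) = cis \<theta> * cis \<theta> powi (int j - int n)" for \<theta> j
      using power_int_add[of "cis \<theta>" "int j - int n" 1] by (simp add: algebra_simps)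
    ultimately show ?thesis using n by (simp add: sum_distrib_left)
  qed
  ultimately have "has_tail (\<lambda>z. z powi k) (2 * of_real pi)" by (rule has_tailI)
  then show ?thesis using False by simp
qed

lemma has_tail_mean:
  assumes "finite S" "S \<noteq> {}" "\<And>n. n \<in> S \<Longrightarrow> has_tail (F n) (I n)"
  shows "has_tail (\<lambda>z. (\<Sum>n\<in>S. F n z) / of_nat (card S)) ((\<Sum>n\<in>S. I n) / of_nat (card S))"
proof -
  have "\<forall>n\<in>S. \<exists>A. (\<forall>\<theta>. F n (cis \<theta>) = 1 + (1 - cis \<theta>) * A \<theta>) \<and>
     ((\<lambda>\<theta>. cis \<theta> * A \<theta>) has_integral I n) {- pi..pi}"
    using assms unfolding has_tail_def by blast
  then obtain A where A: "\<And>n \<theta>. n \<in> S \<Longrightarrow> F n (cis \<theta>) = 1 + (1 - cis \<theta>) * A n \<theta>"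
    "\<And>n. n \<in> S \<Longrightarrow> ((\<lambda>\<theta>. cis \<theta> * A n \<theta>) has_integral I n) {- pi..pi}"
    by metis
  have c: "of_nat (card S) \<noteq> (0::complex)" using assms by simp
  let ?A = "\<lambda>\<theta>. (\<Sum>n\<in>S. A n \<theta>) / of_nat (card S)"
  have "(\<Sum>n\<in>S. F n (cis \<theta>)) / of_nat (card S) = 1 + (1 - cis \<theta>) * ?A \<theta>" for \<theta>
  proof -
    have "(\<Sum>n\<in>S. F n (cis \<theta>)) = (\<Sum>n\<in>S. 1 + (1 - cis \<theta>) * A n \<theta>)"
      by (intro sum.cong A refl)
    also have "\<dots> = of_nat (card S) + (1 - cis \<theta>) * (\<Sum>n\<in>S. A n \<theta>)"
      by (simp add: sum.distrib sum_distrib_left)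
    finally show ?thesis using c by (simp add: field_simps)
  qed
  moreover have "((\<lambda>\<theta>. cis \<theta> * ?A \<theta>) has_integral (\<Sum>n\<in>S. I n) / of_nat (card S)) {- pi..pi}"
  proof -
    have "((\<lambda>\<theta>. (\<Sum>n\<in>S. cis \<theta> * A n \<theta>) / of_nat (card S)) has_integral (\<Sum>n\<in>S. I n) / of_nat (card S)) {- pi..pi}"
      by (intro has_integral_divide has_integral_sum assms A)
    then show ?thesis by (simp add: sum_distrib_left)
  qed
  ultimately show ?thesis by (rule has_tailI)
qed

text \<open>Mixtures of powers of \<open>phi\<close>, where \<open>p\<close> is the weight of \<open>phi ^ 0\<close>: in the variable \<open>w = 1 - z\<close> the powers are
  even, so that positive powers give equal mass to the negative and to the nonnegative integers.\<close>
definition balanced :: "(complex \<Rightarrow> complex) \<Rightarrow> real \<Rightarrow> bool" where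
  "balanced F p \<longleftrightarrow> has_tail F (of_real (pi * (1 - p))) \<and>
     (\<forall>m. ((\<lambda>\<theta>. cis \<theta> * (1 - cis \<theta>) * phi (cis \<theta>) ^ Suc m * F (cis \<theta>)) has_integral
            (if m = 0 then of_real (pi * p) else 0)) {- pi..pi})"

lemma balanced_one: "balanced (\<lambda>_. 1) 1"
proof -
  have "has_tail (\<lambda>_. 1) (of_real (pi * (1 - 1)))"
    unfolding has_tail_def by (intro exI[of _ "\<lambda>_. 0"]) simp
  moreover have "((\<lambda>\<theta>. cis \<theta> * (1 - cis \<theta>) * phi (cis \<theta>) ^ Suc m) has_integral
            (if m = 0 then of_real pi else 0)) {- pi..pi}" for m
  proof (cases "m = 0")
    case True
    \<comment> \<open>For \<open>m = 0\<close> the integrand is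
      \<open>1 / 2 - z / (2 * (2 - z))\<close>. The second part is \<open>z\<close> times a
      derivative, because \<open>Re (2 - z) \<ge> 1\<close> keeps \<open>Ln (2 - z)\<close> away
      from its branch cut.\<close>
    have "((\<lambda>z. - Ln (2 - z)) has_field_derivative 1 / (2 - z)) (at z)" if "norm z = 1" for z
    proof -
      have "Re z \<le> 1" using complex_Re_le_cmod[of z] that by simp
      then have "2 - z \<notin> \<real>\<^sub>\<le>\<^sub>0" by (auto simp: complex_nonpos_Reals_iff)
      then show ?thesis by (auto intro!: derivative_eq_intros simp: divide_inverse)
    qed
    from has_integral_loop[OF this]
    have "((\<lambda>\<theta>. cis \<theta> * (1 / (2 - cis \<theta>))) has_integral 0) {- pi..pi}" by simp
    from has_integral_diff[OF has_integral_const_real[of "1 / 2 :: complex" "- pi" pi] has_integral_mult_right[OF this, of "1 / 2"]]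
    have "((\<lambda>\<theta>. 1 / 2 - 1 / 2 * (cis \<theta> * (1 / (2 - cis \<theta>)))) has_integral of_real pi) {- pi..pi}"
      by (simp add: scaleR_conv_of_real)
    moreover have "1 / 2 - 1 / 2 * (cis \<theta> * (1 / (2 - cis \<theta>))) = cis \<theta> * (1 - cis \<theta>) * phi (cis \<theta>) ^ Suc m" for \<theta>
      using unit_nonzero[of "cis \<theta>"] True by (simp add: phi_def divide_simps) (simp add: algebra_simps)
    ultimately show ?thesis using True by simp
  next
    case False
    then obtain k where k: "m = Suc k" by (cases m) auto
    \<comment> \<open>Evenness in \<open>1 - z\<close> at work: the derivative of \<open>phi\<close>
      is \<open>- 2 * (1 - z) * phi z ^ 2\<close>, so \<open>(1 - z) * phi z ^ Suc m\<close> has an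
      antiderivative.\<close>
    have "((\<lambda>z. - 1 / (2 * of_nat m) * phi z ^ m) has_field_derivative (1 - z) * phi z ^ Suc m) (at z)"
      if "norm z = 1" for z
    proof -
      note nz = unit_nonzero[OF that]
      have "(phi has_field_derivative - 2 * (1 - z) * phi z ^ 2) (at z)"
        unfolding phi_def[abs_def] using nz
        by (auto intro!: derivative_eq_intros simp: field_simps power2_eq_square)
      from DERIV_cmult[OF DERIV_power[OF this, of m], of "- 1 / (2 * of_nat m)"] show ?thesis
        by (rule DERIV_cong) (simp add: k divide_simps power2_eq_square del: of_nat_Suc, simp add: algebra_simps)
    qed
    from has_integral_loop[OF this] show ?thesis using False by (simp add: mult.assoc)
  qed
  ultimately show ?thesis unfolding balanced_def mult_1_right by blast
qed

text \<open>Multiplication by \<open>qf\<close> adds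
  \<open>x / 2 * (1 - z)\<^sup>2 * phi * F\<close>, whose tail is the integral with
  \<open>m = 0\<close>. Writing \<open>qf\<close> as a mixture of 1 and \<open>phi\<close> expresses
  the new integrals by those with \<open>m\<close> and \<open>Suc m\<close>, which is why the
  definition quantifies over all \<open>m\<close>.\<close>

lemma balanced_qf:
  assumes "balanced F p"
  shows "balanced (\<lambda>z. F z * qf z x) (p * (1 - x / 2))"
proof -
  let ?J = "\<lambda>m \<theta>. cis \<theta> * (1 - cis \<theta>) * phi (cis \<theta>) ^ Suc m * F (cis \<theta>)"
  have J: "(?J m has_integral (if m = 0 then of_real (pi * p) else 0)) {- pi..pi}" for m
    using assms unfolding balanced_def by blast
  obtain A where A: "\<And>\<theta>. F (cis \<theta>) = 1 + (1 - cis \<theta>) * A \<theta>"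
    "((\<lambda>\<theta>. cis \<theta> * A \<theta>) has_integral of_real (pi * (1 - p))) {- pi..pi}"
    using assms unfolding balanced_def has_tail_def by blast
  have "((\<lambda>\<theta>. cis \<theta> * (1 - cis \<theta>) * phi (cis \<theta>) ^ Suc m * (F (cis \<theta>) * qf (cis \<theta>) x)) has_integral
            (if m = 0 then of_real (pi * (p * (1 - x / 2))) else 0)) {- pi..pi}" for m
  proof -
    have "((\<lambda>\<theta>. of_real (1 - x / 2) * ?J m \<theta> + of_real (x / 2) * ?J (Suc m) \<theta>) has_integral
        of_real (1 - x / 2) * (if m = 0 then of_real (pi * p) else 0) + of_real (x / 2) * 0) {- pi..pi}"
      using J[of "Suc m"] by (intro has_integral_add has_integral_mult_right J) simp
    moreover have "of_real (1 - x / 2) * ?J m \<theta> + of_real (x / 2) * ?J (Suc m) \<theta>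
        = cis \<theta> * (1 - cis \<theta>) * phi (cis \<theta>) ^ Suc m * (F (cis \<theta>) * qf (cis \<theta>) x)" for \<theta>
      unfolding qf_mix[OF norm_cis] power_Suc[of _ "Suc m"] by (simp only: distrib_left distrib_right mult_ac)
    ultimately show ?thesis by (simp add: mult_ac split: if_splits)
  qed
  moreover have "has_tail (\<lambda>z. F z * qf z x) (of_real (pi * (1 - p * (1 - x / 2))))"
  proof -
    let ?A = "\<lambda>\<theta>. A \<theta> + of_real (x / 2) * ((1 - cis \<theta>) * phi (cis \<theta>) * F (cis \<theta>))"
    have "F (cis \<theta>) * qf (cis \<theta>) x = 1 + (1 - cis \<theta>) * ?A \<theta>" for \<theta>
    proof -
      have "F (cis \<theta>) * qf (cis \<theta>) x
          = F (cis \<theta>) + (1 - cis \<theta>) * (of_real (x / 2) * ((1 - cis \<theta>) * phi (cis \<theta>) * F (cis \<theta>)))"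
        unfolding qf_def power2_eq_square by (simp only: distrib_left distrib_right mult_ac mult_1)
      then show ?thesis using A(1)[of \<theta>] by (simp add: distrib_left)
    qed
    moreover have "((\<lambda>\<theta>. cis \<theta> * ?A \<theta>) has_integral of_real (pi * (1 - p * (1 - x / 2)))) {- pi..pi}"
    proof -
      have "((\<lambda>\<theta>. cis \<theta> * A \<theta> + of_real (x / 2) * ?J 0 \<theta>) has_integral
          of_real (pi * (1 - p)) + of_real (x / 2) * of_real (pi * p)) {- pi..pi}"
        using J[of 0] by (intro has_integral_add has_integral_mult_right A) simp
      moreover have "of_real (pi * (1 - p)) + of_real (x / 2) * of_real (pi * p)
          = complex_of_real (pi * (1 - p * (1 - x / 2)))"
        unfolding of_real_mult[symmetric] of_real_add[symmetric] by (simp add: algebra_simps)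
      moreover have "cis \<theta> * ?A \<theta> = cis \<theta> * A \<theta> + of_real (x / 2) * ?J 0 \<theta>" for \<theta>
        by (simp add: distrib_left mult_ac)
      ultimately show ?thesis by simp
    qed
    ultimately show ?thesis by (rule has_tailI)
  qed
  ultimately show ?thesis unfolding balanced_def by blast
qed

lemma balanced_Phi: "\<exists>p\<ge>0. balanced (\<lambda>z. Phi z t) p"
proof (induction t rule: bin_induct)
  case zero
  then show ?case using balanced_one by (auto simp: Phi_simps intro!: exI[of _ 1])
next
  case (even t)
  then obtain p where p: "p \<ge> 0" "balanced (\<lambda>z. Phi z t) p" by blast
  from balanced_qf[OF p(2), of "x0 t"] have "balanced (\<lambda>z. Phi z (2 * t)) (p * (1 - x0 t / 2))"
    using even by (simp add: Phi_simps)
  moreover have "0 \<le> p * (1 - x0 t / 2)" using p x0_le[of t] by simp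
  ultimately show ?case by blast
qed (simp add: Phi_simps)

section \<open>Densities\<close>

declare binsum.simps [simp del]

lemma binsum_simps: "binsum 0 = 0" "binsum (2 * n) = binsum n" "binsum (Suc (2 * n)) = Suc (binsum n)"
proof -
  show "binsum 0 = 0" by (simp add: binsum.simps)
  then show "binsum (2 * n) = binsum n" by (cases "n = 0") (simp_all add: binsum.simps[of "2 * n"])
  show "binsum (Suc (2 * n)) = Suc (binsum n)" by (simp add: binsum.simps[of "Suc (2 * n)"])
qed

lemma binsum_split: "a < 2 ^ M \<Longrightarrow> binsum (q * 2 ^ M + a) = binsum q + binsum a"
proof (induction M arbitrary: a)
  case (Suc M)
  have "a div 2 < 2 ^ M" using Suc by auto
  note IH = Suc.IH[OF this]
  show ?case
  proof (cases "even a")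
    case True
    then obtain b where a: "a = 2 * b" by blast
    have e: "q * 2 ^ Suc M + a = 2 * (q * 2 ^ M + b)" by (simp add: a)
    show ?thesis unfolding e binsum_simps using IH by (simp add: a binsum_simps)
  next
    case False
    then obtain b where a: "a = Suc (2 * b)" by (metis oddE Suc_eq_plus1)
    have e: "q * 2 ^ Suc M + a = Suc (2 * (q * 2 ^ M + b))" by (simp add: a)
    show ?thesis unfolding e binsum_simps using IH by (simp add: a binsum_simps)
  qed
qed (simp add: binsum_simps)

lemma sum_lessThan_add: "(\<Sum>n<m + k. f n) = (\<Sum>n<m. f n) + (\<Sum>a<k. f (m + a))"
  for f :: "nat \<Rightarrow> 'a :: comm_monoid_add"
  by (induction k) (simp_all add: add.assoc)

definition ge_ind :: "nat \<Rightarrow> nat \<Rightarrow> real" where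
  "ge_ind t n = of_bool (binsum (n + t) \<ge> binsum n)"

definition ge_freq :: "nat \<Rightarrow> nat \<Rightarrow> real" where
  "ge_freq t N = (\<Sum>n<N. ge_ind t n) / real N"

lemma ge_freq_eq: "ge_freq t N = real (card {n. n < N \<and> binsum (n + t) \<ge> binsum n}) / real N"
proof -
  have "{..<N} \<inter> {n. binsum (n + t) \<ge> binsum n} = {n. n < N \<and> binsum (n + t) \<ge> binsum n}" by auto
  then show ?thesis by (simp add: ge_freq_def ge_ind_def)
qed

lemma ge_ind_bounds: "0 \<le> ge_ind t n" "ge_ind t n \<le> 1"
  by (simp_all add: ge_ind_def)

lemma ge_ind_shift: "a + t < 2 ^ M \<Longrightarrow> ge_ind t (q * 2 ^ M + a) = ge_ind t a"
  using binsum_split[of a M q] binsum_split[of "a + t" M q]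
  by (simp add: ge_ind_def add.assoc)

text \<open>Only the last \<open>t\<close> residues modulo \<open>2 ^ M\<close> can produce a carry
  into the higher digits.\<close>

lemma ge_ind_block: "\<bar>(\<Sum>a<2 ^ M. ge_ind t (q * 2 ^ M + a)) - (\<Sum>a<2 ^ M. ge_ind t a)\<bar> \<le> real t"
proof -
  have "\<bar>(\<Sum>a<2 ^ M. ge_ind t (q * 2 ^ M + a)) - (\<Sum>a<2 ^ M. ge_ind t a)\<bar>
      \<le> (\<Sum>a<2 ^ M. \<bar>ge_ind t (q * 2 ^ M + a) - ge_ind t a\<bar>)"
    unfolding sum_subtractf[symmetric] by (rule sum_abs)
  also have "\<dots> \<le> (\<Sum>a<2 ^ M. of_bool (2 ^ M \<le> a + t))"
  proof (rule sum_mono)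
    fix a
    show "\<bar>ge_ind t (q * 2 ^ M + a) - ge_ind t a\<bar> \<le> of_bool (2 ^ M \<le> a + t)"
      using ge_ind_shift[of a t M q] ge_ind_bounds[of t a] ge_ind_bounds[of t "q * 2 ^ M + a"]
      by (cases "2 ^ M \<le> a + t") (auto simp: abs_le_iff)
  qed
  also have "\<dots> = real (card ({..<2 ^ M} \<inter> {a. 2 ^ M \<le> a + t}))" by simp
  also have "\<dots> \<le> real (card {2 ^ M - t..<2 ^ M})"
    by (intro of_nat_mono card_mono) auto
  also have "\<dots> \<le> real t" unfolding card_atLeastLessThan by (intro of_nat_mono) simp
  finally show ?thesis .
qed

lemma ge_ind_blocks: "\<bar>(\<Sum>n<q * 2 ^ M. ge_ind t n) - real q * (\<Sum>a<2 ^ M. ge_ind t a)\<bar> \<le> real q * real t"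
proof (induction q)
  case (Suc q)
  have "(\<Sum>n<Suc q * 2 ^ M. ge_ind t n) = (\<Sum>n<q * 2 ^ M. ge_ind t n) + (\<Sum>a<2 ^ M. ge_ind t (q * 2 ^ M + a))"
    using sum_lessThan_add[of "ge_ind t" "q * 2 ^ M" "2 ^ M"] by (simp add: add.commute)
  then show ?case
    using Suc ge_ind_block[of t q M] by (simp add: distrib_right)
qed simp

text \<open>Each complete block of length \<open>2 ^ M\<close> contributes an error of at most
  \<open>t\<close>; the incomplete block, and replacing the quotient by \<open>N / 2 ^ M\<close>,
  cost at most \<open>2 ^ M\<close> each.\<close>

lemma ge_freq_approx:
  assumes "N > 0"
  shows "\<bar>ge_freq t N - ge_freq t (2 ^ M)\<bar> \<le> real t / 2 ^ M + 2 * 2 ^ M / real N"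
proof -
  define K :: nat where "K = 2 ^ M"
  define q where "q = N div K"
  define F where "F = (\<Sum>a<K. ge_ind t a)"
  have K: "K > 0" by (simp add: K_def)
  have F: "0 \<le> F" "F \<le> real K"
    using sum_mono[of "{..<K}" "ge_ind t" "\<lambda>_. 1"] ge_ind_bounds by (auto simp: F_def intro: sum_nonneg)
  have N: "N = q * K + N mod K" by (simp add: q_def)
  have r: "real (N mod K) \<le> real K" using K by (simp add: less_imp_le)
  have qK: "real N = real q * real K + real (N mod K)"
    by (metis N of_nat_add of_nat_mult)
  have "(\<Sum>n<N. ge_ind t n) = (\<Sum>n<q * K. ge_ind t n) + (\<Sum>a<N mod K. ge_ind t (q * K + a))"
    using sum_lessThan_add[of "ge_ind t" "q * K" "N mod K"] N by simp
  moreover have "0 \<le> (\<Sum>a<N mod K. ge_ind t (q * K + a))"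
    using ge_ind_bounds by (intro sum_nonneg) auto
  moreover have "(\<Sum>a<N mod K. ge_ind t (q * K + a)) \<le> real K"
    using sum_mono[of "{..<N mod K}" "\<lambda>a. ge_ind t (q * K + a)" "\<lambda>_. 1"] ge_ind_bounds r by auto
  moreover have "\<bar>(\<Sum>n<q * K. ge_ind t n) - real q * F\<bar> \<le> real q * real t"
    using ge_ind_blocks[of t q M] by (simp add: K_def F_def)
  ultimately have 1: "\<bar>(\<Sum>n<N. ge_ind t n) - real q * F\<bar> \<le> real q * real t + real K" by linarith
  have "real N / real K * F - real q * F = real (N mod K) * (F / real K)"
    using K qK by (simp add: field_simps)
  moreover have "0 \<le> F / real K" "F / real K \<le> 1" using F K by auto
  ultimately have 2: "\<bar>real N / real K * F - real q * F\<bar> \<le> real K"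
    using mult_mono[of "real (N mod K)" "real K" "F / real K" 1] r F by (simp add: abs_mult)
  have 3: "real q * real t \<le> real N / real K * real t"
    using qK K by (intro mult_right_mono) (auto simp: field_simps)
  have "\<bar>(\<Sum>n<N. ge_ind t n) - real N / real K * F\<bar> \<le> real N / real K * real t + 2 * real K"
    using 1 2 3 by linarith
  then have "\<bar>(\<Sum>n<N. ge_ind t n) - real N / real K * F\<bar> / real N \<le> (real N / real K * real t + 2 * real K) / real N"
    by (intro divide_right_mono) auto
  moreover have "\<bar>(\<Sum>n<N. ge_ind t n) - real N / real K * F\<bar> / real N = \<bar>ge_freq t N - ge_freq t K\<bar>"
  proof -
    have "\<bar>(\<Sum>n<N. ge_ind t n) - real N / real K * F\<bar> / real N
        = \<bar>((\<Sum>n<N. ge_ind t n) - real N / real K * F) / real N\<bar>" by simp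
    also have "((\<Sum>n<N. ge_ind t n) - real N / real K * F) / real N = ge_freq t N - ge_freq t K"
      using assms by (simp add: ge_freq_def F_def diff_divide_distrib)
    finally show ?thesis .
  qed
  ultimately show ?thesis
    using assms by (simp add: K_def add_divide_distrib)
qed

lemma ge_freq_tendsto: "ge_freq t \<longlonglongrightarrow> c_dens t"
proof -
  have "Cauchy (ge_freq t)"
    unfolding Cauchy_def
  proof (intro allI impI)
    fix e :: real assume e: "e > 0"
    obtain M where M: "(1 / 2) ^ M < e / (4 * (real t + 1))"
      using real_arch_pow_inv[of "e / (4 * (real t + 1))" "1 / 2"] e by auto
    have "real t / 2 ^ M \<le> (real t + 1) * (1 / 2) ^ M" by (simp add: power_divide divide_right_mono)
    also have "\<dots> < (real t + 1) * (e / (4 * (real t + 1)))" using M by (intro mult_strict_left_mono) auto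
    also have "\<dots> = e / 4" using nonzero_mult_div_cancel_left[of "real t + 1" "e / 4"] by simp
    finally have tM: "real t / 2 ^ M < e / 4" .
    obtain N0 where N0: "real N0 > 8 * 2 ^ M / e" using reals_Archimedean2 by blast
    have close: "\<bar>ge_freq t N - ge_freq t (2 ^ M)\<bar> < e / 2" if "N \<ge> Suc N0" for N
    proof -
      have "real N > 8 * 2 ^ M / e" using N0 that by simp
      then have "2 * 2 ^ M / real N < e / 4" using e that by (simp add: field_simps)
      then show ?thesis using ge_freq_approx[of N t M] tM that by linarith
    qed
    show "\<exists>N. \<forall>m\<ge>N. \<forall>n\<ge>N. dist (ge_freq t m) (ge_freq t n) < e"
    proof (intro exI allI impI)
      fix m n assume "Suc N0 \<le> m" "Suc N0 \<le> n"
      from close[OF this(1)] close[OF this(2)] show "dist (ge_freq t m) (ge_freq t n) < e"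
        unfolding dist_real_def by linarith
    qed
  qed
  then have "convergent (ge_freq t)" by (simp add: Cauchy_convergent_iff)
  moreover have "c_dens t = lim (ge_freq t)"
    unfolding c_dens_def ge_freq_eq[abs_def] ..
  ultimately show ?thesis by (simp add: convergent_LIMSEQ_iff)
qed

section \<open>Characteristic functions over finite ranges and their limits\<close>

definition GM :: "nat \<Rightarrow> nat \<Rightarrow> complex \<Rightarrow> complex" where
  "GM M t z = (\<Sum>n<2 ^ M. z powi (int (binsum (n + t)) - int (binsum n))) / 2 ^ M"

lemma sum_lessThan_double: "(\<Sum>n<2 * k. f n) = (\<Sum>n<k. f (2 * n) + f (Suc (2 * n)))"
  for f :: "nat \<Rightarrow> 'a :: comm_monoid_add"
  by (induction k) (simp_all add: add.assoc)

lemma GM_even: "GM (Suc M) (2 * t) z = GM M t z"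
proof -
  have "(\<Sum>n<2 * 2 ^ M. z powi (int (binsum (n + 2 * t)) - int (binsum n)))
      = (\<Sum>n<2 ^ M. 2 * z powi (int (binsum (n + t)) - int (binsum n)))"
    unfolding sum_lessThan_double
  proof (rule sum.cong)
    fix n
    have "2 * n + 2 * t = 2 * (n + t)" "Suc (2 * n) + 2 * t = Suc (2 * (n + t))" by simp_all
    then show "z powi (int (binsum (2 * n + 2 * t)) - int (binsum (2 * n))) +
        z powi (int (binsum (Suc (2 * n) + 2 * t)) - int (binsum (Suc (2 * n))))
        = 2 * z powi (int (binsum (n + t)) - int (binsum n))"
      by (simp only: binsum_simps) simp
  qed simp
  then show ?thesis by (simp add: GM_def sum_distrib_left[symmetric])
qed

lemma GM_odd:
  assumes "z \<noteq> 0"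
  shows "GM (Suc M) (Suc (2 * t)) z = (z * GM M t z + GM M (Suc t) z / z) / 2"
proof -
  have "(\<Sum>n<2 * 2 ^ M. z powi (int (binsum (n + Suc (2 * t))) - int (binsum n)))
      = (\<Sum>n<2 ^ M. z * z powi (int (binsum (n + t)) - int (binsum n)) +
          z powi (int (binsum (n + Suc t)) - int (binsum n)) / z)"
    unfolding sum_lessThan_double
  proof (rule sum.cong)
    fix n
    have 1: "2 * n + Suc (2 * t) = Suc (2 * (n + t))" "Suc (2 * n) + Suc (2 * t) = 2 * (n + Suc t)" by simp_all
    have 2: "z powi (int (Suc a) - int b) = z * z powi (int a - int b)" for a b
      using power_int_add[of z 1 "int a - int b"] assms by (simp add: algebra_simps)
    have 3: "z powi (int a - int (Suc b)) = z powi (int a - int b) / z" for a b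
      using power_int_diff[of z "int a - int b" 1] assms by (simp add: algebra_simps)
    show "z powi (int (binsum (2 * n + Suc (2 * t))) - int (binsum (2 * n))) +
        z powi (int (binsum (Suc (2 * n) + Suc (2 * t))) - int (binsum (Suc (2 * n))))
        = z * z powi (int (binsum (n + t)) - int (binsum n)) + z powi (int (binsum (n + Suc t)) - int (binsum n)) / z"
      unfolding 1 binsum_simps 2 3 ..
  qed simp
  also have "\<dots> = z * (\<Sum>n<2 ^ M. z powi (int (binsum (n + t)) - int (binsum n))) +
      (\<Sum>n<2 ^ M. z powi (int (binsum (n + Suc t)) - int (binsum n))) / z"
    by (simp only: sum.distrib sum_distrib_left sum_divide_distrib)
  finally show ?thesis
    unfolding GM_def power_Suc using assms by (simp add: field_simps)
qed

lemma GM_zero: "GM M 0 z = 1"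
  by (simp add: GM_def)

lemma norm_mean_diff_le:
  fixes z :: complex
  assumes "norm z = 1" "norm (a - c) \<le> e" "norm (b - d) \<le> e"
  shows "norm ((z * a + b / z) / 2 - (z * c + d / z) / 2) \<le> e"
proof -
  have e: "(z * a + b / z) / 2 - (z * c + d / z) / 2 = (z * (a - c) + (b - d) / z) / 2"
    by (simp add: algebra_simps diff_divide_distrib add_divide_distrib)
  show ?thesis unfolding e using norm_mean_le[OF assms] by simp
qed

text \<open>\<open>psi z\<close> is the fixed point of the recursion, which contracts by 1/2. The
  factor \<open>norm (1 - z)\<close> in the bound is there to survive the division by
  \<open>1 - z\<close> in \<open>has_tail\<close>.\<close>

lemma GM_one_approx: "norm z = 1 \<Longrightarrow> norm (GM m 1 z - psi z) \<le> norm (1 - z) / 2 ^ m"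
proof (induction m)
  case 0
  note nz = unit_nonzero[OF 0]
  have "GM 0 1 z = z" by (simp add: GM_def binsum.simps binsum_simps)
  then have "GM 0 1 z - psi z = z * (z - 1) / (2 * z - 1)"
    using nz by (simp add: psi_def field_simps power2_eq_square)
  then have "norm (GM 0 1 z - psi z) = norm (1 - z) / norm (2 * z - 1)"
    using 0 by (simp add: norm_divide norm_mult norm_minus_commute)
  also have "\<dots> \<le> norm (1 - z) / 1"
    using norm_2z_minus_ge[OF 0] by (intro divide_left_mono) auto
  finally show ?case by simp
next
  case (Suc m)
  note nz = unit_nonzero[OF Suc.prems]
  have "GM (Suc m) 1 z = (z + GM m 1 z / z) / 2"
    using GM_odd[of z m 0] nz by (simp add: GM_zero)
  moreover have "psi z = (z + psi z / z) / 2"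
    using chi_simps(4)[OF Suc.prems, of 0] chi_simps(1,2)[OF Suc.prems] by simp
  ultimately have "GM (Suc m) 1 z - psi z = (z + GM m 1 z / z) / 2 - (z + psi z / z) / 2"
    by argo
  also have "\<dots> = (GM m 1 z - psi z) / (2 * z)" using nz by (simp add: field_simps)
  finally show ?case using Suc by (simp add: norm_divide norm_mult)
qed

text \<open>Every binary digit of \<open>t\<close> uses up one halving of the range of
  \<open>n\<close>, so \<open>L\<close> can be taken as the number of digits; taking means does not
  enlarge the error.\<close>

lemma GM_approx:
  "\<exists>L. \<forall>m z. norm z = 1 \<longrightarrow> norm (GM (m + L) t z - chi0 z t) \<le> norm (1 - z) / 2 ^ m \<and>
     norm (GM (m + L) (Suc t) z - chi1 z t) \<le> norm (1 - z) / 2 ^ m"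
proof (induction t rule: bin_induct)
  case zero
  show ?case using GM_one_approx by (intro exI[of _ 0]) (simp add: GM_zero chi_simps)
next
  case (even t)
  then obtain L where L: "\<And>m z. norm z = 1 \<Longrightarrow> norm (GM (m + L) t z - chi0 z t) \<le> norm (1 - z) / 2 ^ m"
    "\<And>m z. norm z = 1 \<Longrightarrow> norm (GM (m + L) (Suc t) z - chi1 z t) \<le> norm (1 - z) / 2 ^ m" by blast
  show ?case
  proof (intro exI[of _ "Suc L"] allI impI conjI)
    fix m and z :: complex assume z: "norm z = 1"
    show "norm (GM (m + Suc L) (2 * t) z - chi0 z (2 * t)) \<le> norm (1 - z) / 2 ^ m"
      using L(1)[OF z] by (simp add: GM_even chi_simps[OF z])
    show "norm (GM (m + Suc L) (Suc (2 * t)) z - chi1 z (2 * t)) \<le> norm (1 - z) / 2 ^ m"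
      unfolding add_Suc_right GM_odd[OF unit_nonzero(1)[OF z]] chi_simps[OF z]
      by (rule norm_mean_diff_le[OF z L(1)[OF z] L(2)[OF z]])
  qed
next
  case (odd t)
  then obtain L where L: "\<And>m z. norm z = 1 \<Longrightarrow> norm (GM (m + L) t z - chi0 z t) \<le> norm (1 - z) / 2 ^ m"
    "\<And>m z. norm z = 1 \<Longrightarrow> norm (GM (m + L) (Suc t) z - chi1 z t) \<le> norm (1 - z) / 2 ^ m" by blast
  show ?case
  proof (intro exI[of _ "Suc L"] allI impI conjI)
    fix m and z :: complex assume z: "norm z = 1"
    show "norm (GM (m + Suc L) (Suc (2 * t)) z - chi0 z (Suc (2 * t))) \<le> norm (1 - z) / 2 ^ m"
      unfolding add_Suc_right GM_odd[OF unit_nonzero(1)[OF z]] chi_simps[OF z]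
      by (rule norm_mean_diff_le[OF z L(1)[OF z] L(2)[OF z]])
    have "Suc (Suc (2 * t)) = 2 * Suc t" by simp
    then show "norm (GM (m + Suc L) (Suc (Suc (2 * t))) z - chi1 z (Suc (2 * t))) \<le> norm (1 - z) / 2 ^ m"
      using L(2)[OF z] by (simp only: GM_even chi_simps[OF z] add_Suc_right)
  qed
qed

lemma has_tail_GM: "has_tail (GM M t) (of_real (2 * pi * (1 - ge_freq t (2 ^ M))))"
proof -
  let ?k = "\<lambda>n. int (binsum (n + t)) - int (binsum n)"
  have "has_tail (\<lambda>z. (\<Sum>n\<in>{..<2 ^ M}. z powi ?k n) / of_nat (card {..<2 ^ M :: nat}))
      ((\<Sum>n\<in>{..<2 ^ M}. if ?k n \<ge> 0 then 0 else 2 * of_real pi) / of_nat (card {..<2 ^ M :: nat}))"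
    by (intro has_tail_mean has_tail_power_int) (auto simp: lessThan_empty_iff)
  moreover have "(\<Sum>n<2 ^ M. if ?k n \<ge> 0 then 0 else 2 * of_real pi)
      = complex_of_real (2 * pi * (2 ^ M - (\<Sum>n<2 ^ M. ge_ind t n)))"
  proof -
    have "(\<Sum>n<2 ^ M. if ?k n \<ge> 0 then 0 else 2 * of_real pi)
        = complex_of_real (\<Sum>n<2 ^ M. 2 * pi * (1 - ge_ind t n))"
      unfolding of_real_sum by (intro sum.cong) (auto simp: ge_ind_def)
    also have "(\<Sum>n<2 ^ M. 2 * pi * (1 - ge_ind t n)) = 2 * pi * (2 ^ M - (\<Sum>n<2 ^ M. ge_ind t n))"
      by (simp add: sum_distrib_left[symmetric] sum_subtractf)
    finally show ?thesis .
  qed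
  moreover have "complex_of_real (2 * pi * (2 ^ M - (\<Sum>n<2 ^ M. ge_ind t n))) / 2 ^ M
      = of_real (2 * pi * (1 - ge_freq t (2 ^ M)))"
    by (simp add: ge_freq_def field_simps)
  moreover have "(\<lambda>z. (\<Sum>n\<in>{..<2 ^ M}. z powi ?k n) / of_nat (card {..<2 ^ M :: nat})) = GM M t"
    by (simp add: GM_def[abs_def])
  ultimately show ?thesis by simp
qed

section \<open>The main integral\<close>

lemma continuous_on_phi: "continuous_on (sphere 0 1) phi"
  unfolding phi_def[abs_def] by (intro continuous_intros) (auto dest: unit_nonzero)

lemma continuous_on_psi: "continuous_on (sphere 0 1) psi"
  unfolding psi_def[abs_def] by (intro continuous_intros) (use unit_nonzero(3) in auto)

lemma continuous_on_qf: "continuous_on (sphere 0 1) (\<lambda>z. qf z x)"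
  unfolding qf_def by (intro continuous_intros continuous_on_phi)

lemma continuous_on_BB_YY:
  "continuous_on (sphere 0 1) (\<lambda>z. BB z t) \<and> continuous_on (sphere 0 1) (\<lambda>z. YY z t)"
proof (induction t rule: bin_induct)
  case (even t)
  then show ?case by (auto intro!: continuous_intros)
next
  case (odd t)
  then show ?case by (auto intro!: continuous_intros)
qed simp

lemma continuous_on_err: "continuous_on (sphere 0 1) (\<lambda>z. err z t)"
  unfolding err_def delta_def using continuous_on_BB_YY[of t]
  by (auto intro!: continuous_intros continuous_on_phi)

lemma continuous_on_MM_SS:
  "continuous_on (sphere 0 1) (\<lambda>z. MM z t) \<and> continuous_on (sphere 0 1) (\<lambda>z. SS z t)"
proof (induction t rule: bin_induct)
  case (even t)
  then show ?case
    using continuous_on_BB_YY[of t] continuous_on_err[of t] continuous_on_qf[of "x0 t"]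
    by (auto simp: MM_simps SS_simps intro!: continuous_intros)
qed (simp_all add: MM_simps SS_simps)

text \<open>By \<open>chi0_decomp\<close> this is \<open>- z\<close> times the difference of
  \<open>chi0\<close> and the comparison product, divided by \<open>1 - z\<close>. The sign turns
  less mass on the negative integers into a positive integral.\<close>

definition Ig :: "nat \<Rightarrow> complex \<Rightarrow> complex" where
  "Ig t z = - z * ((1 - z)\<^sup>2 * MMe z t + (1 - z) * SSe z t)"

lemma continuous_on_Ig: "continuous_on (sphere 0 1) (Ig t)"
  unfolding Ig_def MMe_def SSe_def erre_def
  using continuous_on_BB_YY[of t] continuous_on_MM_SS[of t] continuous_on_qf[of "x0 t"]
  by (auto intro!: continuous_intros continuous_on_phi continuous_on_psi)

definition JJ :: "nat \<Rightarrow> real" where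
  "JJ t = integral {- pi..pi} (\<lambda>\<theta>. Re (Ig t (cis \<theta>)))"

lemma has_integral_JJ: "((\<lambda>\<theta>. Re (Ig t (cis \<theta>))) has_integral JJ t) {- pi..pi}"
proof -
  have "continuous_on {- pi..pi} (\<lambda>\<theta>. Ig t (cis \<theta>))"
    by (rule continuous_on_compose2[OF continuous_on_Ig]) (auto intro!: continuous_intros)
  then have "continuous_on {- pi..pi} (\<lambda>\<theta>. Re (Ig t (cis \<theta>)))"
    by (rule continuous_on_Re)
  then show ?thesis unfolding JJ_def by (intro integrable_integral integrable_continuous_interval)
qed

lemma norm_1_minus_cis: "norm (1 - cis \<theta>) = 2 * \<bar>sin (\<theta> / 2)\<bar>"
proof (rule power2_eq_imp_eq)
  have "(norm (1 - cis \<theta>))\<^sup>2 = 2 - 2 * cos \<theta>" by (simp add: norm_w_sq)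
  also have "\<dots> = (2 * \<bar>sin (\<theta> / 2)\<bar>)\<^sup>2"
    using cos_double_sin[of "\<theta> / 2"] by (simp add: power_mult_distrib)
  finally show "(norm (1 - cis \<theta>))\<^sup>2 = (2 * \<bar>sin (\<theta> / 2)\<bar>)\<^sup>2" .
qed auto

lemma norm_1_minus_cis_le: "norm (1 - cis \<theta>) \<le> \<bar>\<theta>\<bar>"
  unfolding norm_1_minus_cis using abs_sin_x_le_abs_x[of "\<theta> / 2"] by simp

lemma norm_1_minus_cis_ge:
  assumes "\<bar>\<theta>\<bar> \<le> pi"
  shows "\<bar>\<theta>\<bar> / 2 \<le> norm (1 - cis \<theta>)"
proof -
  let ?x = "\<theta> / 2"
  have "(\<Sum>m<3. sin_coeff m * ?x ^ m) = ?x" by (simp add: eval_nat_numeral sin_coeff_def)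
  with Maclaurin_sin_bound[of ?x 3] have "\<bar>sin ?x - ?x\<bar> \<le> inverse 6 * \<bar>?x\<bar> ^ 3"
    by (simp add: fact_numeral)
  also have "\<bar>?x\<bar> ^ 3 = \<bar>?x\<bar> * \<bar>?x\<bar>\<^sup>2" by (simp add: power3_eq_cube power2_eq_square)
  \<comment> \<open>17/10 exceeds \<open>pi / 2\<close>, while
    \<open>(17 / 10)\<^sup>2 / 6 < 1 / 2\<close>.\<close>
  also have "\<bar>?x\<bar>\<^sup>2 \<le> (17 / 10)\<^sup>2" using assms pi_less_4 pi_approx by (intro power_mono) auto
  finally have "\<bar>sin ?x - ?x\<bar> \<le> inverse 6 * (\<bar>?x\<bar> * (17 / 10)\<^sup>2)" by (simp add: mult_left_mono)
  moreover have "\<bar>?x\<bar> \<le> \<bar>sin ?x\<bar> + \<bar>sin ?x - ?x\<bar>" by linarith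
  ultimately have "\<bar>sin ?x\<bar> \<ge> \<bar>?x\<bar> / 2" by (simp add: power2_eq_square)
  then show ?thesis unfolding norm_1_minus_cis by simp
qed

text \<open>The tails of \<open>GM\<close> and of the comparison product are subtracted. The product
  is balanced with some \<open>p \<ge> 0\<close>, so its nonnegative mass is
  \<open>(1 + p) / 2\<close>; the approximation by \<open>GM\<close> costs
  \<open>1 / 2 ^ m\<close>.\<close>

lemma ge_freq_ge:
  "\<exists>L. \<forall>m. ge_freq t (2 ^ (m + L)) \<ge> 1 / 2 + JJ t / (2 * pi) - 1 / 2 ^ m"
proof -
  obtain L where L: "\<And>m z. norm z = 1 \<Longrightarrow> norm (GM (m + L) t z - chi0 z t) \<le> norm (1 - z) / 2 ^ m"
    using GM_approx[of t] by blast
  obtain p0 where p0: "p0 \<ge> 0" "balanced (\<lambda>z. Phi z t) p0" using balanced_Phi by blast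
  define p where "p = p0 * (1 - x0 t / 2) * (1 - x0 t / 2)"
  have "balanced (\<lambda>z. Phi z t * qf z (x0 t) * qf z (x0 t)) p"
    unfolding p_def by (intro balanced_qf p0)
  then obtain A' where A': "\<And>\<theta>. Phi (cis \<theta>) t * qf (cis \<theta>) (x0 t) * qf (cis \<theta>) (x0 t) = 1 + (1 - cis \<theta>) * A' \<theta>"
    "((\<lambda>\<theta>. cis \<theta> * A' \<theta>) has_integral of_real (pi * (1 - p))) {- pi..pi}"
    unfolding balanced_def has_tail_def by blast
  have p: "p \<ge> 0" unfolding p_def using p0 x0_le[of t] by simp
  have "ge_freq t (2 ^ (m + L)) \<ge> 1 / 2 + JJ t / (2 * pi) - 1 / 2 ^ m" for m
  proof -
    let ?f = "ge_freq t (2 ^ (m + L))"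
    obtain A where A: "\<And>\<theta>. GM (m + L) t (cis \<theta>) = 1 + (1 - cis \<theta>) * A \<theta>"
      "((\<lambda>\<theta>. cis \<theta> * A \<theta>) has_integral of_real (2 * pi * (1 - ?f))) {- pi..pi}"
      using has_tail_GM[of "m + L" t] unfolding has_tail_def by blast
    have "((\<lambda>\<theta>. Re (cis \<theta> * A \<theta> - cis \<theta> * A' \<theta>)) has_integral
        Re (of_real (2 * pi * (1 - ?f)) - of_real (pi * (1 - p)))) {- pi..pi}"
      by (intro has_integral_Re has_integral_diff A A')
    moreover have "Re (of_real (2 * pi * (1 - ?f)) - of_real (pi * (1 - p))) = 2 * pi * (1 - ?f) - pi * (1 - p)" by simp
    ultimately have R: "((\<lambda>\<theta>. Re (cis \<theta> * A \<theta> - cis \<theta> * A' \<theta>)) has_integral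
        2 * pi * (1 - ?f) - pi * (1 - p)) {- pi..pi}" by (simp only:)
    \<comment> \<open>At \<open>\<theta> = 0\<close> the quotients \<open>A\<close> and
      \<open>A'\<close> are unconstrained, so the integrand is overwritten there by a value for
      which the pointwise comparison holds.\<close>
    have 1: "((\<lambda>\<theta>. if \<theta> = 0 then 1 / 2 ^ m - Re (Ig t (cis 0)) else Re (cis \<theta> * A \<theta> - cis \<theta> * A' \<theta>)) has_integral
        2 * pi * (1 - ?f) - pi * (1 - p)) {- pi..pi}"
      by (rule has_integral_spike_finite[OF _ _ R, of "{0}"]) simp_all
    have 2: "((\<lambda>\<theta>. 1 / 2 ^ m - Re (Ig t (cis \<theta>))) has_integral (2 * pi) * (1 / 2 ^ m) - JJ t) {- pi..pi}"
      using has_integral_diff[OF has_integral_const_real[of "1 / 2 ^ m :: real" "- pi" pi] has_integral_JJ[of t]] by simp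
    have "2 * pi * (1 - ?f) - pi * (1 - p) \<le> (2 * pi) * (1 / 2 ^ m) - JJ t"
    proof (rule has_integral_le[OF 1 2])
      fix \<theta> assume \<theta>: "\<theta> \<in> {- pi..pi}"
      show "(if \<theta> = 0 then 1 / 2 ^ m - Re (Ig t (cis 0)) else Re (cis \<theta> * A \<theta> - cis \<theta> * A' \<theta>))
          \<le> 1 / 2 ^ m - Re (Ig t (cis \<theta>))"
      proof (cases "\<theta> = 0")
        case False
        let ?z = "cis \<theta>"
        have "\<bar>\<theta>\<bar> \<le> pi" using \<theta> by auto
        from norm_1_minus_cis_ge[OF this] False have w: "norm (1 - ?z) > 0" by linarith
        define e where "e = (GM (m + L) t ?z - chi0 ?z t) / (1 - ?z)"
        have e: "norm e \<le> 1 / 2 ^ m"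
          using L[of ?z m] w by (simp add: e_def norm_divide field_simps)
        have "(1 - ?z) * (A \<theta> - A' \<theta>) = GM (m + L) t ?z - Phi ?z t * qf ?z (x0 t) * qf ?z (x0 t)"
          unfolding A A' by (simp add: algebra_simps)
        also have "\<dots> = (1 - ?z) * (e + ((1 - ?z)\<^sup>2 * MMe ?z t + (1 - ?z) * SSe ?z t))"
        proof -
          have "(1 - ?z) * e = GM (m + L) t ?z - chi0 ?z t" using w by (simp add: e_def)
          then show ?thesis
            unfolding chi0_decomp[OF norm_cis] by (simp add: algebra_simps power2_eq_square power3_eq_cube)
        qed
        finally have D: "A \<theta> - A' \<theta> = e + ((1 - ?z)\<^sup>2 * MMe ?z t + (1 - ?z) * SSe ?z t)" using w by simp
        have "?z * A \<theta> - ?z * A' \<theta> = ?z * e - Ig t ?z"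
          unfolding right_diff_distrib[symmetric] D Ig_def by (simp add: distrib_left)
        moreover have "Re (?z * e) \<le> 1 / 2 ^ m"
          using e complex_Re_le_cmod[of "?z * e"] by (simp add: norm_mult)
        ultimately show ?thesis using False by simp
      qed simp
    qed
    then have "pi * (2 * (1 / 2 ^ m) - 2 * (1 - ?f) + 1) \<ge> JJ t + pi * p" by (simp add: algebra_simps)
    moreover have "pi * p \<ge> 0" using p by simp
    ultimately have "JJ t \<le> pi * (2 * (1 / 2 ^ m) - 2 * (1 - ?f) + 1)" by linarith
    then have "JJ t / pi \<le> 2 * (1 / 2 ^ m) - 2 * (1 - ?f) + 1" by (simp add: field_simps)
    then show ?thesis by (simp add: field_simps)
  qed
  then show ?thesis by blast
qed

lemma c_dens_ge: "c_dens t \<ge> 1 / 2 + JJ t / (2 * pi)"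
proof -
  obtain L where L: "\<And>m. ge_freq t (2 ^ (m + L)) \<ge> 1 / 2 + JJ t / (2 * pi) - 1 / 2 ^ m"
    using ge_freq_ge[of t] by blast
  have "strict_mono (\<lambda>m. 2 ^ (m + L) :: nat)" by (rule strict_monoI) simp
  from LIMSEQ_subseq_LIMSEQ[OF ge_freq_tendsto this]
  have 1: "(\<lambda>m. ge_freq t (2 ^ (m + L))) \<longlonglongrightarrow> c_dens t" by (simp add: o_def)
  have "(\<lambda>m. (1 / 2) ^ m :: real) \<longlonglongrightarrow> 0" by (rule LIMSEQ_realpow_zero) auto
  then have "(\<lambda>m. 1 / 2 + JJ t / (2 * pi) - (1 / 2) ^ m) \<longlonglongrightarrow> 1 / 2 + JJ t / (2 * pi) - 0"
    by (intro tendsto_diff tendsto_const)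
  then have 2: "(\<lambda>m. 1 / 2 + JJ t / (2 * pi) - 1 / 2 ^ m) \<longlonglongrightarrow> 1 / 2 + JJ t / (2 * pi)"
    by (simp add: power_divide)
  show ?thesis by (rule LIMSEQ_le[OF 2 1]) (use L in blast)
qed

section \<open>Elementary integrals of powers and Gaussians\<close>

lemma has_integral_abs_even:
  fixes f :: "real \<Rightarrow> real"
  assumes "(f has_integral I) {0..b}" "0 \<le> b"
  shows "((\<lambda>x. f \<bar>x\<bar>) has_integral 2 * I) {- b..b}"
proof -
  have "((\<lambda>x. f \<bar>x\<bar>) has_integral I) {0..b}"
    using assms(1) by (rule has_integral_eq[rotated]) auto
  moreover from has_integral_reflect_lemma_real[OF this] have "((\<lambda>x. f \<bar>x\<bar>) has_integral I) {- b..0}"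
    by simp
  ultimately have "((\<lambda>x. f \<bar>x\<bar>) has_integral I + I) {- b..b}"
    using assms(2) by (intro has_integral_combine[of "- b" 0 b]) auto
  then show ?thesis by simp
qed

lemma has_integral_abs_power:
  fixes b :: real
  assumes "0 \<le> b"
  shows "((\<lambda>x. \<bar>x\<bar> ^ m) has_integral 2 * (b ^ Suc m / real (Suc m))) {- b..b}"
proof -
  have "((\<lambda>x. x ^ m) has_integral b ^ Suc m / real (Suc m) - 0 ^ Suc m / real (Suc m)) {0..b}"
  proof (rule fundamental_theorem_of_calculus[OF assms])
    fix x :: real
    have "((\<lambda>x. x ^ Suc m / real (Suc m)) has_real_derivative x ^ m) (at x within {0..b})"
      by (auto intro!: derivative_eq_intros simp del: power_Suc of_nat_Suc)
    then show "((\<lambda>x. x ^ Suc m / real (Suc m)) has_vector_derivative x ^ m) (at x within {0..b})"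
      by (simp add: has_real_derivative_iff_has_vector_derivative)
  qed
  from has_integral_abs_even[OF this assms] show ?thesis by simp
qed

text \<open>The cubic weight makes the antiderivative elementary. With \<open>c\<close> proportional
  to \<open>s ^ 2\<close> the bound is of order \<open>s powr -4\<close>, one order below the
  surplus.\<close>

lemma integral_cube_gauss:
  fixes b c :: real
  assumes "c > 0" "0 \<le> b"
  shows "\<exists>I\<le>1 / c\<^sup>2. ((\<lambda>x. \<bar>x\<bar> ^ 3 * exp (- c * \<bar>x\<bar>\<^sup>2)) has_integral I) {- b..b}"
proof -
  let ?F = "\<lambda>x. - (x\<^sup>2 / (2 * c) + 1 / (2 * c\<^sup>2)) * exp (- c * x\<^sup>2)"
  have "((\<lambda>x. x ^ 3 * exp (- c * x\<^sup>2)) has_integral ?F b - ?F 0) {0..b}"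
  proof (rule fundamental_theorem_of_calculus[OF assms(2)])
    fix x :: real
    have "(?F has_real_derivative x ^ 3 * exp (- c * x\<^sup>2)) (at x within {0..b})"
      using assms(1)
      by (auto intro!: derivative_eq_intros simp: field_simps power2_eq_square power3_eq_cube)
    then show "(?F has_vector_derivative x ^ 3 * exp (- c * x\<^sup>2)) (at x within {0..b})"
      by (simp add: has_real_derivative_iff_has_vector_derivative)
  qed
  from has_integral_abs_even[OF this assms(2)]
  have "((\<lambda>x. \<bar>x\<bar> ^ 3 * exp (- c * \<bar>x\<bar>\<^sup>2)) has_integral 2 * (?F b - ?F 0)) {- b..b}" .
  moreover have "0 \<le> (b\<^sup>2 / (2 * c) + 1 / (2 * c\<^sup>2)) * exp (- c * b\<^sup>2)" using assms by simp
  moreover have "2 * (?F b - ?F 0) = 1 / c\<^sup>2 - 2 * ((b\<^sup>2 / (2 * c) + 1 / (2 * c\<^sup>2)) * exp (- c * b\<^sup>2))"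
    by (simp add: algebra_simps)
  ultimately have "((\<lambda>x. \<bar>x\<bar> ^ 3 * exp (- c * \<bar>x\<bar>\<^sup>2)) has_integral 2 * (?F b - ?F 0)) {- b..b}"
    "2 * (?F b - ?F 0) \<le> 1 / c\<^sup>2" by linarith+
  then show ?thesis by blast
qed

section \<open>Lower bounds for the integrand and for its integral\<close>

lemma GG_nonneg: "0 \<le> GG t"
  using zsum_nonneg[of gain t] gain_nonneg x0_nonneg[of t] x0_le_x1[of t] by (simp add: GG_def)

context
  fixes z :: complex and t :: nat
  assumes z: "norm z = 1"
begin

lemma Ig_split: "Ig t z = of_real ((norm (1 - z))\<^sup>2) * (z\<^sup>2 * MMe z t) - z * (1 - z) * SSe z t"
  unfolding Ig_def w_sq_eq[OF z] by (simp add: algebra_simps power2_eq_square)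

lemma Re_Ig_ge:
  assumes "Re (z\<^sup>2 * MMe z t) \<ge> c"
  shows "Re (Ig t z) \<ge> (norm (1 - z))\<^sup>2 * c - (64 * zsum dev t + 150) * (norm (1 - z) ^ 3 * tau z ^ falls t)"
proof -
  have "norm (z * (1 - z) * SSe z t) \<le> norm (1 - z) * ((64 * zsum dev t + 150) * (norm (1 - z))\<^sup>2 * tau z ^ falls t)"
    using norm_SSe_le[OF z, of t] z by (simp add: norm_mult mult_left_mono)
  then have "Re (z * (1 - z) * SSe z t) \<le> (64 * zsum dev t + 150) * (norm (1 - z) ^ 3 * tau z ^ falls t)"
    using complex_Re_le_cmod[of "z * (1 - z) * SSe z t"]
    by (simp add: power2_eq_square power3_eq_cube mult_ac)
  moreover have "(norm (1 - z))\<^sup>2 * c \<le> (norm (1 - z))\<^sup>2 * Re (z\<^sup>2 * MMe z t)"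
    using assms by (intro mult_left_mono) auto
  moreover have "Re (Ig t z) = (norm (1 - z))\<^sup>2 * Re (z\<^sup>2 * MMe z t) - Re (z * (1 - z) * SSe z t)"
  proof -
    have "Re (of_real a * u - v) = a * Re u - Re v" for a u v by simp
    then show ?thesis unfolding Ig_split .
  qed
  ultimately show ?thesis by linarith
qed

lemma Re_far: "Re (z\<^sup>2 * MMe z t) \<ge> - (3 * GG t * tau z ^ falls t)"
proof -
  have "\<bar>Re (z\<^sup>2 * MMe z t)\<bar> \<le> norm (MMe z t)"
    using abs_Re_le_cmod[of "z\<^sup>2 * MMe z t"] z by (simp add: norm_mult norm_power)
  then show ?thesis using norm_MMe_le[OF z, of t] by linarith
qed

text \<open>Replacing \<open>z\<^sup>2\<close> by 1 costs \<open>6 * \<sigma>\<close>, since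
  \<open>norm (1 - z\<^sup>2) \<le> 2 * \<sigma>\<close> and
  \<open>norm (MMe z t) \<le> 3 * GG t\<close>; the error \<open>2 * \<sigma>\<^sup>2\<close> is at
  most \<open>2 * \<sigma>\<close>.\<close>

lemma Re_near:
  assumes "norm (1 - z) \<le> 1"
  defines "\<sigma> \<equiv> norm (1 - z)" and "W \<equiv> zsum wt t + 2"
  shows "Re (z\<^sup>2 * MMe z t) \<ge> GG t * (max 0 (1 - \<sigma>\<^sup>2 * W) - W * \<sigma> ^ 3 - 8 * \<sigma>)"
proof -
  have "z\<^sup>2 * MMe z t - MMe z t = - ((1 - z) * (1 + z) * MMe z t)"
    by (simp add: power2_eq_square algebra_simps)
  then have "norm (z\<^sup>2 * MMe z t - MMe z t) = norm (1 - z) * norm (1 + z) * norm (MMe z t)"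
    by (simp only: norm_minus_cancel norm_mult)
  also have "\<dots> \<le> \<sigma> * 2 * (3 * GG t * 1)"
  proof (intro mult_mono)
    show "norm (1 + z) \<le> 2" using norm_triangle_ineq[of 1 z] z by simp
    have "3 * GG t * tau z ^ falls t \<le> 3 * GG t * 1"
      using GG_nonneg tau_power_pos[OF z] by (intro mult_left_mono) auto
    then show "norm (MMe z t) \<le> 3 * GG t * 1" using norm_MMe_le[OF z, of t] by linarith
  qed (auto simp: \<sigma>_def)
  finally have 1: "Re (z\<^sup>2 * MMe z t) \<ge> Re (MMe z t) - 6 * \<sigma> * GG t"
    using abs_Re_le_cmod[of "z\<^sup>2 * MMe z t - MMe z t"] by (simp add: mult_ac)
  have 2: "Re (MMe z t) \<ge> GG t * (max 0 (1 - \<sigma>\<^sup>2 * W) - (W * \<sigma> ^ 3 + 2 * \<sigma>\<^sup>2))"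
    using Re_MMe_ge[OF z assms(1), of t] by (simp add: \<sigma>_def W_def)
  have "\<sigma>\<^sup>2 \<le> \<sigma>" using assms(1) by (simp add: \<sigma>_def power2_eq_square mult_left_le)
  then have "GG t * (2 * \<sigma>\<^sup>2) \<le> GG t * (2 * \<sigma>)" using GG_nonneg by (intro mult_left_mono) auto
  then show ?thesis using 1 2 by (simp add: algebra_simps)
qed

end

text \<open>96 is \<open>24 * 4\<close>: the 24 from \<open>tau\<close>, the 4 from squaring
  \<open>\<bar>\<theta>\<bar> / 2 \<le> norm (1 - cis \<theta>)\<close>.\<close>

lemma tau_cis_le:
  assumes "\<bar>\<theta>\<bar> \<le> pi"
  shows "tau (cis \<theta>) ^ n \<le> exp (- (real n / 96) * \<bar>\<theta>\<bar>\<^sup>2)"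
proof -
  have "(\<bar>\<theta>\<bar> / 2)\<^sup>2 \<le> (norm (1 - cis \<theta>))\<^sup>2"
    using norm_1_minus_cis_ge[OF assms] by (intro power_mono) auto
  then have "tau (cis \<theta>) \<le> 1 + (- (\<bar>\<theta>\<bar>\<^sup>2 / 96))" by (simp add: tau_def power_divide)
  also have "\<dots> \<le> exp (- (\<bar>\<theta>\<bar>\<^sup>2 / 96))" by (rule exp_ge_add_one_self)
  finally have "tau (cis \<theta>) ^ n \<le> exp (- (\<bar>\<theta>\<bar>\<^sup>2 / 96)) ^ n"
    using tau_bounds[of "cis \<theta>"] by (intro power_mono) auto
  then show ?thesis by (simp add: exp_of_nat_mult[symmetric] mult_ac)
qed

text \<open>The contribution of \<open>\<bar>\<theta>\<bar> \<le> 1 / (50 * s)\<close>, with \<open>s\<close> the square root of the number of falls, is of order \<open>s powr -3\<close>.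
  The bounds beyond it are small against this for \<open>\<bar>\<theta>\<bar> \<le> R / s\<close> if \<open>s\<close> is large and for the remaining \<open>\<theta>\<close> if \<open>R\<close> is large.\<close>
lemma Re_Ig_cis_ge:
  assumes n: "n = falls t" "n > 0" and s: "s = sqrt (real n)" and R: "R \<ge> 1" "R \<le> s" and \<theta>: "\<bar>\<theta>\<bar> \<le> pi"
  shows "Re (Ig t (cis \<theta>)) \<ge> GG t / 8 * (if \<theta> \<in> {- (1 / (50 * s))..1 / (50 * s)} then \<bar>\<theta>\<bar>\<^sup>2 else 0)
     - GG t * (1010 * R\<^sup>2) * (if \<theta> \<in> {- (R / s)..R / s} then \<bar>\<theta>\<bar> ^ 3 else 0)
     - (3 * GG t * (s / R) + 64 * zsum dev t + 150) * (\<bar>\<theta>\<bar> ^ 3 * exp (- (real n / 96) * \<bar>\<theta>\<bar>\<^sup>2))"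
proof -
  let ?z = "cis \<theta>" and ?\<sigma> = "norm (1 - cis \<theta>)" and ?D = "64 * zsum dev t + 150"
  let ?X = "\<bar>\<theta>\<bar> ^ 3 * exp (- (real n / 96) * \<bar>\<theta>\<bar>\<^sup>2)"
  have s0: "s > 0" "s\<^sup>2 = real n" using n s by auto
  have \<sigma>: "0 \<le> ?\<sigma>" "?\<sigma> \<le> \<bar>\<theta>\<bar>" "\<bar>\<theta>\<bar> / 2 \<le> ?\<sigma>"
    using norm_1_minus_cis_le norm_1_minus_cis_ge[OF \<theta>] by auto
  have G: "0 \<le> GG t" by (rule GG_nonneg)
  have D: "0 \<le> ?D" using zsum_nonneg[OF dev_nonneg] by (simp add: add_nonneg_nonneg)
  have tX: "?\<sigma> ^ 3 * tau ?z ^ falls t \<le> ?X"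
    using \<sigma> tau_cis_le[OF \<theta>, of n] n tau_power_pos[of ?z] by (intro mult_mono power_mono) auto
  then have DX: "?D * (?\<sigma> ^ 3 * tau ?z ^ falls t) \<le> ?D * ?X" using D by (intro mult_left_mono)
  have X0: "0 \<le> ?X" by simp
  show ?thesis
  proof (cases "\<bar>\<theta>\<bar> \<le> R / s")
    case True
    have Rs: "R / s \<le> 1" using R s0 by simp
    have \<sigma>1: "?\<sigma> \<le> 1" using \<sigma> True Rs by linarith
    define W where "W = zsum wt t + 2"
    \<comment> \<open>1000 per fall comes from \<open>zsum_wt_le\<close>, and the summand 2 is at
      most \<open>2 * real n\<close>.\<close>
    have W: "0 \<le> W" "W \<le> 1002 * real n"
      using zsum_wt_le[of t] zsum_nonneg[OF wt_nonneg] n by (auto simp: W_def add_nonneg_nonneg)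
    define m where "m = max 0 (1 - ?\<sigma>\<^sup>2 * W)"
    have "\<bar>\<theta>\<bar>\<^sup>2 \<le> (R / s)\<^sup>2" using True by (intro power_mono) auto
    then have n\<theta>: "real n * \<bar>\<theta>\<bar>\<^sup>2 \<le> R\<^sup>2" using s0 n(2) by (simp add: power_divide field_simps)
    have "?\<sigma>\<^sup>2 * (W * ?\<sigma> ^ 3) \<le> \<bar>\<theta>\<bar>\<^sup>2 * (1002 * real n * \<bar>\<theta>\<bar> ^ 3)"
      using \<sigma> W by (intro mult_mono power_mono mult_nonneg_nonneg) auto
    also have "\<dots> = 1002 * (real n * \<bar>\<theta>\<bar>\<^sup>2) * \<bar>\<theta>\<bar> ^ 3" by simp
    also have "\<dots> \<le> 1002 * R\<^sup>2 * \<bar>\<theta>\<bar> ^ 3" using n\<theta> by (intro mult_right_mono mult_left_mono) auto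
    finally have e1: "?\<sigma>\<^sup>2 * (W * ?\<sigma> ^ 3) \<le> 1002 * R\<^sup>2 * \<bar>\<theta>\<bar> ^ 3" .
    have "?\<sigma>\<^sup>2 * (8 * ?\<sigma>) = 8 * ?\<sigma> ^ 3" by (simp add: power2_eq_square power3_eq_cube)
    also have "\<dots> \<le> 8 * R\<^sup>2 * \<bar>\<theta>\<bar> ^ 3"
      using \<sigma> R by (intro mult_mono power_mono) (auto simp: one_le_power)
    finally have e2: "?\<sigma>\<^sup>2 * (8 * ?\<sigma>) \<le> 8 * R\<^sup>2 * \<bar>\<theta>\<bar> ^ 3" .
    have e3: "(if \<theta> \<in> {- (1 / (50 * s))..1 / (50 * s)} then \<bar>\<theta>\<bar>\<^sup>2 else 0) / 8 \<le> ?\<sigma>\<^sup>2 * m"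
    proof (cases "\<theta> \<in> {- (1 / (50 * s))..1 / (50 * s)}")
      case True
      then have "\<bar>\<theta>\<bar> \<le> 1 / (50 * s)" by auto
      then have "?\<sigma>\<^sup>2 \<le> (1 / (50 * s))\<^sup>2" using \<sigma> by (intro power_mono) auto
      then have "?\<sigma>\<^sup>2 * W \<le> (1 / (50 * s))\<^sup>2 * (1002 * real n)" using W by (intro mult_mono) auto
      \<comment> \<open>The radius \<open>1 / (50 * s)\<close> is chosen to bring this below
        1/2.\<close>
      also have "\<dots> = 1002 / 2500" using n by (simp add: power_mult_distrib power_divide s0)
      finally have m: "1 / 2 \<le> m" unfolding m_def by simp
      have "(\<bar>\<theta>\<bar> / 2)\<^sup>2 \<le> ?\<sigma>\<^sup>2" using \<sigma> by (intro power_mono) auto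
      then have "(\<bar>\<theta>\<bar> / 2)\<^sup>2 * (1 / 2) \<le> ?\<sigma>\<^sup>2 * m" using m by (intro mult_mono) auto
      then show ?thesis using True by (simp add: power_divide)
    qed (auto simp: m_def)
    have "Re (?z\<^sup>2 * MMe ?z t) \<ge> GG t * (m - W * ?\<sigma> ^ 3 - 8 * ?\<sigma>)"
      unfolding m_def W_def by (rule Re_near[OF norm_cis \<sigma>1])
    from Re_Ig_ge[OF norm_cis this]
    have "Re (Ig t ?z) \<ge> ?\<sigma>\<^sup>2 * (GG t * (m - W * ?\<sigma> ^ 3 - 8 * ?\<sigma>)) - ?D * ?X" using DX by linarith
    moreover have "?\<sigma>\<^sup>2 * (GG t * (m - W * ?\<sigma> ^ 3 - 8 * ?\<sigma>))
        = GG t * (?\<sigma>\<^sup>2 * m - ?\<sigma>\<^sup>2 * (W * ?\<sigma> ^ 3) - ?\<sigma>\<^sup>2 * (8 * ?\<sigma>))"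
      by (simp add: algebra_simps)
    moreover have "GG t * (?\<sigma>\<^sup>2 * m - ?\<sigma>\<^sup>2 * (W * ?\<sigma> ^ 3) - ?\<sigma>\<^sup>2 * (8 * ?\<sigma>))
        \<ge> GG t * ((if \<theta> \<in> {- (1 / (50 * s))..1 / (50 * s)} then \<bar>\<theta>\<bar>\<^sup>2 else 0) / 8 - 1002 * R\<^sup>2 * \<bar>\<theta>\<bar> ^ 3 - 8 * R\<^sup>2 * \<bar>\<theta>\<bar> ^ 3)"
      using e1 e2 e3 G by (intro mult_left_mono diff_mono) auto
    moreover have "0 \<le> 3 * GG t * (s / R) * ?X" using G s0 R by (intro mult_nonneg_nonneg) auto
    moreover have "GG t * (q / 8 - 1002 * R\<^sup>2 * v - 8 * R\<^sup>2 * v) = GG t / 8 * q - GG t * (1010 * R\<^sup>2) * v" for q v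
      by (simp add: algebra_simps)
    moreover have "(3 * GG t * (s / R) + 64 * zsum dev t + 150) * ?X = 3 * GG t * (s / R) * ?X + ?D * ?X"
      by (simp only: distrib_right add.assoc)
    moreover have "\<theta> \<in> {- (R / s)..R / s}" using True by auto
    ultimately show ?thesis by (simp only: if_True)
  next
    case False
    have R0: "0 < R / s" using R s0 by simp
    have "1 / (50 * s) \<le> R / s" using R s0 by (simp add: field_simps)
    then have ni: "\<theta> \<notin> {- (1 / (50 * s))..1 / (50 * s)}" "\<theta> \<notin> {- (R / s)..R / s}"
      using False by auto
    \<comment> \<open>Outside the radius \<open>R / s\<close> this factor raises the quadratic
      weight to a cubic one, so the Gaussian integral used for \<open>SSe\<close> serves here too
      and gains \<open>1 / R\<close>.\<close>
    have "1 \<le> s / R * \<bar>\<theta>\<bar>" using False R s0 by (simp add: field_simps)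
    then have "?\<sigma>\<^sup>2 * 1 \<le> \<bar>\<theta>\<bar>\<^sup>2 * (s / R * \<bar>\<theta>\<bar>)" using \<sigma> by (intro mult_mono power_mono) auto
    also have "\<dots> = s / R * \<bar>\<theta>\<bar> ^ 3" by (simp add: power2_eq_square power3_eq_cube)
    finally have "?\<sigma>\<^sup>2 * tau ?z ^ falls t \<le> s / R * \<bar>\<theta>\<bar> ^ 3 * exp (- (real n / 96) * \<bar>\<theta>\<bar>\<^sup>2)"
      using tau_cis_le[OF \<theta>, of n] n tau_power_pos[of ?z] s0 R by (intro mult_mono) auto
    then have "3 * GG t * (?\<sigma>\<^sup>2 * tau ?z ^ falls t) \<le> 3 * GG t * (s / R * ?X)"
      using G by (intro mult_left_mono) auto
    moreover have "Re (Ig t ?z) \<ge> ?\<sigma>\<^sup>2 * (- (3 * GG t * tau ?z ^ falls t)) - ?D * ?X"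
      using Re_Ig_ge[OF norm_cis Re_far[OF norm_cis], of \<theta> t] DX by linarith
    moreover have "?\<sigma>\<^sup>2 * (- (3 * GG t * tau ?z ^ falls t)) = - (3 * GG t * (?\<sigma>\<^sup>2 * tau ?z ^ falls t))" by simp
    moreover have "(3 * GG t * (s / R) + 64 * zsum dev t + 150) * ?X = 3 * GG t * (s / R * ?X) + ?D * ?X"
      by (simp only: distrib_right add.assoc mult.assoc)
    ultimately show ?thesis using ni by (simp only: if_False mult_zero_right)
  qed
qed

lemma JJ_ge:
  assumes n: "n = falls t" "n > 0" and s: "s = sqrt (real n)" and R: "R \<ge> 1" "R \<le> s"
  shows "JJ t \<ge> GG t / 8 * (2 / 3 * (1 / (50 * s)) ^ 3) - GG t * (1010 * R\<^sup>2) * ((R / s) ^ 4 / 2)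
     - (3 * GG t * (s / R) + 64 * zsum dev t + 150) * (9216 / s ^ 4)"
proof -
  have s0: "s > 0" "s\<^sup>2 = real n" using n s by auto
  have s1: "s \<ge> 1" using R by simp
  let ?a = "1 / (50 * s)" and ?b = "R / s" and ?C = "3 * GG t * (s / R) + 64 * zsum dev t + 150"
  have pi1: "1 \<le> pi" using pi_gt3 by simp
  have a: "0 \<le> ?a" "?a \<le> pi"
  proof -
    have "?a \<le> 1" using s1 by (simp add: field_simps)
    then show "?a \<le> pi" using pi1 by simp
  qed (use s0 in simp)
  have b: "0 \<le> ?b" "?b \<le> pi"
  proof -
    have "?b \<le> 1" using R s0 by simp
    then show "?b \<le> pi" using pi1 by simp
  qed (use s0 R in simp)
  have C: "0 \<le> ?C"
    using GG_nonneg[of t] zsum_nonneg[OF dev_nonneg] s0 R by (intro add_nonneg_nonneg mult_nonneg_nonneg) auto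
  have 1: "((\<lambda>\<theta>. if \<theta> \<in> {- ?a..?a} then \<bar>\<theta>\<bar>\<^sup>2 else 0) has_integral 2 / 3 * ?a ^ 3) {- pi..pi}"
    using has_integral_abs_power[OF a(1), of 2] a
    by (subst has_integral_restrict) (auto simp: numeral_3_eq_3)
  have 2: "((\<lambda>\<theta>. if \<theta> \<in> {- ?b..?b} then \<bar>\<theta>\<bar> ^ 3 else 0) has_integral ?b ^ 4 / 2) {- pi..pi}"
    using has_integral_abs_power[OF b(1), of 3] b
    by (subst has_integral_restrict) (auto simp: eval_nat_numeral mult_ac)
  obtain I where I: "I \<le> 1 / (real n / 96)\<^sup>2"
    "((\<lambda>\<theta>. \<bar>\<theta>\<bar> ^ 3 * exp (- (real n / 96) * \<bar>\<theta>\<bar>\<^sup>2)) has_integral I) {- pi..pi}"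
    using integral_cube_gauss[of "real n / 96" pi] n by auto
  have I': "I \<le> 9216 / s ^ 4"
  proof -
    have "s ^ 4 = (real n)\<^sup>2" using s0 by (simp add: power4_eq_xxxx power2_eq_square)
    then show ?thesis using I(1) by (simp add: power_divide)
  qed
  have "GG t / 8 * (2 / 3 * ?a ^ 3) - GG t * (1010 * R\<^sup>2) * (?b ^ 4 / 2) - ?C * I \<le> JJ t"
  proof (rule has_integral_le)
    show "((\<lambda>\<theta>. GG t / 8 * (if \<theta> \<in> {- ?a..?a} then \<bar>\<theta>\<bar>\<^sup>2 else 0)
       - GG t * (1010 * R\<^sup>2) * (if \<theta> \<in> {- ?b..?b} then \<bar>\<theta>\<bar> ^ 3 else 0)
       - ?C * (\<bar>\<theta>\<bar> ^ 3 * exp (- (real n / 96) * \<bar>\<theta>\<bar>\<^sup>2))) has_integral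
       GG t / 8 * (2 / 3 * ?a ^ 3) - GG t * (1010 * R\<^sup>2) * (?b ^ 4 / 2) - ?C * I) {- pi..pi}"
      by (intro has_integral_diff has_integral_mult_right 1 2 I)
    show "((\<lambda>\<theta>. Re (Ig t (cis \<theta>))) has_integral JJ t) {- pi..pi}" by (rule has_integral_JJ)
  qed (rule Re_Ig_cis_ge[OF n s R], auto)
  moreover have "?C * I \<le> ?C * (9216 / s ^ 4)" using C I' by (intro mult_left_mono)
  ultimately show ?thesis by linarith
qed

lemma GG_ge: "odd t \<Longrightarrow> GG t \<ge> 2"
  using x1_odd_ge[of t] zsum_nonneg[of gain t] gain_nonneg by (simp add: GG_def)

text \<open>\<open>zsum_dev_le\<close> is applied with \<open>L = \<epsilon> * s\<close>, so that
  the falls contribute only the constant \<open>1 / \<epsilon>\<^sup>2\<close>; constants are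
  absorbed into \<open>GG t\<close> by \<open>GG t \<ge> 2\<close>.\<close>

lemma JJ_ge':
  assumes t: "odd t" and n: "n = falls t" "n > 0" and s: "s = sqrt (real n)" and R: "R \<ge> 1" "R \<le> s"
    and \<epsilon>: "\<epsilon> > 0" "\<epsilon> * s \<ge> 1"
  shows "JJ t \<ge> GG t / s ^ 3 * (1 / 1500000 - 27648 / R - 75497472 * \<epsilon>
     - (505 * R ^ 6 + 37748736 / \<epsilon>\<^sup>2 + 691200) / s)"
proof -
  have s0: "s > 0" "s\<^sup>2 = real n" using n s by auto
  have G: "GG t \<ge> 2" by (rule GG_ge[OF t])
  have g: "0 \<le> zsum gain t" "zsum gain t \<le> GG t"
    using zsum_nonneg[of gain t] gain_nonneg x1_odd_ge[OF t] by (auto simp: GG_def)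
  have "zsum dev t \<le> 128 * (\<epsilon> * s * zsum gain t + real (falls t) / (\<epsilon> * s)\<^sup>2)"
    by (rule zsum_dev_le[OF \<epsilon>(2)])
  also have "\<dots> = 128 * (\<epsilon> * s * zsum gain t + 1 / \<epsilon>\<^sup>2)"
    using s0 n \<epsilon> by (simp add: power_mult_distrib)
  also have "\<dots> \<le> 128 * (\<epsilon> * s * GG t + GG t / 2 * (1 / \<epsilon>\<^sup>2))"
  proof -
    have "1 * (1 / \<epsilon>\<^sup>2) \<le> GG t / 2 * (1 / \<epsilon>\<^sup>2)" using G by (intro mult_right_mono) auto
    then show ?thesis using g \<epsilon> s0 by (intro mult_left_mono add_mono) auto
  qed
  finally have "zsum dev t \<le> 128 * (\<epsilon> * s * GG t + GG t / 2 * (1 / \<epsilon>\<^sup>2))" .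
  moreover have "GG t * (8192 * \<epsilon> * s + 4096 / \<epsilon>\<^sup>2 + 75)
      = 8192 * (\<epsilon> * s * GG t + GG t / 2 * (1 / \<epsilon>\<^sup>2)) + 75 * GG t"
    by (simp add: algebra_simps)
  ultimately have d: "64 * zsum dev t + 150 \<le> GG t * (8192 * \<epsilon> * s + 4096 / \<epsilon>\<^sup>2 + 75)"
    using G by linarith
  have "(3 * GG t * (s / R) + 64 * zsum dev t + 150) * (9216 / s ^ 4)
      \<le> (3 * GG t * (s / R) + GG t * (8192 * \<epsilon> * s + 4096 / \<epsilon>\<^sup>2 + 75)) * (9216 / s ^ 4)"
    using d s0 by (intro mult_right_mono) auto
  \<comment> \<open>\<open>1 / 1500000 = 1 / 8 * (2 / 3) / 50 ^ 3\<close>. The other large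
    constants, apart from 505, are multiples of \<open>9216 = 96 ^ 2\<close>, with factors 3,
    \<open>64 * 128\<close>, \<open>64 * 128 / 2\<close> and 75.\<close>
  moreover have "GG t / 8 * (2 / 3 * (1 / (50 * s)) ^ 3) - GG t * (1010 * R\<^sup>2) * ((R / s) ^ 4 / 2)
      - (3 * GG t * (s / R) + GG t * (8192 * \<epsilon> * s + 4096 / \<epsilon>\<^sup>2 + 75)) * (9216 / s ^ 4)
      = GG t / s ^ 3 * (1 / 1500000 - 27648 / R - 75497472 * \<epsilon>
     - (505 * R ^ 6 + 37748736 / \<epsilon>\<^sup>2 + 691200) / s)"
  proof -
    have nz: "s \<noteq> 0" "R \<noteq> 0" "\<epsilon> \<noteq> 0" using s0 R \<epsilon> by auto
    then show ?thesis by (simp add: divide_simps) algebra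
  qed
  ultimately show ?thesis using JJ_ge[OF n s R] by linarith
qed

lemma JJ_pos: "\<exists>N. \<forall>t. odd t \<and> falls t \<ge> N \<longrightarrow> JJ t > 0"
proof -
  \<comment> \<open>With these choices \<open>27648 / R\<close>,
    \<open>75497472 * \<epsilon>\<close> and later \<open>B / s\<close> are each at most
    \<open>10 powr -7\<close>, in total less than \<open>1 / 1500000\<close>.\<close>
  define R :: real where "R = 10 ^ 12"
  define \<epsilon> :: real where "\<epsilon> = 1 / 10 ^ 15"
  define B :: real where "B = 505 * R ^ 6 + 37748736 / \<epsilon>\<^sup>2 + 691200"
  have B0: "B > 0" unfolding B_def R_def \<epsilon>_def by (intro add_pos_pos) auto
  define S where "S = R + 1 / \<epsilon> + 10 ^ 7 * B"
  have S0: "R \<le> S" "1 / \<epsilon> \<le> S" "10 ^ 7 * B \<le> S" "0 \<le> S" using B0 by (auto simp: S_def R_def \<epsilon>_def)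
  obtain N :: nat where N: "S\<^sup>2 < real N" using reals_Archimedean2 by blast
  have "JJ t > 0" if t: "odd t" "falls t \<ge> N" for t
  proof -
    define n where "n = falls t"
    define s where "s = sqrt (real n)"
    have "S\<^sup>2 < real n" using N t(2) by (simp add: n_def)
    then have "S < s" unfolding s_def by (rule real_less_rsqrt)
    have n: "n > 0" using \<open>S\<^sup>2 < real n\<close> by (cases n) (auto simp: not_less)
    have s0: "s > 0" using n by (simp add: s_def)
    have Rs: "R \<le> s" "1 / \<epsilon> \<le> s" "10 ^ 7 * B \<le> s" using S0 \<open>S < s\<close> by auto
    have e: "\<epsilon> > 0" "\<epsilon> * s \<ge> 1" using Rs(2) by (auto simp: \<epsilon>_def field_simps)
    have "R \<ge> 1" by (simp add: R_def)
    note * = JJ_ge'[OF t(1) n_def n s_def this Rs(1) e]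
    have "B / s \<le> 1 / 10 ^ 7" using Rs(3) s0 by (simp add: field_simps)
    then have "1 / 1500000 - 27648 / R - 75497472 * \<epsilon> - B / s > 0" by (simp add: R_def \<epsilon>_def)
    moreover have "GG t / s ^ 3 > 0" using GG_ge[OF t(1)] s0 by simp
    ultimately have "0 < GG t / s ^ 3 * (1 / 1500000 - 27648 / R - 75497472 * \<epsilon> - B / s)"
      by (intro mult_pos_pos)
    then show ?thesis using * unfolding B_def by linarith
  qed
  then show ?thesis by blast
qed

section \<open>Reduction to odd \<open>t\<close> and the count of blocks\<close>

lemma c_dens_double: "c_dens (2 * t) = c_dens t"
proof -
  have "ge_freq (2 * t) (2 ^ Suc M) = ge_freq t (2 ^ M)" for M
  proof -
    have "2 * n + 2 * t = 2 * (n + t)" "Suc (2 * n) + 2 * t = Suc (2 * (n + t))" for n by simp_all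
    then have "ge_ind (2 * t) (2 * n) + ge_ind (2 * t) (Suc (2 * n)) = 2 * ge_ind t n" for n
      unfolding ge_ind_def by (simp only: binsum_simps) simp
    then have "(\<Sum>n<2 * 2 ^ M. ge_ind (2 * t) n) = 2 * (\<Sum>n<2 ^ M. ge_ind t n)"
      unfolding sum_lessThan_double by (simp add: sum_distrib_left)
    then show ?thesis by (simp add: ge_freq_def)
  qed
  moreover have "(\<lambda>M. ge_freq t (2 ^ M)) \<longlonglongrightarrow> c_dens t"
    using LIMSEQ_subseq_LIMSEQ[OF ge_freq_tendsto, of "\<lambda>M. 2 ^ M"] by (simp add: o_def strict_mono_def)
  moreover have "(\<lambda>M. ge_freq (2 * t) (2 ^ Suc M)) \<longlonglongrightarrow> c_dens (2 * t)"
    using LIMSEQ_subseq_LIMSEQ[OF ge_freq_tendsto, of "\<lambda>M. 2 ^ Suc M"] by (simp add: o_def strict_mono_def)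
  ultimately show ?thesis by (simp add: LIMSEQ_unique)
qed

lemma num_blocks_eq_blocks: "num_blocks t = blocks t"
proof -
  define S where "S t = {mu. bdigit t mu = 1 \<and> (mu = 0 \<or> bdigit t (mu - 1) = 0)}" for t
  have dig: "bdigit (2 * t) 0 = 0" "bdigit (Suc (2 * t)) 0 = 1" "bdigit 0 i = 0"
    "bdigit (2 * t) (Suc i) = bdigit t i" "bdigit (Suc (2 * t)) (Suc i) = bdigit t i" for t i
    by (simp_all add: bdigit_def div_mult2_eq)
  have d0: "bdigit t 0 = (if even t then 0 else 1)" for t
    by (simp add: bdigit_def mod2_eq_if)
  have "finite (S t) \<and> card (S t) = blocks t"
  proof (induction t rule: bin_induct)
    case zero
    then show ?case by (simp add: S_def dig)
  next
    case (even t)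
    have "S (2 * t) = Suc ` S t"
    proof (rule set_eqI)
      fix i show "i \<in> S (2 * t) \<longleftrightarrow> i \<in> Suc ` S t"
      proof (cases i)
        case (Suc j)
        then show ?thesis by (cases j) (auto simp: S_def dig)
      qed (auto simp: S_def dig)
    qed
    then show ?case using even by (simp add: card_image)
  next
    case (odd t)
    \<comment> \<open>A block starting at position 0 of \<open>t\<close> is extended downwards by
      the new one, so its old starting point is dropped.\<close>
    have e: "S (Suc (2 * t)) = insert 0 (Suc ` (S t - {0}))"
    proof (rule set_eqI)
      fix i show "i \<in> S (Suc (2 * t)) \<longleftrightarrow> i \<in> insert 0 (Suc ` (S t - {0}))"
      proof (cases i)
        case (Suc j)
        then show ?thesis by (cases j) (auto simp: S_def dig)
      qed (auto simp: S_def dig)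
    qed
    have fin: "finite (S (Suc (2 * t)))" unfolding e using odd by simp
    have c: "card (S (Suc (2 * t))) = Suc (card (S t - {0}))"
      unfolding e using odd by (subst card_insert_disjoint) (auto simp: card_image)
    have z: "0 \<in> S t \<longleftrightarrow> odd t" by (simp add: S_def d0)
    have "Suc (card (S t - {0})) = blocks (Suc (2 * t))"
    proof (cases "even t")
      case True
      with z have "S t - {0} = S t" by simp
      then show ?thesis using odd True by simp
    next
      case False
      then have "card (S t - {0}) = blocks t - 1" using z odd by (simp add: card_Diff_singleton)
      then show ?thesis using False blocks_pos[OF False] by simp
    qed
    then show ?case using fin c by simp
  qed
  then show ?thesis by (simp add: num_blocks_def S_def)
qed

theorem theorem1p1:
  shows "\<exists>M0::nat. \<forall>t::nat. num_blocks t \<ge> M0 \<longrightarrow> c_dens t > 1/2"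
proof -
  obtain N where N: "\<And>t. odd t \<Longrightarrow> falls t \<ge> N \<Longrightarrow> JJ t > 0" using JJ_pos by blast
  \<comment> \<open>\<open>Suc N\<close> because in an odd number the lowest block has no zero below
    it, so there is one fall less than there are blocks.\<close>
  have "blocks t \<ge> Suc N \<longrightarrow> c_dens t > 1 / 2" for t
  proof (induction t rule: bin_induct)
    case (odd t)
    show ?case
    proof
      assume "blocks (Suc (2 * t)) \<ge> Suc N"
      then have "falls (Suc (2 * t)) \<ge> N" by (simp add: falls_def)
      then have "JJ (Suc (2 * t)) / (2 * pi) > 0" by (intro divide_pos_pos N) auto
      then show "c_dens (Suc (2 * t)) > 1 / 2" using c_dens_ge[of "Suc (2 * t)"] by linarith
    qed
  qed (simp_all add: c_dens_double)
  then show ?thesis unfolding num_blocks_eq_blocks by blast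
qed

end
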